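(* Let $K_1=\langle x_0,\ x_1x_2x_1^{-1},\ x_1^2x_2^{-1}\rangle\le F$ and $K_3=\langle x_0,\ x_1x_2x_1^{-3},\ x_1x_2x_3x_2^{-3}x_1^{-1}\rangle\le F$. Let $\mathcal F\le F$ be Jones's 3-colorable subgroup, let $\sigma$ be the automorphism of $F$ induced by $t\mapsto 1-t$, and let $$M_0=\langle \mathcal F,x_0^2\rangle,\qquad M_1=\langle \mathcal F,x_1^2\rangle,\qquad M_2=\langle \mathcal F,\sigma(x_1)^2\rangle$$ be the Aiello--Nagnibeda subgroups of $F$. Let $\psi_{K_1},\psi_0,\psi_1:\mathcal C_3\to\mathcal C_2$ and $\psi_{K_3}:\mathcal C_2\to\mathcal C_2$ be the homeomorphisms represented by the transducers $T_{K_1},T_{M_0},T_{M_1}$ and $T_{K_3}$ given in the context. Then $$K_1=F_3^{\psi_{K_1}}\cong F_3,\qquad K_3=F^{\psi_{K_3}}\cong F,\qquad M_0=F_3^{\psi_0}\cong F_3,\qquad M_1=F_3^{\psi_1}\cong F_3,$$ and, since $M_2=\sigma(M_1)$, also $M_2\cong F_3$.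
   Context: For $n\ge2$, $\mathcal C_n=\{0,\dots,n-1\}^{\mathbb N}$, and $F_n$ is the group of order-preserving (for the lexicographic order) homeomorphisms $f$ of $\mathcal C_n$ for which there are finite complete prefix codes $\{u_1<\dots<u_k\}$, $\{v_1<\dots<v_k\}$ (complete: the corresponding cylinders partition $\mathcal C_n$) with $f(u_i\omega)=v_i\omega$ for all $i$ and all $\omega\in\mathcal C_n$. Equivalently, $F_n$ is the group of increasing piecewise-linear homeomorphisms of $[0,1]$ with breakpoints in $\mathbb Z[1/n]$ and slopes integer powers of $n$. The two codes are the leaf sets of two finite full $n$-ary trees $T_+,T_-$, and the pair $(T_+,T_-)$ is a tree diagram of $f$. $F=F_2$. For a homeomorphism $\psi:\mathcal C_n\to\mathcal C_2$, $F_n^\psi=\{\omega\mapsto\psi(f(\psi^{-1}(\omega))):f\in F_n\}$. Products are composed left to right, $(fg)(t)=g(f(t))$. In $F$: $x_0$: $00\eta\mapsto0\eta$, $01\eta\mapsto10\eta$, $1\eta\mapsto11\eta$; $x_1$: $0\eta\mapsto0\eta$, $100\eta\mapsto10\eta$, $101\eta\mapsto110\eta$, $11\eta\mapsto111\eta$; $x_{k+1}=x_0^{-1}x_kx_0$ for $k\ge1$. The automorphism $\sigma$ of $F$ is conjugation by the homeomorphism $t\mapsto1-t$ of $[0,1]$. Jones's 3-colorable subgroup $\mathcal F\le F$: given a tree diagram $(T_+,T_-)$ of $f\in F$, draw $T_+$ with its root at the top and $T_-$ upside down below it, glue the corresponding leaves in left-to-right order, and join the two roots by vertical segments to the top and bottom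 sides of a horizontal strip containing the picture. This planar graph divides the strip into regions. Then $f\in\mathcal F$ if and only if the regions can be coloured with three colours so that any two regions sharing an edge have different colours (this does not depend on the chosen diagram of $f$). Transducers: an entry $i\mid w\to s'$ in the row of $s$ means that in state $s$ on input letter $i$ the machine outputs the word $w$ and moves to $s'$; $\varepsilon$ is the empty word. The represented map sends an infinite input word to the infinite output word produced from the initial state. $T_{K_1}$ (input alphabet $\{0,1,2\}$, initial state $\mathsf E$): $\mathsf E$: $0\mid0\to\mathsf A$, $1\mid100\to\mathsf K$, $2\mid1\to\mathsf G$; $\mathsf A$: $0\mid0\to\mathsf A$, $1\mid10\to\mathsf K$, $2\mid11\to\mathsf A$; $\mathsf K$: $0\mid00\to\mathsf K$, $1\mid01\to\mathsf A$, $2\mid1\to\mathsf K$; $\mathsf G$: $0\mid01\to\mathsf A$, $1\mid100\to\mathsf K$, $2\mid1\to\mathsf G$. $T_{K_3}$ (input alphabet $\{0,1\}$, initial state $e$): $e$: $0\mid0\to f$, $1\mid1\to g$; $f$: $0\mid0\to f$, $1\mid1\to h$; $g$: $0\mid0\to h$, $1\mid1\to g$; $h$: $0\mid0\to k$, $1\mid1\to h$; $k$: $0\mid00\to k$, $1\mid\varepsilon\to m$; $m$: $0\mid01\to k$, $1\mid1\to h$. $T_{M_0}$ (input alphabet $\{0,1,2\}$, initial state $\mathsf X$): $\mathsf X$: $0\mid00\to\mathsf X$, $1\mid01\to\mathsf Y$, $2\mid1\to\mathsf Z$; $\mathsf Y$: $0\mid00\to\mathsf Y$, $1\mid01\to\mathsf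 Z$, $2\mid1\to\mathsf Y$; $\mathsf Z$: $0\mid0\to\mathsf Z$, $1\mid10\to\mathsf Y$, $2\mid11\to\mathsf Z$. $T_{M_1}$ (input alphabet $\{0,1,2\}$, initial state $\mathsf E$): $\mathsf E$: $0\mid0\to\mathsf L$, $1\mid10\to\mathsf A$, $2\mid11\to\mathsf B$; $\mathsf L$: $0\mid00\to\mathsf L$, $1\mid010\to\mathsf A$, $2\mid\varepsilon\to\mathsf O$; $\mathsf A$: $0\mid00\to\mathsf A$, $1\mid01\to\mathsf B$, $2\mid1\to\mathsf A$; $\mathsf B$: $0\mid0\to\mathsf B$, $1\mid10\to\mathsf A$, $2\mid11\to\mathsf B$; $\mathsf O$: $0\mid011\to\mathsf B$, $1\mid10\to\mathsf A$, $2\mid11\to\mathsf B$. *)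

theory Defs
  imports
    "HOL-Analysis.Analysis"
    "HOL-Algebra.Generated_Groups"
    "HOL-Library.Omega_Words_Fun"
    "HOL-Library.Fun_Lexorder"
begin

section \<open>Cantor spaces and the Brown--Thompson groups\<close>

definition cantor_set :: "nat \<Rightarrow> nat word set" where
  "cantor_set n = {\<omega>. \<forall>i. \<omega> i < n}"

definition cantor_space :: "nat \<Rightarrow> nat word topology" where
  "cantor_space n = product_topology (\<lambda>_. discrete_topology {..<n}) UNIV"

lemma topspace_cantor_space: "topspace (cantor_space n) = cantor_set n"
  by (auto simp: cantor_space_def cantor_set_def PiE_iff)

definition cylinder :: "nat \<Rightarrow> nat list \<Rightarrow> nat word set" where
  "cylinder n u = {u \<frown> \<omega> | \<omega>. \<omega> \<in> cantor_set n}"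

text \<open>The increasing list of the elements of a finite complete prefix code. The words are
  pairwise incomparable for the prefix order, because their cylinders are disjoint.\<close>

definition complete_prefix_code :: "nat \<Rightarrow> nat list list \<Rightarrow> bool" where
  "complete_prefix_code n us \<longleftrightarrow>
     set us \<subseteq> lists {..<n} \<and>
     sorted_wrt (\<lambda>u v. (u, v) \<in> lexord {(a, b). a < b}) us \<and>
     disjoint_family_on (cylinder n) (set us) \<and>
     (\<Union>u\<in>set us. cylinder n u) = cantor_set n"

definition replaces_prefixes ::
    "nat \<Rightarrow> (nat word \<Rightarrow> nat word) \<Rightarrow> nat list list \<Rightarrow> nat list list \<Rightarrow> bool" where
  "replaces_prefixes n f us vs \<longleftrightarrow>
     length us = length vs \<and>
     (\<forall>i < length us. \<forall>\<omega> \<in> cantor_set n. f (us ! i \<frown> \<omega>) = vs ! i \<frown> \<omega>)"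

text \<open>Homeomorphisms are represented by extensional functions, so that equality of group elements is equality of maps on the Cantor space. The product is
  composition from left to right, opposite to \<^const>\<open>compose\<close>. The definition is meant
  for \<open>n \<ge> 2\<close>.\<close>

definition thompson :: "nat \<Rightarrow> (nat word \<Rightarrow> nat word) monoid" where
  "thompson n =
     \<lparr>carrier = {f \<in> extensional (cantor_set n).
         homeomorphic_map (cantor_space n) (cantor_space n) f \<and>
         (\<forall>x \<in> cantor_set n. \<forall>y \<in> cantor_set n. less_fun x y \<longrightarrow> less_fun (f x) (f y)) \<and>
         (\<exists>us vs. complete_prefix_code n us \<and> complete_prefix_code n vs \<and>
            replaces_prefixes n f us vs)},
      monoid.mult = (\<lambda>f g. compose (cantor_set n) g f),
      one = (\<lambda>\<omega> \<in> cantor_set n. \<omega>)\<rparr>"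

definition conjugated_thompson ::
    "nat \<Rightarrow> (nat word \<Rightarrow> nat word) \<Rightarrow> (nat word \<Rightarrow> nat word) set" where
  "conjugated_thompson n \<psi> =
     (\<lambda>f. \<lambda>\<omega> \<in> cantor_set 2. \<psi> (f (inv_into (cantor_set n) \<psi> \<omega>))) ` carrier (thompson n)"

section \<open>Elements and subgroups of Thompson's group F\<close>

abbreviation thompson_F :: "(nat word \<Rightarrow> nat word) monoid" where
  "thompson_F \<equiv> thompson 2"

definition x_0 :: "nat word \<Rightarrow> nat word" where
  "x_0 = (\<lambda>\<omega> \<in> cantor_set 2.
     if \<omega> 0 = 0 then
       if \<omega> 1 = 0 then [0] \<frown> suffix 2 \<omega> else [1, 0] \<frown> suffix 2 \<omega>
     else [1, 1] \<frown> suffix 1 \<omega>)"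

definition x_1 :: "nat word \<Rightarrow> nat word" where
  "x_1 = (\<lambda>\<omega> \<in> cantor_set 2.
     if \<omega> 0 = 0 then \<omega>
     else if \<omega> 1 = 0 then
       if \<omega> 2 = 0 then [1, 0] \<frown> suffix 3 \<omega> else [1, 1, 0] \<frown> suffix 3 \<omega>
     else [1, 1, 1] \<frown> suffix 2 \<omega>)"

fun x_gen :: "nat \<Rightarrow> nat word \<Rightarrow> nat word" where
  "x_gen 0 = x_0"
| "x_gen (Suc 0) = x_1"
| "x_gen (Suc (Suc k)) =
     inv\<^bsub>thompson_F\<^esub> x_gen 0 \<otimes>\<^bsub>thompson_F\<^esub> x_gen (Suc k) \<otimes>\<^bsub>thompson_F\<^esub> x_gen 0"

text \<open>The map \<open>t \<mapsto> 1 - t\<close> of the unit interval is, on binary expansions, the exchange of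
  the digits 0 and 1; see the lemma below.\<close>

definition flip :: "nat word \<Rightarrow> nat word" where
  "flip \<omega> = (\<lambda>i. 1 - \<omega> i)"

lemma flip_binary_value:
  assumes "\<omega> \<in> cantor_set 2"
  shows "(\<Sum>i. real (flip \<omega> i) * (1/2) ^ Suc i) = 1 - (\<Sum>i. real (\<omega> i) * (1/2) ^ Suc i)"
proof -
  have d: "real (flip \<omega> i) = 1 - real (\<omega> i)" "real (\<omega> i) \<le> 1" for i
    using assms by (auto simp: flip_def cantor_set_def less_2_cases_iff dest!: spec[of _ i])
  have g: "(\<lambda>i. (1/2 :: real) ^ Suc i) sums 1"
    by (rule power_half_series)
  have s: "summable (\<lambda>i. real (\<omega> i) * (1/2) ^ Suc i)"
    by (rule summable_comparison_test'[OF sums_summable[OF g], of 0])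
      (use d(2) in \<open>auto simp: abs_mult intro!: mult_left_le_one_le\<close>)
  have "(\<Sum>i. real (flip \<omega> i) * (1/2) ^ Suc i)
      = (\<Sum>i. (1/2) ^ Suc i - real (\<omega> i) * (1/2) ^ Suc i)"
    unfolding d(1) left_diff_distrib mult_1 ..
  also have "\<dots> = 1 - (\<Sum>i. real (\<omega> i) * (1/2) ^ Suc i)"
    by (intro sums_unique[symmetric] sums_diff g summable_sums s)
  finally show ?thesis .
qed

definition sigma_F :: "(nat word \<Rightarrow> nat word) \<Rightarrow> nat word \<Rightarrow> nat word" where
  "sigma_F f = (\<lambda>\<omega> \<in> cantor_set 2. flip (f (flip \<omega>)))"

subsection \<open>Tree diagrams and the 3-colorable subgroup\<close>

datatype bintree = Leaf | Caret bintree bintree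

fun leaves :: "bintree \<Rightarrow> nat list list" where
  "leaves Leaf = [[]]"
| "leaves (Caret l r) = map ((#) 0) (leaves l) @ map ((#) 1) (leaves r)"

definition tree_diagram :: "(nat word \<Rightarrow> nat word) \<Rightarrow> bintree \<Rightarrow> bintree \<Rightarrow> bool" where
  "tree_diagram f S T \<longleftrightarrow> replaces_prefixes 2 f (leaves S) (leaves T)"

text \<open>In the strip, two trees with \<open>k\<close> leaves glued along their leaves cut out \<open>k + 1\<close> regions,
  one passing through each gap between horizontally consecutive leaves: region \<open>j\<close> lies
  between leaves \<open>j - 1\<close> and \<open>j\<close> (leaves being numbered from 0), region \<open>0\<close> is to the left and
  region \<open>k\<close> to the right of the whole picture. The edge ending at the top of a subtree
  whose leaves are those numbered from \<open>i\<close> to \<open>j - 1\<close> has region \<open>i\<close> on its left and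
  region \<open>j\<close> on its right; for the whole tree this edge is the vertical segment joining the
  root to the boundary of the strip. Turning the lower tree upside down does not change left
  and right. \<open>edge_sides i T\<close> lists these pairs of regions for all edges of \<open>T\<close>, where \<open>i\<close> is
  the number of the leftmost leaf of \<open>T\<close>.\<close>

fun edge_sides :: "nat \<Rightarrow> bintree \<Rightarrow> (nat \<times> nat) set" where
  "edge_sides i Leaf = {(i, i + 1)}"
| "edge_sides i (Caret l r) =
     {(i, i + length (leaves (Caret l r)))} \<union>
     edge_sides i l \<union> edge_sides (i + length (leaves l)) r"

definition three_colorable :: "bintree \<Rightarrow> bintree \<Rightarrow> bool" where
  "three_colorable S T \<longleftrightarrow>
     (\<exists>c :: nat \<Rightarrow> nat. c ` {0..length (leaves S)} \<subseteq> {0, 1, 2} \<and>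
        (\<forall>(p, q) \<in> edge_sides 0 S \<union> edge_sides 0 T. c p \<noteq> c q))"

definition jones_subgroup :: "(nat word \<Rightarrow> nat word) set" where
  "jones_subgroup =
     {f \<in> carrier thompson_F. \<exists>S T. tree_diagram f S T \<and> three_colorable S T}"

subsection \<open>The subgroups\<close>

definition K1 :: "(nat word \<Rightarrow> nat word) set" where
  "K1 = generate thompson_F
     {x_gen 0,
      x_gen 1 \<otimes>\<^bsub>thompson_F\<^esub> x_gen 2 \<otimes>\<^bsub>thompson_F\<^esub> inv\<^bsub>thompson_F\<^esub> x_gen 1,
      x_gen 1 [^]\<^bsub>thompson_F\<^esub> (2::int) \<otimes>\<^bsub>thompson_F\<^esub> inv\<^bsub>thompson_F\<^esub> x_gen 2}"

definition K3 :: "(nat word \<Rightarrow> nat word) set" where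
  "K3 = generate thompson_F
     {x_gen 0,
      x_gen 1 \<otimes>\<^bsub>thompson_F\<^esub> x_gen 2 \<otimes>\<^bsub>thompson_F\<^esub> x_gen 1 [^]\<^bsub>thompson_F\<^esub> (- 3::int),
      x_gen 1 \<otimes>\<^bsub>thompson_F\<^esub> x_gen 2 \<otimes>\<^bsub>thompson_F\<^esub> x_gen 3 \<otimes>\<^bsub>thompson_F\<^esub>
        x_gen 2 [^]\<^bsub>thompson_F\<^esub> (- 3::int) \<otimes>\<^bsub>thompson_F\<^esub> inv\<^bsub>thompson_F\<^esub> x_gen 1}"

definition M0 :: "(nat word \<Rightarrow> nat word) set" where
  "M0 = generate thompson_F (jones_subgroup \<union> {x_gen 0 [^]\<^bsub>thompson_F\<^esub> (2::int)})"

definition M1 :: "(nat word \<Rightarrow> nat word) set" where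
  "M1 = generate thompson_F (jones_subgroup \<union> {x_gen 1 [^]\<^bsub>thompson_F\<^esub> (2::int)})"

definition M2 :: "(nat word \<Rightarrow> nat word) set" where
  "M2 = generate thompson_F (jones_subgroup \<union> {sigma_F (x_gen 1) [^]\<^bsub>thompson_F\<^esub> (2::int)})"

section \<open>Transducers\<close>

text \<open>A transducer assigns to each state its row: the list, indexed by the input letter, of
  the output words and successor states.\<close>

type_synonym 's transducer = "'s \<Rightarrow> (nat list \<times> 's) list"

fun transduce :: "'s transducer \<Rightarrow> 's \<Rightarrow> nat list \<Rightarrow> nat list" where
  "transduce T s [] = []"
| "transduce T s (a # w) = fst (T s ! a) @ transduce T (snd (T s ! a)) w"

text \<open>The \<open>i\<close>-th output letter is read off as soon as the output produced is long enough.
  This is meaningful when the output on every infinite word is infinite, which holds for the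
  four transducers below.\<close>

definition represented_map :: "'s transducer \<Rightarrow> 's \<Rightarrow> nat word \<Rightarrow> nat word" where
  "represented_map T s \<omega> =
     (\<lambda>i. transduce T s (prefix (LEAST k. i < length (transduce T s (prefix k \<omega>))) \<omega>) ! i)"

datatype K1_state = K1_E | K1_A | K1_K | K1_G

primrec T_K1 :: "K1_state transducer" where
  "T_K1 K1_E = [([0], K1_A), ([1,0,0], K1_K), ([1], K1_G)]"
| "T_K1 K1_A = [([0], K1_A), ([1,0], K1_K), ([1,1], K1_A)]"
| "T_K1 K1_K = [([0,0], K1_K), ([0,1], K1_A), ([1], K1_K)]"
| "T_K1 K1_G = [([0,1], K1_A), ([1,0,0], K1_K), ([1], K1_G)]"

datatype K3_state = K3_e | K3_f | K3_g | K3_h | K3_k | K3_m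

primrec T_K3 :: "K3_state transducer" where
  "T_K3 K3_e = [([0], K3_f), ([1], K3_g)]"
| "T_K3 K3_f = [([0], K3_f), ([1], K3_h)]"
| "T_K3 K3_g = [([0], K3_h), ([1], K3_g)]"
| "T_K3 K3_h = [([0], K3_k), ([1], K3_h)]"
| "T_K3 K3_k = [([0,0], K3_k), ([], K3_m)]"
| "T_K3 K3_m = [([0,1], K3_k), ([1], K3_h)]"

datatype M0_state = M0_X | M0_Y | M0_Z

primrec T_M0 :: "M0_state transducer" where
  "T_M0 M0_X = [([0,0], M0_X), ([0,1], M0_Y), ([1], M0_Z)]"
| "T_M0 M0_Y = [([0,0], M0_Y), ([0,1], M0_Z), ([1], M0_Y)]"
| "T_M0 M0_Z = [([0], M0_Z), ([1,0], M0_Y), ([1,1], M0_Z)]"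

datatype M1_state = M1_E | M1_L | M1_A | M1_B | M1_O

primrec T_M1 :: "M1_state transducer" where
  "T_M1 M1_E = [([0], M1_L), ([1,0], M1_A), ([1,1], M1_B)]"
| "T_M1 M1_L = [([0,0], M1_L), ([0,1,0], M1_A), ([], M1_O)]"
| "T_M1 M1_A = [([0,0], M1_A), ([0,1], M1_B), ([1], M1_A)]"
| "T_M1 M1_B = [([0], M1_B), ([1,0], M1_A), ([1,1], M1_B)]"
| "T_M1 M1_O = [([0,1,1], M1_B), ([1,0], M1_A), ([1,1], M1_B)]"

definition psi_K1 :: "nat word \<Rightarrow> nat word" where
  "psi_K1 = represented_map T_K1 K1_E"

definition psi_K3 :: "nat word \<Rightarrow> nat word" where
  "psi_K3 = represented_map T_K3 K3_e"

definition psi_0 :: "nat word \<Rightarrow> nat word" where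
  "psi_0 = represented_map T_M0 M0_X"

definition psi_1 :: "nat word \<Rightarrow> nat word" where
  "psi_1 = represented_map T_M1 M1_E"

end

theory Submission
  imports Defs "HOL-Library.List_Lexorder"
begin

text \<open>A homeomorphism lies in \<open>F\<^sub>n\<close> iff it preserves the order and replaces prefixes locally, by
  compactness. This makes the group structure and membership tests easy: no codes have to be
  exhibited.

  Every complete prefix code arises from the trivial code by splitting one leaf at a time, and
  splitting any leaf but the last one corresponds to multiplying by one of the standard positive
  elements. Hence every code is taken to a vine by a product of these elements, so they generate
  \<open>F\<^sub>n\<close>, and conjugating them by the first one leaves only \<open>n\<close> generators. The transducers carry
  these generators to elements of \<open>F\<close> that can be read off on finitely many cylinders; up to simple
  identities they are the given generators of \<open>K\<^sub>1\<close> and \<open>K\<^sub>3\<close>, and for \<open>M\<^sub>0\<close> and \<open>M\<^sub>1\<close> they are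
  products of 3-colorable elements and the extra generator.

  It remains to see that the 3-colorable subgroup is contained in the two conjugates of \<open>F\<^sub>3\<close>. The
  colours beside an edge of a tree are a function of its address, and up to a bounded delay
  they determine the state in which the transducer outputs this address.
  So a 3-colorable element matches cylinders on which the transducer is in the same state.\<close>

section \<open>Infinite words\<close>

text \<open>A conjugate of \<open>F_3\<close> is a priori only a group of homeomorphisms of the
  binary Cantor space. That it lies in \<open>F\<close> is seen on generators, where g(psi(xi)) =
  psi(f(xi)) is checked letter by letter, without computing the inverse of psi. No generating set of
  the 3-colorable subgroup is used. That \<open>M_0\<close> and \<open>M_1\<close> contain the
  conjugates takes four explicit 3-colorable elements; the converse needs an argument uniform in the
  tree diagram, hence the local membership criterion. A state entered after a short or empty output
  cannot write every binary word, because part of the cylinder has been taken by a sibling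
  transition. Prescribing the image of each state turns monotonicity and surjectivity into checks on
  single transitions. \<open>K_3\<close> is given by three elements although \<open>F\<close> has
  two generators: the third is a word in the other two, namely the image of x_1 x_2^-1 x_1^-1.
  \<open>M_2\<close> is reached from \<open>M_1\<close> by mirroring tree diagrams and reversing the
  order of the colours of the regions.\<close>

lemma conc_in_cantor_set [simp]:
  "u \<frown> \<omega> \<in> cantor_set n \<longleftrightarrow> set u \<subseteq> {..<n} \<and> \<omega> \<in> cantor_set n"
proof -
  have "\<omega> \<in> cantor_set n \<longleftrightarrow> range \<omega> \<subseteq> {..<n}" for \<omega>
    by (auto simp: cantor_set_def)
  then show ?thesis
    by (simp del: range_subsetD add: range_conc)
qed

lemma build_in_cantor_set [simp]:
  "a ## \<omega> \<in> cantor_set n \<longleftrightarrow> a < n \<and> \<omega> \<in> cantor_set n"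
  using conc_in_cantor_set[of "[a]" \<omega> n] by simp

lemma cantor_set_cases:
  assumes "\<omega> \<in> cantor_set n"
  obtains a \<eta> where "\<omega> = a ## \<eta>" "a < n" "\<eta> \<in> cantor_set n"
  using assms build_in_cantor_set build_split by metis

lemma cantor_set_0 [simp]: "(\<lambda>_. 0) \<in> cantor_set n \<longleftrightarrow> 0 < n"
  by (auto simp: cantor_set_def)

lemma suffix_in_cantor_set: "\<omega> \<in> cantor_set n \<Longrightarrow> suffix k \<omega> \<in> cantor_set n"
  by (auto simp: cantor_set_def)

lemma set_prefix_subset: "\<omega> \<in> cantor_set n \<Longrightarrow> set (prefix k \<omega>) \<subseteq> {..<n}"
  by (auto simp: cantor_set_def)

lemma build_nth [simp]:
  "(a ## \<omega>) (numeral k) = \<omega> (pred_numeral k)"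
  by (simp add: numeral_eq_Suc)

lemma suffix_build [simp]:
  "suffix (Suc k) (a ## \<omega>) = suffix k \<omega>"
  "suffix (numeral m) (a ## \<omega>) = suffix (pred_numeral m) \<omega>"
  by (auto simp: suffix_def numeral_eq_Suc fun_eq_iff)

lemma prefix_build [simp]: "prefix (Suc k) (a ## \<omega>) = a # prefix k \<omega>"
  by (simp add: subsequence_def map_upt_Suc del: upt_Suc)

lemma less_fun_build [simp]:
  fixes a b :: nat
  shows "less_fun (a ## x) (b ## y) \<longleftrightarrow> a < b \<or> a = b \<and> less_fun x y"
proof
  assume "less_fun (a ## x) (b ## y)"
  then obtain k where k: "(a ## x) k < (b ## y) k" "\<And>k'. k' < k \<Longrightarrow> (a ## x) k' = (b ## y) k'"
    by (auto elim: less_funE)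
  show "a < b \<or> a = b \<and> less_fun x y"
  proof (cases k)
    case 0
    then show ?thesis using k by simp
  next
    case (Suc j)
    have "a = b" using k(2)[of 0] Suc by simp
    moreover have "x j < y j" using k(1) Suc by simp
    moreover have "x k' = y k'" if "k' < j" for k' using k(2)[of "Suc k'"] Suc that by simp
    ultimately show ?thesis unfolding less_fun_def by blast
  qed
next
  assume "a < b \<or> a = b \<and> less_fun x y"
  then show "less_fun (a ## x) (b ## y)"
  proof
    assume "a < b"
    then show ?thesis by (intro less_funI exI[of _ 0]) simp
  next
    assume *: "a = b \<and> less_fun x y"
    then obtain k where k: "x k < y k" "\<And>k'. k' < k \<Longrightarrow> x k' = y k'"
      by (auto elim: less_funE)
    show ?thesis
    proof (intro less_funI exI conjI allI impI)
      show "(a ## x) (Suc k) < (b ## y) (Suc k)" using k by simp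
      show "(a ## x) k' = (b ## y) k'" if "k' < Suc k" for k'
        using that k * by (cases k') auto
    qed
  qed
qed

lemma less_fun_linear:
  fixes x y :: "nat word"
  assumes "x \<noteq> y"
  shows "less_fun x y \<or> less_fun y x"
proof -
  define k where "k = (LEAST k. x k \<noteq> y k)"
  obtain j where "x j \<noteq> y j" using assms by blast
  then have "x k \<noteq> y k" unfolding k_def by (rule LeastI)
  moreover have "x j = y j" if "j < k" for j
    using not_less_Least that unfolding k_def by blast
  ultimately show ?thesis
    unfolding less_fun_def by (metis linorder_neqE_nat)
qed

lemma less_fun_conc [simp]: "less_fun (u \<frown> x) (u \<frown> y) \<longleftrightarrow> less_fun x (y :: nat word)"
  by (induction u) auto

text \<open>Here \<open><\<close> is the lexicographic order of finite words, in which a prefix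
  precedes its extensions. A comparison of infinite words says nothing about two of their prefixes
  when one extends the other, hence the two extra disjuncts.\<close>

lemma less_fun_conc_imp:
  "less_fun (u \<frown> x) (v \<frown> y :: nat word) \<Longrightarrow> u < v \<or> (\<exists>w. u = v @ w) \<or> (\<exists>w. v = u @ w)"
proof (induction u arbitrary: v)
  case (Cons a u)
  then show ?case by (cases v) auto
qed auto

lemma less_imp_less_fun_conc:
  "u < v \<Longrightarrow> \<forall>w. v \<noteq> u @ w \<Longrightarrow> less_fun (u \<frown> x) (v \<frown> y :: nat word)"
proof (induction u arbitrary: v)
  case (Cons a u)
  then show ?case by (cases v) auto
qed auto

lemma conc_eq_conc_cases:
  assumes "u \<frown> x = v \<frown> y"
  obtains w where "v = u @ w" "x = w \<frown> y" | w where "u = v @ w" "y = w \<frown> x"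
  using assms
proof (induction u arbitrary: v thesis)
  case (Cons a u)
  show ?case
  proof (cases v)
    case Nil
    then show ?thesis using Cons.prems(2)[of "a # u"] Cons.prems(3) by simp
  next
    case (Cons b v')
    then have "u \<frown> x = v' \<frown> y" "a = b" using Cons.prems(3) by auto
    then show ?thesis using Cons.IH[of v'] Cons.prems(1,2) Cons by auto
  qed
qed auto

section \<open>Topology of the Cantor spaces\<close>

lemma compact_space_cantor: "compact_space (cantor_space n)"
  unfolding cantor_space_def
  by (simp add: compact_space_product_topology compact_space_discrete_topology)

lemma Hausdorff_space_cantor: "Hausdorff_space (cantor_space n)"
  unfolding cantor_space_def by (simp add: Hausdorff_space_product_topology)

lemma openin_agree:
  assumes "x \<in> cantor_set n"
  shows "openin (cantor_space n) {y \<in> cantor_set n. \<forall>i<k. y i = x i}"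
proof (induction k)
  case 0
  then show ?case
    using openin_topspace[of "cantor_space n"] by (simp add: topspace_cantor_space)
next
  case (Suc k)
  have "continuous_map (cantor_space n) (discrete_topology {..<n}) (\<lambda>y. y k)"
    unfolding cantor_space_def by (rule continuous_map_product_projection) simp
  from openin_continuous_map_preimage[OF this, of "{x k}"] assms
  have "openin (cantor_space n) {y \<in> cantor_set n. y k = x k}"
    by (simp add: topspace_cantor_space cantor_set_def)
  from openin_Int[OF Suc this] show ?case
    by (rule back_subst[of "openin _"]) (auto simp: less_Suc_eq)
qed

text \<open>Continuity into a product of discrete spaces may be tested on each output letter, and a
  letter depends continuously on the input when it is constant on some cylinder around each
  point.\<close>

lemma continuous_map_cantorI:
  assumes "f ` cantor_set n \<subseteq> cantor_set m"
    and "\<And>x i. x \<in> cantor_set n \<Longrightarrow> \<exists>k. \<forall>y\<in>cantor_set n. (\<forall>j<k. y j = x j) \<longrightarrow> f y i = f x i"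
  shows "continuous_map (cantor_space n) (cantor_space m) f"
proof -
  have "continuous_map (cantor_space n) (discrete_topology {..<m}) (\<lambda>x. f x i)" for i
    unfolding continuous_map_def
  proof (intro conjI allI impI)
    show "(\<lambda>x. f x i) \<in> topspace (cantor_space n) \<rightarrow> topspace (discrete_topology {..<m})"
      using assms(1) by (auto simp: topspace_cantor_space cantor_set_def)
    fix U assume "openin (discrete_topology {..<m}) U"
    let ?V = "{x \<in> topspace (cantor_space n). f x i \<in> U}"
    have "\<exists>T. openin (cantor_space n) T \<and> x \<in> T \<and> T \<subseteq> ?V" if x: "x \<in> ?V" for x
    proof -
      from x have x': "x \<in> cantor_set n" by (simp add: topspace_cantor_space)
      obtain k where k: "\<And>y. y \<in> cantor_set n \<Longrightarrow> \<forall>j<k. y j = x j \<Longrightarrow> f y i = f x i"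
        using assms(2)[OF x', of i] by metis
      have "{y \<in> cantor_set n. \<forall>j<k. y j = x j} \<subseteq> ?V"
      proof
        fix y assume "y \<in> {y \<in> cantor_set n. \<forall>j<k. y j = x j}"
        then have "y \<in> cantor_set n" "f y i = f x i" using k[of y] by blast+
        then show "y \<in> ?V" using x by (simp add: topspace_cantor_space)
      qed
      then show ?thesis
        using x' openin_agree[OF x', of k] by blast
    qed
    then show "openin (cantor_space n) ?V"
      by (subst openin_subopen) blast
  qed
  then show ?thesis
    by (subst (2) cantor_space_def) (simp add: continuous_map_componentwise_UNIV)
qed

lemma eq_prefix_iff: "prefix k x = prefix k y \<longleftrightarrow> (\<forall>i<k. x i = y i)"
  by (auto simp: subsequence_def)

text \<open>Compactness: finitely many of the cylinders on which \<open>P\<close> has been reached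
  cover the space. Since \<open>P\<close> passes to extensions, the maximum of their depths works
  everywhere.\<close>

lemma cantor_set_uniform_level:
  assumes "\<And>x. x \<in> cantor_set n \<Longrightarrow> \<exists>k. P (prefix k x)"
    and ext: "\<And>u v. P u \<Longrightarrow> set v \<subseteq> {..<n} \<Longrightarrow> P (u @ v)"
  obtains L where "\<And>x. x \<in> cantor_set n \<Longrightarrow> P (prefix L x)"
proof -
  define B where "B x k = {y \<in> cantor_set n. \<forall>i<k. y i = x i}" for x :: "nat word" and k
  define C where "C = {B x k | x k. x \<in> cantor_set n \<and> P (prefix k x)}"
  have 1: "openin (cantor_space n) U" if "U \<in> C" for U
    using that openin_agree unfolding C_def B_def by blast
  have 2: "\<Union>C = topspace (cantor_space n)"
  proof
    show "\<Union>C \<subseteq> topspace (cantor_space n)"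
      using 1 openin_subset by blast
    show "topspace (cantor_space n) \<subseteq> \<Union>C"
    proof
      fix x assume "x \<in> topspace (cantor_space n)"
      then have x: "x \<in> cantor_set n" by (simp add: topspace_cantor_space)
      obtain k where "P (prefix k x)" using assms(1)[OF x] by blast
      then have "B x k \<in> C" using x unfolding C_def by blast
      moreover have "x \<in> B x k" using x unfolding B_def by simp
      ultimately show "x \<in> \<Union>C" by blast
    qed
  qed
  obtain D where D: "finite D" "D \<subseteq> C" "cantor_set n \<subseteq> \<Union>D"
    using compact_space_cantor 1 2 unfolding compact_space_alt topspace_cantor_space
    by (metis subset_refl)
  have "\<forall>U\<in>D. \<exists>k. \<forall>y\<in>U. P (prefix k y)"
  proof
    fix U assume "U \<in> D"
    then have "U \<in> C" using D(2) by blast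
    then obtain x k where xk: "U = B x k" "P (prefix k x)" unfolding C_def by blast
    then have "P (prefix k y)" if "y \<in> U" for y
    proof -
      have "prefix k y = prefix k x"
        using that xk(1) unfolding eq_prefix_iff B_def by simp
      then show ?thesis using xk(2) by simp
    qed
    then show "\<exists>k. \<forall>y\<in>U. P (prefix k y)" by blast
  qed
  then obtain K where K: "\<And>U y. U \<in> D \<Longrightarrow> y \<in> U \<Longrightarrow> P (prefix (K U) y)" by metis
  define L where "L = Max (insert 0 (K ` D))"
  have "P (prefix L x)" if x: "x \<in> cantor_set n" for x
  proof -
    obtain U where U: "U \<in> D" "x \<in> U" using D(3) x by blast
    have "K U \<le> L" unfolding L_def using D(1) U(1) by (intro Max_ge) auto
    then have "prefix L x = prefix (K U) x @ subsequence x (K U) L"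
      using subsequence_append[of x "K U" "L - K U"] by simp
    moreover have "set (subsequence x (K U) L) \<subseteq> {..<n}"
      using x by (auto simp: cantor_set_def)
    ultimately show ?thesis using ext K[OF U] by metis
  qed
  then show thesis using that by blast
qed

section \<open>A local description of the groups \<open>F\<^sub>n\<close>\<close>

definition lex_mono :: "nat \<Rightarrow> (nat word \<Rightarrow> nat word) \<Rightarrow> bool" where
  "lex_mono n f \<longleftrightarrow>
     (\<forall>x \<in> cantor_set n. \<forall>y \<in> cantor_set n. less_fun x y \<longrightarrow> less_fun (f x) (f y))"

text \<open>The words may vary with the point, and neither disjointness nor an order of the
  cylinders is demanded; injectivity and monotonicity of \<open>f\<close> supply both.\<close>

definition locally_replacing :: "nat \<Rightarrow> (nat word \<Rightarrow> nat word) \<Rightarrow> bool" where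
  "locally_replacing n f \<longleftrightarrow>
     (\<forall>x \<in> cantor_set n. \<exists>u v \<eta>. \<eta> \<in> cantor_set n \<and> x = u \<frown> \<eta> \<and>
        (\<forall>\<omega> \<in> cantor_set n. f (u \<frown> \<omega>) = v \<frown> \<omega>))"

lemma lex_mono_less_iff:
  assumes "lex_mono n f" "x \<in> cantor_set n" "y \<in> cantor_set n"
  shows "less_fun (f x) (f y) \<longleftrightarrow> less_fun x y"
  using assms unfolding lex_mono_def
  by (metis less_fun_asym less_fun_irrefl less_fun_linear)

lemma lex_mono_inj_on: "lex_mono n f \<Longrightarrow> inj_on f (cantor_set n)"
  by (intro inj_onI) (metis lex_mono_less_iff less_fun_irrefl less_fun_linear)

lemma lex_mono_inv_into:
  assumes "lex_mono n f" "f ` cantor_set n = cantor_set m"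
  shows "lex_mono m (inv_into (cantor_set n) f)"
  unfolding lex_mono_def
  by (metis assms lex_mono_less_iff f_inv_into_f inv_into_into)

lemma cylinder_eq_image: "cylinder n u = (\<lambda>\<omega>. u \<frown> \<omega>) ` cantor_set n"
  by (auto simp: cylinder_def)

lemma cylinder_append_subset: "set w \<subseteq> {..<n} \<Longrightarrow> cylinder n (u @ w) \<subseteq> cylinder n u"
  by (auto simp: cylinder_def simp flip: conc_conc)

lemma cylinder_nonempty: "0 < n \<Longrightarrow> cylinder n u \<noteq> {}"
  using cantor_set_0[of n] by (auto simp: cylinder_eq_image simp del: cantor_set_0)

text \<open>Disjoint cylinders have incomparable words because cylinders are nonempty; this is where
  \<open>0 < n\<close> enters.\<close>

lemma complete_prefix_code_prefix_free:
  assumes "complete_prefix_code n us" "0 < n" "u \<in> set us" "u @ w \<in> set us"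
  shows "w = []"
proof (rule ccontr)
  assume "w \<noteq> []"
  then have "u \<noteq> u @ w" by simp
  then have "cylinder n u \<inter> cylinder n (u @ w) = {}"
    using assms unfolding complete_prefix_code_def disjoint_family_on_def by blast
  moreover have "set (u @ w) \<subseteq> {..<n}"
    using assms unfolding complete_prefix_code_def by auto
  ultimately show False
    using cylinder_append_subset[of w n u] cylinder_nonempty[OF assms(2), of "u @ w"] by auto
qed

text \<open>Identifies the order used in the definition of a code with the instance \<open><\<close>
  on lists, so that sorted lists of sets become available.\<close>

lemma sorted_lexord: "sorted_wrt (\<lambda>u v. (u, v) \<in> lexord {(a, b). a < b}) us \<longleftrightarrow> sorted_wrt (<) us"
proof -
  have "(<) = (\<lambda>u v :: 'a list. (u, v) \<in> lexord {(a, b). a < b})"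
    by (intro ext) (rule list_less_def)
  then show ?thesis by simp
qed

definition level :: "nat \<Rightarrow> nat \<Rightarrow> nat list list" where
  "level n L = sorted_list_of_set {w. set w \<subseteq> {..<n} \<and> length w = L}"

lemma set_level: "set (level n L) = {w. set w \<subseteq> {..<n} \<and> length w = L}"
  unfolding level_def by (simp add: finite_lists_length_eq)

lemma complete_prefix_code_level: "complete_prefix_code n (level n L)"
  unfolding complete_prefix_code_def
proof (intro conjI)
  show "set (level n L) \<subseteq> lists {..<n}" by (auto simp: set_level)
  show "sorted_wrt (\<lambda>u v. (u, v) \<in> lexord {(a, b). a < b}) (level n L)"
    unfolding sorted_lexord level_def by simp
  show "disjoint_family_on (cylinder n) (set (level n L))"
    unfolding disjoint_family_on_def set_level cylinder_def by auto
  show "(\<Union>u\<in>set (level n L). cylinder n u) = cantor_set n"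
  proof
    show "(\<Union>u\<in>set (level n L). cylinder n u) \<subseteq> cantor_set n"
      by (auto simp: set_level cylinder_def)
    show "cantor_set n \<subseteq> (\<Union>u\<in>set (level n L). cylinder n u)"
    proof
      fix x assume x: "x \<in> cantor_set n"
      have "prefix L x \<in> set (level n L)"
        using set_prefix_subset[OF x, of L] by (simp add: set_level)
      moreover have "x \<in> cylinder n (prefix L x)"
        unfolding cylinder_def using prefix_suffix[of x L] suffix_in_cantor_set[OF x] by blast
      ultimately show "x \<in> (\<Union>u\<in>set (level n L). cylinder n u)" by blast
    qed
  qed
qed

lemma locally_replacing_continuous:
  assumes "f ` cantor_set n \<subseteq> cantor_set n" "locally_replacing n f"
  shows "continuous_map (cantor_space n) (cantor_space n) f"
proof (rule continuous_map_cantorI[OF assms(1)])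
  fix x i assume x: "x \<in> cantor_set n"
  obtain u v \<eta> where u: "\<eta> \<in> cantor_set n" "x = u \<frown> \<eta>"
    "\<forall>\<omega> \<in> cantor_set n. f (u \<frown> \<omega>) = v \<frown> \<omega>"
    using assms(2) x unfolding locally_replacing_def by blast
  show "\<exists>k. \<forall>y\<in>cantor_set n. (\<forall>j<k. y j = x j) \<longrightarrow> f y i = f x i"
  \<comment> \<open>Agreement on this many letters puts \<open>y\<close> into the cylinder of
    \<open>u\<close> and makes the two tails agree up to position \<open>i\<close>; this suffices
    whatever the length of \<open>v\<close>.\<close>
  proof (intro exI[of _ "length u + Suc i"] ballI impI)
    fix y assume y: "y \<in> cantor_set n" "\<forall>j < length u + Suc i. y j = x j"
    define \<zeta> where "\<zeta> = suffix (length u) y"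
    have "prefix (length u) y = prefix (length u) x"
      unfolding eq_prefix_iff using y(2) by simp
    then have yu: "y = u \<frown> \<zeta>"
      using prefix_suffix[of y "length u"] u(2) unfolding \<zeta>_def by simp
    moreover have "\<zeta> \<in> cantor_set n" unfolding \<zeta>_def by (rule suffix_in_cantor_set[OF y(1)])
    ultimately have fy: "f y = v \<frown> \<zeta>" "f x = v \<frown> \<eta>" using u by simp_all
    have "\<zeta> j = \<eta> j" if "j \<le> i" for j
      using y(2)[rule_format, of "length u + j"] that unfolding yu u(2) by simp
    then show "f y i = f x i" unfolding fy by (cases "i < length v") simp_all
  qed
qed

text \<open>At a uniform depth \<open>L\<close> every cylinder is mapped by a prefix replacement, so
  all words of length \<open>L\<close> form the domain code. Their images are cylinders again, and
  they are disjoint and covering because \<open>f\<close> is a bijection.\<close>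

lemma thompsonI:
  assumes n: "0 < n"
    and ext: "f \<in> extensional (cantor_set n)" and im: "f ` cantor_set n = cantor_set n"
    and mono: "lex_mono n f" and loc: "locally_replacing n f"
  shows "f \<in> carrier (thompson n)"
proof -
  note inj = lex_mono_inj_on[OF mono]
  define P where "P u \<longleftrightarrow> (\<exists>v. \<forall>\<omega> \<in> cantor_set n. f (u \<frown> \<omega>) = v \<frown> \<omega>)" for u
  obtain L where L: "\<And>x. x \<in> cantor_set n \<Longrightarrow> P (prefix L x)"
  proof (rule cantor_set_uniform_level)
    fix x assume "x \<in> cantor_set n"
    then obtain u v \<eta> where "x = u \<frown> \<eta>" "\<forall>\<omega> \<in> cantor_set n. f (u \<frown> \<omega>) = v \<frown> \<omega>"
      using loc unfolding locally_replacing_def by blast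
    then show "\<exists>k. P (prefix k x)"
      unfolding P_def by (intro exI[of _ "length u"]) auto
  next
    fix u v :: "nat list" assume "P u" "set v \<subseteq> {..<n}"
    then show "P (u @ v)"
      unfolding P_def by (metis conc_conc conc_in_cantor_set)
  qed blast
  define us where "us = level n L"
  have us: "complete_prefix_code n us" unfolding us_def by (rule complete_prefix_code_level)
  have wus: "set u \<subseteq> {..<n}" if "u \<in> set us" for u
    using that unfolding us_def set_level by auto
  have "\<exists>v. \<forall>\<omega> \<in> cantor_set n. f (u \<frown> \<omega>) = v \<frown> \<omega>" if "u \<in> set us" for u
  proof -
    have "length u = L" using that unfolding us_def set_level by auto
    \<comment> \<open>The zero tail only serves as a sample point of the cylinder, here and in the
      comparisons below.\<close>
    then have "prefix L (u \<frown> (\<lambda>_. 0)) = u" by auto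
    moreover have "u \<frown> (\<lambda>_. 0) \<in> cantor_set n" using wus[OF that] n by auto
    ultimately show ?thesis using L unfolding P_def by metis
  qed
  then obtain h where h: "\<And>u \<omega>. u \<in> set us \<Longrightarrow> \<omega> \<in> cantor_set n \<Longrightarrow> f (u \<frown> \<omega>) = h u \<frown> \<omega>"
    by metis
  have cyl: "cylinder n (h u) = f ` cylinder n u" if "u \<in> set us" for u
    unfolding cylinder_eq_image image_image using h[OF that] by simp
  have cylsub: "cylinder n u \<subseteq> cantor_set n" if "u \<in> set us" for u
    using wus[OF that] by (auto simp: cylinder_def)
  have disj: "cylinder n (h u) \<inter> cylinder n (h v) = {}" if "u \<in> set us" "v \<in> set us" "u \<noteq> v" for u v
  proof -
    have "cylinder n u \<inter> cylinder n v = {}"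
      using us that unfolding complete_prefix_code_def disjoint_family_on_def by blast
    then show ?thesis
      unfolding cyl[OF that(1)] cyl[OF that(2)]
      using inj_on_image_Int[OF inj cylsub[OF that(1)] cylsub[OF that(2)]] by simp
  qed
  have hw: "set (h u) \<subseteq> {..<n}" if "u \<in> set us" for u
  proof -
    have "f (u \<frown> (\<lambda>_. 0)) \<in> cantor_set n"
      using im wus[OF that] n by auto
    then show ?thesis using h[OF that, of "\<lambda>_. 0"] n by simp
  qed
  \<comment> \<open>One sample point per cylinder shows the order of the images; disjointness then
    excludes that one of the new words extends the other.\<close>
  have hless: "h u < h v" if "u \<in> set us" "v \<in> set us" "u < v" for u v
  proof -
    have ne: "u \<noteq> v" using that(3) by auto
    have "\<forall>w. v \<noteq> u @ w"
      using complete_prefix_code_prefix_free[OF us n that(1)] that(2) ne by auto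
    then have "less_fun (u \<frown> (\<lambda>_. 0)) (v \<frown> (\<lambda>_. 0 :: nat))"
      using that(3) by (intro less_imp_less_fun_conc)
    then have "less_fun (h u \<frown> (\<lambda>_. 0)) (h v \<frown> (\<lambda>_. 0 :: nat))"
      using mono h[of _ "\<lambda>_. 0"] wus that n unfolding lex_mono_def by (metis cantor_set_0 conc_in_cantor_set)
    moreover have "\<And>w. h u \<noteq> h v @ w" "\<And>w. h v \<noteq> h u @ w"
      using disj[OF that(1,2) ne] hw[OF that(1)] hw[OF that(2)]
        cylinder_append_subset[of _ n] cylinder_nonempty[OF n]
      by (metis Int_absorb1 Int_absorb2 set_append le_sup_iff)+
    ultimately show ?thesis using less_fun_conc_imp by blast
  qed
  define vs where "vs = map h us"
  have "complete_prefix_code n vs"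
    unfolding complete_prefix_code_def
  proof (intro conjI)
    show "set vs \<subseteq> lists {..<n}" using hw unfolding vs_def by auto
    have "sorted_wrt (<) us" using us unfolding complete_prefix_code_def sorted_lexord by simp
    then show "sorted_wrt (\<lambda>u v. (u, v) \<in> lexord {(a, b). a < b}) vs"
      unfolding sorted_lexord vs_def sorted_wrt_map
      by (rule sorted_wrt_mono_rel[rotated]) (use hless in blast)
    show "disjoint_family_on (cylinder n) (set vs)"
      unfolding disjoint_family_on_def vs_def using disj by auto
    have "(\<Union>v\<in>set vs. cylinder n v) = f ` (\<Union>u\<in>set us. cylinder n u)"
      unfolding vs_def using cyl by auto
    also have "\<dots> = cantor_set n"
      using us im unfolding complete_prefix_code_def by auto
    finally show "(\<Union>v\<in>set vs. cylinder n v) = cantor_set n" .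
  qed
  moreover have "replaces_prefixes n f us vs"
    unfolding replaces_prefixes_def vs_def using h by auto
  moreover have "homeomorphic_map (cantor_space n) (cantor_space n) f"
    using locally_replacing_continuous[OF _ loc] im inj
    by (intro continuous_imp_homeomorphic_map compact_space_cantor Hausdorff_space_cantor)
      (auto simp: topspace_cantor_space)
  ultimately show ?thesis
    using ext mono us unfolding thompson_def lex_mono_def by simp blast
qed

lemma complete_prefix_code_cover:
  assumes "complete_prefix_code n us" "x \<in> cantor_set n"
  obtains i \<eta> where "i < length us" "x = us ! i \<frown> \<eta>" "\<eta> \<in> cantor_set n"
proof -
  obtain u where "u \<in> set us" "x \<in> cylinder n u"
    using assms unfolding complete_prefix_code_def by blast
  then show thesis using that unfolding cylinder_def by (auto simp: in_set_conv_nth)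
qed

lemma thompson_carrier_iff:
  assumes "0 < n"
  shows "f \<in> carrier (thompson n) \<longleftrightarrow>
    f \<in> extensional (cantor_set n) \<and> f ` cantor_set n = cantor_set n \<and> lex_mono n f \<and> locally_replacing n f"
    (is "?L \<longleftrightarrow> ?R")
proof
  assume L: ?L
  then obtain us vs where *: "complete_prefix_code n us" "replaces_prefixes n f us vs"
    unfolding thompson_def by auto
  have "locally_replacing n f"
    unfolding locally_replacing_def
  proof
    fix x assume "x \<in> cantor_set n"
    with *(1) obtain i \<eta> where "i < length us" "x = us ! i \<frown> \<eta>" "\<eta> \<in> cantor_set n"
      by (rule complete_prefix_code_cover)
    moreover from this have "\<forall>\<omega>\<in>cantor_set n. f (us ! i \<frown> \<omega>) = vs ! i \<frown> \<omega>"
      using *(2) unfolding replaces_prefixes_def by simp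
    ultimately show "\<exists>u v \<eta>. \<eta> \<in> cantor_set n \<and> x = u \<frown> \<eta> \<and> (\<forall>\<omega>\<in>cantor_set n. f (u \<frown> \<omega>) = v \<frown> \<omega>)"
      by blast
  qed
  then show ?R
    using L homeomorphic_imp_surjective_map[of "cantor_space n" "cantor_space n" f]
    unfolding thompson_def lex_mono_def by (simp add: topspace_cantor_space)
qed (use thompsonI[OF assms] in blast)

lemma thompson_mult [simp]: "f \<otimes>\<^bsub>thompson n\<^esub> g = compose (cantor_set n) g f"
  and thompson_one [simp]: "\<one>\<^bsub>thompson n\<^esub> = (\<lambda>\<omega> \<in> cantor_set n. \<omega>)"
  by (simp_all add: thompson_def)

lemma thompson_app_closed:
  assumes "f \<in> carrier (thompson n)" "x \<in> cantor_set n"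
  shows "f x \<in> cantor_set n"
  using assms homeomorphic_imp_surjective_map[of "cantor_space n" "cantor_space n" f]
  unfolding thompson_def by (auto simp: topspace_cantor_space)

lemma thompson_inj_on:
  "f \<in> carrier (thompson n) \<Longrightarrow> inj_on f (cantor_set n)"
  unfolding thompson_def by (auto intro!: lex_mono_inj_on simp: lex_mono_def)

lemma thompson_eqI:
  assumes "f \<in> carrier (thompson n)" "g \<in> carrier (thompson n)"
    and "\<And>x. x \<in> cantor_set n \<Longrightarrow> f x = g x"
  shows "f = g"
  using assms unfolding thompson_def by (auto intro: extensionalityI)

text \<open>The output prefix \<open>v\<close> of \<open>f\<close> and the input prefix of
  \<open>g\<close> are prefixes of the same infinite word, so one extends the other. The surplus
  \<open>w\<close> is appended to the input side in the first case and to the output side in the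
  second.\<close>

lemma locally_replacing_compose:
  assumes "locally_replacing n f" "locally_replacing n g" "f ` cantor_set n \<subseteq> cantor_set n"
  shows "locally_replacing n (compose (cantor_set n) g f)"
  unfolding locally_replacing_def
proof
  fix x assume x: "x \<in> cantor_set n"
  obtain u v \<eta> where \<eta>: "\<eta> \<in> cantor_set n" and xu: "x = u \<frown> \<eta>"
    and fu: "\<And>\<omega>. \<omega> \<in> cantor_set n \<Longrightarrow> f (u \<frown> \<omega>) = v \<frown> \<omega>"
    using assms(1) x unfolding locally_replacing_def by metis
  have u: "set u \<subseteq> {..<n}" using x xu by simp
  have "f x \<in> cantor_set n" using assms(3) x by blast
  then have v: "v \<frown> \<eta> \<in> cantor_set n" using fu[OF \<eta>] xu by simp
  obtain u' v' \<zeta> where \<zeta>: "\<zeta> \<in> cantor_set n" and eq: "v \<frown> \<eta> = u' \<frown> \<zeta>"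
    and gu: "\<And>\<omega>. \<omega> \<in> cantor_set n \<Longrightarrow> g (u' \<frown> \<omega>) = v' \<frown> \<omega>"
    using assms(2) v unfolding locally_replacing_def by metis
  from eq show "\<exists>u v \<eta>. \<eta> \<in> cantor_set n \<and> x = u \<frown> \<eta> \<and>
      (\<forall>\<omega>\<in>cantor_set n. compose (cantor_set n) g f (u \<frown> \<omega>) = v \<frown> \<omega>)"
  proof (cases rule: conc_eq_conc_cases)
    case (1 w)
    with \<eta> have w: "set w \<subseteq> {..<n}" by simp
    have "compose (cantor_set n) g f ((u @ w) \<frown> \<omega>) = v' \<frown> \<omega>" if "\<omega> \<in> cantor_set n" for \<omega>
      using that u w fu[of "w \<frown> \<omega>"] gu[of \<omega>] 1 by (simp add: compose_def)
    moreover have "x = (u @ w) \<frown> \<zeta>" using xu 1 by simp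
    ultimately show ?thesis using \<zeta> by blast
  next
    case (2 w)
    have w: "set w \<subseteq> {..<n}" using \<zeta> 2 by simp
    have "compose (cantor_set n) g f (u \<frown> \<omega>) = (v' @ w) \<frown> \<omega>" if "\<omega> \<in> cantor_set n" for \<omega>
      using that u w fu[of \<omega>] gu[of "w \<frown> \<omega>"] 2 by (simp add: compose_def)
    then show ?thesis using \<eta> xu by blast
  qed
qed

lemma locally_replacing_inverse:
  assumes "locally_replacing n f" "inj_on f (cantor_set n)" "f ` cantor_set n = cantor_set n"
  shows "locally_replacing n (\<lambda>x \<in> cantor_set n. inv_into (cantor_set n) f x)"
  unfolding locally_replacing_def
proof
  fix y assume "y \<in> cantor_set n"
  then obtain x where x: "x \<in> cantor_set n" "y = f x" using assms(3) by blast
  obtain u v \<eta> where 1: "\<eta> \<in> cantor_set n" "x = u \<frown> \<eta>" "\<forall>\<omega> \<in> cantor_set n. f (u \<frown> \<omega>) = v \<frown> \<omega>"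
    using assms(1) x(1) unfolding locally_replacing_def by blast
  have u: "set u \<subseteq> {..<n}" using x(1) 1 by simp
  have "restrict (inv_into (cantor_set n) f) (cantor_set n) (v \<frown> \<omega>) = u \<frown> \<omega>"
    if "\<omega> \<in> cantor_set n" for \<omega>
  proof -
    have "u \<frown> \<omega> \<in> cantor_set n" using u that by simp
    then have "inv_into (cantor_set n) f (f (u \<frown> \<omega>)) = u \<frown> \<omega>" "f (u \<frown> \<omega>) \<in> cantor_set n"
      using inv_into_f_f[OF assms(2)] assms(3) by blast+
    moreover have "f (u \<frown> \<omega>) = v \<frown> \<omega>" using 1(3) that by blast
    ultimately show ?thesis by (simp only: restrict_apply')
  qed
  then show "\<exists>u v \<eta>. \<eta> \<in> cantor_set n \<and> y = u \<frown> \<eta> \<and>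
      (\<forall>\<omega>\<in>cantor_set n. restrict (inv_into (cantor_set n) f) (cantor_set n) (u \<frown> \<omega>) = v \<frown> \<omega>)"
    using 1 x by metis
qed

theorem group_thompson:
  assumes "0 < n"
  shows "group (thompson n)"
proof (rule groupI)
  fix f g h
  assume f: "f \<in> carrier (thompson n)" and g: "g \<in> carrier (thompson n)"
  note f' = f[unfolded thompson_carrier_iff[OF assms]] and g' = g[unfolded thompson_carrier_iff[OF assms]]
  have "lex_mono n (compose (cantor_set n) g f)"
    unfolding lex_mono_def
  proof (intro ballI impI)
    fix x y assume xy: "x \<in> cantor_set n" "y \<in> cantor_set n" "less_fun x y"
    then have "f x \<in> cantor_set n" "f y \<in> cantor_set n" "less_fun (f x) (f y)"
      using f' unfolding lex_mono_def by blast+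
    then have "less_fun (g (f x)) (g (f y))" using g' unfolding lex_mono_def by blast
    then show "less_fun (compose (cantor_set n) g f x) (compose (cantor_set n) g f y)"
      using xy by (simp add: compose_def)
  qed
  moreover have "compose (cantor_set n) g f ` cantor_set n = g ` f ` cantor_set n"
    unfolding image_image by (intro image_cong refl) (simp add: compose_def)
  ultimately show "f \<otimes>\<^bsub>thompson n\<^esub> g \<in> carrier (thompson n)"
    using f' g' locally_replacing_compose[of n f g]
    by (simp add: thompson_carrier_iff[OF assms])
next
  fix f g h
  assume "f \<in> carrier (thompson n)" "g \<in> carrier (thompson n)" "h \<in> carrier (thompson n)"
  then show "f \<otimes>\<^bsub>thompson n\<^esub> g \<otimes>\<^bsub>thompson n\<^esub> h = f \<otimes>\<^bsub>thompson n\<^esub> (g \<otimes>\<^bsub>thompson n\<^esub> h)"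
    using thompson_app_closed[of f n] by (simp add: compose_def restrict_def fun_eq_iff)
next
  have "locally_replacing n (\<lambda>\<omega>\<in>cantor_set n. \<omega>)"
    unfolding locally_replacing_def
    by (auto intro!: exI[of _ "[]"])
  then show "\<one>\<^bsub>thompson n\<^esub> \<in> carrier (thompson n)"
    by (auto simp: thompson_carrier_iff[OF assms] lex_mono_def)
next
  fix f assume f: "f \<in> carrier (thompson n)"
  then have "f \<in> extensional (cantor_set n)" by (simp add: thompson_def)
  then show "\<one>\<^bsub>thompson n\<^esub> \<otimes>\<^bsub>thompson n\<^esub> f = f"
    by (auto simp: compose_def fun_eq_iff extensional_def)
  note f' = f[unfolded thompson_carrier_iff[OF assms]]
  then have inj: "inj_on f (cantor_set n)" by (simp add: lex_mono_inj_on)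
  let ?g = "\<lambda>x \<in> cantor_set n. inv_into (cantor_set n) f x"
  have "?g ` cantor_set n = inv_into (cantor_set n) f ` f ` cantor_set n"
    using f' by (intro image_cong) simp_all
  also have "\<dots> = cantor_set n" using inv_into_image_cancel[OF inj order_refl] .
  finally have "?g ` cantor_set n = cantor_set n" .
  moreover have "lex_mono n ?g"
    using lex_mono_inv_into[of n f n] f' unfolding lex_mono_def[of n ?g]
    by (simp add: lex_mono_def[of n "inv_into _ _"])
  moreover have "locally_replacing n ?g"
    using locally_replacing_inverse[of n f] f' inj by blast
  ultimately have "?g \<in> carrier (thompson n)"
    unfolding thompson_carrier_iff[OF assms] by simp
  moreover have "?g \<otimes>\<^bsub>thompson n\<^esub> f = \<one>\<^bsub>thompson n\<^esub>"
  proof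
    fix x
    show "(?g \<otimes>\<^bsub>thompson n\<^esub> f) x = \<one>\<^bsub>thompson n\<^esub> x"
      using f' f_inv_into_f[of x f "cantor_set n"] by (simp add: compose_def restrict_def)
  qed
  ultimately show "\<exists>g\<in>carrier (thompson n). g \<otimes>\<^bsub>thompson n\<^esub> f = \<one>\<^bsub>thompson n\<^esub>"
    by blast
qed

text \<open>Reduces the value of an inverse to a value of the element itself; the rewrite rules for
  inverses below all come from this.\<close>

lemma thompson_inv_app:
  assumes "0 < n" "f \<in> carrier (thompson n)" "x \<in> cantor_set n" "f x = y"
  shows "(inv\<^bsub>thompson n\<^esub> f) y = x"
proof -
  interpret group "thompson n" by (rule group_thompson[OF assms(1)])
  have "(f \<otimes>\<^bsub>thompson n\<^esub> inv\<^bsub>thompson n\<^esub> f) x = \<one>\<^bsub>thompson n\<^esub> x"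
    using assms(2) by (simp only: r_inv)
  then show ?thesis using assms(3,4) by (simp add: compose_def)
qed

lemma thompson_mult_app:
  "x \<in> cantor_set n \<Longrightarrow> (f \<otimes>\<^bsub>thompson n\<^esub> g) x = g (f x)"
  by (simp add: compose_def)

section \<open>Generators of \<open>F\<^sub>n\<close>\<close>

lemma append_less_append_iff [simp]: "u @ v < u @ w \<longleftrightarrow> v < (w :: 'a :: order list)"
  by (induction u) auto

lemma append_less_of_less:
  "u < v \<Longrightarrow> \<forall>w. v \<noteq> u @ w \<Longrightarrow> u @ x < (v :: 'a :: order list)"
proof (induction u arbitrary: v)
  case (Cons a u)
  then show ?case by (cases v) auto
qed (auto elim: allE[of _ v])

section \<open>Complete prefix codes grow from the trivial code by splitting leaves\<close>

definition expand :: "nat \<Rightarrow> nat list list \<Rightarrow> nat \<Rightarrow> nat list list" where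
  "expand n us i = take i us @ map (\<lambda>a. us ! i @ [a]) [0..<n] @ drop (Suc i) us"

lemma length_expand [simp]: "i < length us \<Longrightarrow> length (expand n us i) = length us + n - 1"
  by (simp add: expand_def)

lemma expand_nth:
  assumes "i < length us" "j < length us + n - 1"
  shows "expand n us i ! j =
    (if j < i then us ! j else if j < i + n then us ! i @ [j - i] else us ! (j + 1 - n))"
  using assms by (auto simp: expand_def nth_append min_def intro!: arg_cong[of _ _ "(!) us"])

text \<open>Induction on the number of words. A longest word \<open>u @ [a]\<close> has all its
  siblings \<open>u @ [b]\<close> in the code, and merging them into \<open>u\<close> gives a
  smaller complete code whose expansion at \<open>u\<close> is the given one.\<close>

lemma complete_prefix_code_induct [consumes 2, case_names root expand]:
  assumes "complete_prefix_code n us" "2 \<le> n"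
    and root: "P [[]]"
    and step: "\<And>us i. complete_prefix_code n us \<Longrightarrow> P us \<Longrightarrow> i < length us \<Longrightarrow> P (expand n us i)"
  shows "P us"
  using assms(1)
proof (induction "length us" arbitrary: us rule: less_induct)
  case less
  note code = less.prems
  have words: "set u \<subseteq> {..<n}" if "u \<in> set us" for u
    using code that unfolding complete_prefix_code_def by blast
  have sorted: "sorted_wrt (<) us" using code unfolding complete_prefix_code_def sorted_lexord by simp
  have disj: "cylinder n u \<inter> cylinder n v = {}" if "u \<in> set us" "v \<in> set us" "u \<noteq> v" for u v
    using code that unfolding complete_prefix_code_def disjoint_family_on_def by blast
  have free: "w = []" if "u \<in> set us" "u @ w \<in> set us" for u w
    using complete_prefix_code_prefix_free[OF code _ that] assms(2) by simp
  have "us \<noteq> []"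
    using complete_prefix_code_cover[OF code, of "\<lambda>_. 0"] assms(2) by fastforce
  then have "Max (length ` set us) \<in> length ` set us" by (intro Max_in) auto
  then obtain w where w: "w \<in> set us" "length w = Max (length ` set us)" by auto
  then have longest: "length v \<le> length w" if "v \<in> set us" for v using that by simp
  show ?case
  proof (cases "w = []")
    case True
    then have "v = []" if "v \<in> set us" for v using longest[OF that] by simp
    then have "set us = set [[]]" using w(1) by auto
    then have "us = [[]]" using strict_sorted_equal[of "[[]]" us] sorted by simp
    then show ?thesis using root by simp
  next
    case False
    then obtain u a where wu: "w = u @ [a]" using rev_exhaust by blast
    define S where "S = (\<lambda>b. u @ [b]) ` {..<n}"
    have u: "set u \<subseteq> {..<n}" using words[OF w(1)] wu by simp
    \<comment> \<open>Some word of the code covers a point below the sibling \<open>s\<close>. By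
      maximality it is no longer than \<open>s\<close>, hence a prefix of \<open>s\<close>; a proper
      prefix would be a prefix of \<open>u\<close> and so of \<open>w\<close>, against
      prefix-freeness.\<close>
    have S: "S \<subseteq> set us"
    proof
      fix s assume "s \<in> S"
      then obtain b where b: "b < n" "s = u @ [b]" unfolding S_def by auto
      have "s \<frown> (\<lambda>_. 0) \<in> cantor_set n" using u b by simp
      from complete_prefix_code_cover[OF code this]
      obtain i \<eta> where i: "i < length us" and eq: "s \<frown> (\<lambda>_. 0) = us ! i \<frown> \<eta>" by metis
      let ?v = "us ! i"
      have v: "?v \<in> set us" "length ?v \<le> length s" using i longest[of ?v] wu b by simp_all
      have "?v = s"
      proof (rule ccontr)
        assume ne: "?v \<noteq> s"
        from eq obtain x where x: "s = ?v @ x"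
          using v(2) by (cases rule: conc_eq_conc_cases) auto
        with ne have "x \<noteq> []" by auto
        then have "u = ?v @ butlast x" using x b by (metis butlast_append butlast_snoc)
        then have "w = ?v @ (butlast x @ [a])" using wu by simp
        then show False using free[OF v(1)] w(1) by (metis append_is_Nil_conv list.distinct(1))
      qed
      then show "s \<in> set us" using v(1) by simp
    qed
    have notu: "u \<notin> set us" using free[of u "[a]"] w(1) wu by auto
    define us' where "us' = sorted_list_of_set (insert u (set us - S))"
    have set': "set us' = insert u (set us - S)" unfolding us'_def
      by (rule set_sorted_list_of_set) simp
    have sorted': "sorted_wrt (<) us'" unfolding us'_def
      by (rule sorted_list_of_set.strict_sorted_key_list_of_set)
    have cyl: "cylinder n u = (\<Union>s\<in>S. cylinder n s)"
    proof
      show "cylinder n u \<subseteq> (\<Union>s\<in>S. cylinder n s)"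
      proof
        fix x assume "x \<in> cylinder n u"
        then obtain b \<eta> where "x = u \<frown> b ## \<eta>" "b < n" "\<eta> \<in> cantor_set n"
          unfolding cylinder_def using cantor_set_cases by blast
        then show "x \<in> (\<Union>s\<in>S. cylinder n s)"
          unfolding S_def cylinder_def by auto
      qed
      show "(\<Union>s\<in>S. cylinder n s) \<subseteq> cylinder n u"
        using cylinder_append_subset[of "[_]" n u] unfolding S_def by auto
    qed
    have code': "complete_prefix_code n us'"
      unfolding complete_prefix_code_def sorted_lexord
    proof (intro conjI)
      show "set us' \<subseteq> lists {..<n}" using words u unfolding set' by auto
      show "sorted_wrt (<) us'" by (rule sorted')
      have "cylinder n u \<inter> cylinder n v = {}" if "v \<in> set us - S" for v
        unfolding cyl using disj that S by blast
      then show "disjoint_family_on (cylinder n) (set us')"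
        unfolding disjoint_family_on_def set' using disj by blast
      have "(\<Union>v\<in>set us'. cylinder n v) = (\<Union>v\<in>set us. cylinder n v)"
        unfolding set' using cyl S by auto
      also have "\<dots> = cantor_set n" using code unfolding complete_prefix_code_def by simp
      finally show "(\<Union>v\<in>set us'. cylinder n v) = cantor_set n" .
    qed
    obtain i where i: "i < length us'" "us' ! i = u"
      using set' by (metis in_set_conv_nth insertI1)
    have us': "us' = take i us' @ u # drop (Suc i) us'"
      using id_take_nth_drop[OF i(1)] i(2) by simp
    \<comment> \<open>As \<open>us'\<close> is free of repetitions, removing its entry
      \<open>u\<close> leaves exactly the words of the old code that were not merged.\<close>
    have rest: "set (take i us') \<union> set (drop (Suc i) us') = set us - S"
    proof -
      have "distinct us'" unfolding us'_def
        by (rule sorted_list_of_set.distinct_sorted_key_list_of_set)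
      then have "distinct (take i us' @ u # drop (Suc i) us')" by (simp only: us'[symmetric])
      then have "u \<notin> set (take i us') \<union> set (drop (Suc i) us')" by simp
      moreover have "set (take i us' @ u # drop (Suc i) us') =
          insert u (set (take i us') \<union> set (drop (Suc i) us'))" by simp
      then have "set us' = insert u (set (take i us') \<union> set (drop (Suc i) us'))"
        by (simp only: us'[symmetric])
      moreover have "u \<notin> set us - S" using notu by simp
      ultimately show ?thesis using insert_ident set' by metis
    qed
    have sorted'': "sorted_wrt (<) (take i us' @ u # drop (Suc i) us')"
      using sorted' by (simp only: us'[symmetric])
    have "sorted_wrt (<) (expand n us' i)"
      unfolding expand_def i(2) sorted_wrt_append
    proof (intro conjI ballI)
      show "sorted_wrt (<) (take i us')" "sorted_wrt (<) (drop (Suc i) us')"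
        using sorted'' by (simp_all add: sorted_wrt_append)
      have "sorted_wrt (<) [0..<n]" by simp
      then show "sorted_wrt (<) (map (\<lambda>a. u @ [a]) [0..<n])"
        unfolding sorted_wrt_map by (rule sorted_wrt_mono_rel[rotated]) simp
      fix x assume x: "x \<in> set (take i us')"
      then have xu: "x < u" using sorted'' by (simp add: sorted_wrt_append)
      fix y assume "y \<in> set (map (\<lambda>a. u @ [a]) [0..<n] @ drop (Suc i) us')"
      then show "x < y"
      proof (clarsimp, elim disjE)
        assume "y \<in> (\<lambda>a. u @ [a]) ` {0..<n}"
        then obtain b where "y = u @ [b]" by auto
        moreover have "u < u @ [b]" using append_less_append_iff[of u "[]" "[b]"] by simp
        ultimately show ?thesis using xu order.strict_trans by blast
      next
        assume "y \<in> set (drop (Suc i) us')"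
        then show ?thesis using sorted'' x by (simp add: sorted_wrt_append)
      qed
    next
      fix x y assume "x \<in> set (map (\<lambda>a. u @ [a]) [0..<n])" and y: "y \<in> set (drop (Suc i) us')"
      then obtain b where b: "b < n" "x = u @ [b]" by auto
      have "u < y" using sorted'' y by (simp add: sorted_wrt_append)
      \<comment> \<open>A word of the code that extends \<open>u\<close> begins with some sibling
        \<open>u @ [c]\<close>, so it equals that sibling and belongs to \<open>S\<close>; but
        \<open>y\<close> lies outside \<open>S\<close>.\<close>
      moreover have "y \<noteq> u @ z" for z
      proof
        assume yz: "y = u @ z"
        with \<open>u < y\<close> obtain c z' where z: "z = c # z'" by (cases z) auto
        have y': "y \<in> set us" "y \<notin> S" using rest y by blast+
        have "c < n" using words[OF y'(1)] yz z by simp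
        then have "u @ [c] \<in> S" unfolding S_def by auto
        then have "z' = []" using free[of "u @ [c]" z'] S y' yz z by auto
        then show False using y'(2) \<open>u @ [c] \<in> S\<close> yz z by simp
      qed
      ultimately show "x < y" unfolding b(2) by (intro append_less_of_less) auto
    qed
    moreover have "set (expand n us' i) = set us"
      using rest S unfolding expand_def i(2) S_def by (auto simp: atLeast0LessThan)
    \<comment> \<open>Strictly sorted lists with the same elements coincide, so positions need not
      be tracked.\<close>
    ultimately have eq: "us = expand n us' i"
      using strict_sorted_equal[OF _ sorted] by blast
    have "length us' < length us"
      unfolding eq length_expand[OF i(1)] using assms(2) by simp
    from less.hyps[OF this code'] show ?thesis
      unfolding eq by (intro step code' i(1))
  qed
qed

text \<open>\<open>vine d j\<close> is the address of leaf \<open>j\<close> (counted from 0) of the infinite \<open>(d + 1)\<close>-ary tree all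
  of whose carets hang on the rightmost branch. The element \<open>gen d i\<close> below absorbs a caret attached
  to leaf \<open>i\<close>; for \<open>d = 1\<close> it is \<open>x\<^sub>i\<close>.\<close>

fun vine :: "nat \<Rightarrow> nat \<Rightarrow> nat list" where
  "vine d j = (if d = 0 \<or> j < d then [j] else d # vine d (j - d))"

declare vine.simps [simp del]

lemma vine_less [simp]: "j < d \<Longrightarrow> vine d j = [j]"
  by (simp add: vine.simps)

lemma vine_add [simp]: "0 < d \<Longrightarrow> vine d (j + d) = d # vine d j"
  by (subst vine.simps) simp

lemma vine_diff: "0 < d \<Longrightarrow> d \<le> j \<Longrightarrow> vine d j = d # vine d (j - d)"
  by (subst vine.simps) simp

lemma vine_last_block: "a < d \<Longrightarrow> vine d (k * d + a) = replicate k d @ [a]"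
proof (induction k)
  case (Suc k)
  then have "vine d (Suc k * d + a) = d # vine d (k * d + a)"
    using vine_add[of d "k * d + a"] by (simp add: ac_simps)
  then show ?case using Suc by simp
qed simp

text \<open>The domain tree is a root caret with a second caret at its leaf \<open>i < d\<close>,
  the range tree is the vine with two carets. Leaves to the right of \<open>i\<close> move on by
  \<open>d\<close> places; the leaves after the first in a root caret thereby just get the letter
  \<open>d\<close> in front.\<close>

definition branch :: "nat \<Rightarrow> nat \<Rightarrow> nat word \<Rightarrow> nat word" where
  "branch d i = (\<lambda>\<omega> \<in> cantor_set (Suc d).
     if \<omega> 0 < i then \<omega>
     else if \<omega> 0 = i then vine d (i + \<omega> 1) \<frown> suffix 2 \<omega>
     else d ## \<omega>)"

definition under_last :: "nat \<Rightarrow> (nat word \<Rightarrow> nat word) \<Rightarrow> nat word \<Rightarrow> nat word" where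
  "under_last d g = (\<lambda>\<omega> \<in> cantor_set (Suc d).
     if \<omega> 0 = d then d ## g (suffix 1 \<omega>) else \<omega>)"

fun gen :: "nat \<Rightarrow> nat \<Rightarrow> nat word \<Rightarrow> nat word" where
  "gen d i = (if d = 0 \<or> i < d then branch d i else under_last d (gen d (i - d)))"

declare gen.simps [simp del]

lemma gen_less: "i < d \<Longrightarrow> gen d i = branch d i"
  by (simp add: gen.simps)

lemma gen_add: "0 < d \<Longrightarrow> gen d (i + d) = under_last d (gen d i)"
  by (subst gen.simps) simp

lemma branch_build:
  assumes "\<omega> \<in> cantor_set (Suc d)"
  shows "a < i \<Longrightarrow> i < d \<Longrightarrow> branch d i (a ## \<omega>) = a ## \<omega>"
    and "i < a \<Longrightarrow> a \<le> d \<Longrightarrow> branch d i (a ## \<omega>) = d ## a ## \<omega>"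
    and "a \<le> d \<Longrightarrow> i < d \<Longrightarrow> branch d i (i ## a ## \<omega>) = vine d (i + a) \<frown> \<omega>"
  using assms by (simp_all add: branch_def)

lemma under_last_build:
  assumes "\<omega> \<in> cantor_set (Suc d)"
  shows "under_last d g (d ## \<omega>) = d ## g \<omega>"
    and "a < d \<Longrightarrow> under_last d g (a ## \<omega>) = a ## \<omega>"
  using assms by (simp_all add: under_last_def)

lemma under_last_carrier:
  assumes "g \<in> carrier (thompson (Suc d))"
  shows "under_last d g \<in> carrier (thompson (Suc d))"
proof (rule thompsonI)
  note g = assms[unfolded thompson_carrier_iff[OF zero_less_Suc]]
  let ?C = "cantor_set (Suc d)"
  have app: "under_last d g (a ## \<xi>) = (if a = d then d ## g \<xi> else a ## \<xi>)"
    if "a < Suc d" "\<xi> \<in> ?C" for a \<xi>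
    using that under_last_build[OF that(2)] by auto
  have closed: "g \<xi> \<in> ?C" if "\<xi> \<in> ?C" for \<xi> using assms that by (rule thompson_app_closed)
  show "under_last d g \<in> extensional ?C" by (simp add: under_last_def)
  show "under_last d g ` ?C = ?C"
  proof
    show "under_last d g ` ?C \<subseteq> ?C"
    proof
      fix y assume "y \<in> under_last d g ` ?C"
      then obtain x where "x \<in> ?C" and x: "y = under_last d g x" by blast
      then obtain a \<xi> where "x = a ## \<xi>" "a < Suc d" "\<xi> \<in> ?C"
        using cantor_set_cases by blast
      with x have "y = under_last d g (a ## \<xi>)" "a < Suc d" "\<xi> \<in> ?C" by simp_all
      then show "y \<in> ?C" using closed by (simp add: app)
    qed
    show "?C \<subseteq> under_last d g ` ?C"
    proof
      fix y assume "y \<in> ?C"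
      then obtain a \<xi> where y: "y = a ## \<xi>" "a < Suc d" "\<xi> \<in> ?C" by (rule cantor_set_cases)
      have "\<xi> \<in> g ` ?C" using g y(3) by simp
      then obtain \<zeta> where z: "\<zeta> \<in> ?C" "g \<zeta> = \<xi>" by (elim imageE) simp
      show "y \<in> under_last d g ` ?C"
      proof (cases "a = d")
        case True
        then have "y = under_last d g (d ## \<zeta>)" using app[of d \<zeta>] z y by simp
        then show ?thesis using z(1) by (intro image_eqI[of _ _ "d ## \<zeta>"]) simp_all
      next
        case False
        then have "y = under_last d g y" using app[of a \<xi>] y by simp
        then show ?thesis using \<open>y \<in> ?C\<close> by (rule image_eqI)
      qed
    qed
  qed
  show "lex_mono (Suc d) (under_last d g)"
    unfolding lex_mono_def
  proof (intro ballI impI)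
    fix x y assume xC: "x \<in> ?C" and yC: "y \<in> ?C" and less: "less_fun x y"
    from xC obtain a \<xi> where x: "x = a ## \<xi>" "a < Suc d" "\<xi> \<in> ?C" by (rule cantor_set_cases)
    from yC obtain b \<zeta> where y: "y = b ## \<zeta>" "b < Suc d" "\<zeta> \<in> ?C" by (rule cantor_set_cases)
    have "less_fun \<xi> \<zeta> \<Longrightarrow> less_fun (g \<xi>) (g \<zeta>)"
      using g x(3) y(3) unfolding lex_mono_def by blast
    then show "less_fun (under_last d g x) (under_last d g y)"
      using less x(2) y(2) unfolding x(1) y(1) app[OF x(2,3)] app[OF y(2,3)] by auto
  qed
  show "locally_replacing (Suc d) (under_last d g)"
    unfolding locally_replacing_def
  proof
    fix x assume "x \<in> ?C"
    then obtain a \<xi> where x: "x = a ## \<xi>" "a < Suc d" "\<xi> \<in> ?C" by (rule cantor_set_cases)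
    show "\<exists>u v \<eta>. \<eta> \<in> ?C \<and> x = u \<frown> \<eta> \<and> (\<forall>\<omega>\<in>?C. under_last d g (u \<frown> \<omega>) = v \<frown> \<omega>)"
    proof (cases "a = d")
      case True
      obtain u v \<eta> where *: "\<eta> \<in> ?C" "\<xi> = u \<frown> \<eta>" "\<forall>\<omega>\<in>?C. g (u \<frown> \<omega>) = v \<frown> \<omega>"
        using g x(3) unfolding locally_replacing_def by blast
      have "under_last d g ((d # u) \<frown> \<omega>) = (d # v) \<frown> \<omega>" if "\<omega> \<in> ?C" for \<omega>
        using x(3) *(2,3) that app[of d "u \<frown> \<omega>"] by simp
      then show ?thesis
        using x True * by (intro exI[of _ "d # u"] exI[of _ "d # v"] exI[of _ \<eta>]) simp
    next
      case False
      then show ?thesis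
        using x app[OF x(2)] by (intro exI[of _ "[a]"] exI[of _ "[a]"] exI[of _ \<xi>]) simp
    qed
  qed
qed simp

lemma branch_carrier:
  assumes i: "i < d"
  shows "branch d i \<in> carrier (thompson (Suc d))"
proof (rule thompsonI)
  let ?C = "cantor_set (Suc d)"
  note app = branch_build
  have vine2: "vine d (i + a) = (if i + a < d then [i + a] else [d, i + a - d])" if "a \<le> d" for a
    using i that by (auto simp: vine_diff)
  have cases [consumes 1]: thesis
    if "x \<in> ?C" "\<And>a \<xi>. x = a ## \<xi> \<Longrightarrow> \<xi> \<in> ?C \<Longrightarrow> a < i \<Longrightarrow> thesis"
      "\<And>a \<xi>. x = a ## \<xi> \<Longrightarrow> \<xi> \<in> ?C \<Longrightarrow> i < a \<Longrightarrow> a \<le> d \<Longrightarrow> thesis"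
      "\<And>a \<xi>. x = i ## a ## \<xi> \<Longrightarrow> \<xi> \<in> ?C \<Longrightarrow> a \<le> d \<Longrightarrow> thesis" for x thesis
  proof -
    from that(1) obtain a \<xi> where x: "x = a ## \<xi>" "a < Suc d" "\<xi> \<in> ?C" by (rule cantor_set_cases)
    from x(3) obtain b \<zeta> where y: "\<xi> = b ## \<zeta>" "b < Suc d" "\<zeta> \<in> ?C" by (rule cantor_set_cases)
    consider "a < i" | "i < a" | "a = i" by linarith
    then show thesis using that(2-4) x y by cases auto
  qed
  show "branch d i \<in> extensional ?C" by (simp add: branch_def)
  show "branch d i ` ?C = ?C"
  proof
    show "branch d i ` ?C \<subseteq> ?C"
    proof
      fix y assume "y \<in> branch d i ` ?C"
      then obtain x where x: "x \<in> ?C" "y = branch d i x" by blast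
      from x(1) show "y \<in> ?C" unfolding x(2)
        by (cases rule: cases) (use i in \<open>auto simp: app vine2\<close>)
    qed
    show "?C \<subseteq> branch d i ` ?C"
    proof
      fix y assume "y \<in> ?C"
      then obtain b \<zeta> where y: "y = b ## \<zeta>" "b < Suc d" "\<zeta> \<in> ?C" by (rule cantor_set_cases)
      from y(3) obtain c \<xi> where z: "\<zeta> = c ## \<xi>" "c < Suc d" "\<xi> \<in> ?C" by (rule cantor_set_cases)
      consider "b < i" | "i \<le> b" "b < d" | "b = d" "c \<le> i" | "b = d" "i < c"
        using y(2) by linarith
      then show "y \<in> branch d i ` ?C"
      proof cases
        case 1
        then show ?thesis using app(1)[OF y(3) 1 i] \<open>y \<in> ?C\<close> y(1) by (metis image_eqI)
      next
        case 2
        then have "branch d i (i ## (b - i) ## \<zeta>) = y" using app(3)[OF y(3), of "b - i" i] i y(1) by simp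
        then show ?thesis using 2 i y(3) by (intro image_eqI[of _ _ "i ## (b - i) ## \<zeta>"]) simp_all
      next
        case 3
        then have "branch d i (i ## (c + d - i) ## \<xi>) = y"
          using app(3)[OF z(3), of "c + d - i" i] i y(1) z(1) by (simp add: vine2)
        then show ?thesis using 3 i z(3) by (intro image_eqI[of _ _ "i ## (c + d - i) ## \<xi>"]) simp_all
      next
        case 4
        then have "branch d i \<zeta> = y" using app(2)[OF z(3), of i c] y(1) z by simp
        then show ?thesis using y(3) by (intro image_eqI[of _ _ \<zeta>]) simp_all
      qed
    qed
  qed
  show "lex_mono (Suc d) (branch d i)"
    unfolding lex_mono_def
  proof (intro ballI impI)
    fix x y assume x: "x \<in> ?C" and y: "y \<in> ?C" and less: "less_fun x y"
    from x show "less_fun (branch d i x) (branch d i y)"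
    proof (cases rule: cases)
      case (1 a \<xi>)
      from y show ?thesis
        by (cases rule: cases) (use less i 1 in \<open>auto simp: app vine2\<close>)
    next
      case (2 a \<xi>)
      from y show ?thesis
        by (cases rule: cases) (use less i 2 in \<open>auto simp: app vine2\<close>)
    next
      case (3 a \<xi>)
      from y show ?thesis
        by (cases rule: cases) (use less i 3 in \<open>auto simp: app vine2\<close>)
    qed
  qed
  show "locally_replacing (Suc d) (branch d i)"
    unfolding locally_replacing_def
  proof
    fix x assume "x \<in> ?C"
    then show "\<exists>u v \<eta>. \<eta> \<in> ?C \<and> x = u \<frown> \<eta> \<and> (\<forall>\<omega>\<in>?C. branch d i (u \<frown> \<omega>) = v \<frown> \<omega>)"
    proof (cases rule: cases)
      case (1 a \<xi>)
      then show ?thesis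
        using i app(1) by (intro exI[of _ "[a]"] exI[of _ "[a]"] exI[of _ \<xi>]) simp
    next
      case (2 a \<xi>)
      then show ?thesis
        using i app(2) by (intro exI[of _ "[a]"] exI[of _ "[d, a]"] exI[of _ \<xi>]) simp
    next
      case (3 a \<xi>)
      then show ?thesis
        using i app(3) by (intro exI[of _ "[i, a]"] exI[of _ "vine d (i + a)"] exI[of _ \<xi>]) simp
    qed
  qed
qed simp

lemma gen_carrier: "0 < d \<Longrightarrow> gen d i \<in> carrier (thompson (Suc d))"
proof (induction d i rule: gen.induct)
  case (1 d i)
  then show ?case
    by (cases "i < d") (simp_all add: gen.simps[of d i] branch_carrier under_last_carrier)
qed

lemma set_vine [simp]: "0 < d \<Longrightarrow> set (vine d j) \<subseteq> {..<Suc d}"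
  by (induction d j rule: vine.induct) (subst vine.simps, auto)

lemma gen_rec: "d \<le> i \<Longrightarrow> 0 < d \<Longrightarrow> gen d i = under_last d (gen d (i - d))"
  by (subst gen.simps) simp

text \<open>This lemma and the next three describe the action on all leaves of a vine: those before
  leaf \<open>i\<close> stay, the children of leaf \<open>i\<close> become leaves \<open>i\<close>
  to \<open>i + d\<close>, later ones move on by \<open>d\<close>, and the last leaf goes one caret
  further down.\<close>

lemma gen_fixes:
  "0 < d \<Longrightarrow> \<eta> \<in> cantor_set (Suc d) \<Longrightarrow> j < i \<Longrightarrow> gen d i (vine d j \<frown> \<eta>) = vine d j \<frown> \<eta>"
proof (induction d i arbitrary: j rule: gen.induct)
  case (1 d i)
  show ?case
  proof (cases "i < d")
    case True
    then show ?thesis using 1 by (simp add: gen_less branch_build)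
  next
    case False
    have "d \<le> j \<Longrightarrow> gen d (i - d) (vine d (j - d) \<frown> \<eta>) = vine d (j - d) \<frown> \<eta>"
      using 1(1)[of "j - d"] 1(2-4) False by simp
    then show ?thesis
      using 1(2-4) False by (cases "j < d") (simp_all add: gen_rec vine_diff[of d j] under_last_build)
  qed
qed

lemma gen_splits:
  "0 < d \<Longrightarrow> \<eta> \<in> cantor_set (Suc d) \<Longrightarrow> a \<le> d \<Longrightarrow>
    gen d i (vine d i \<frown> a ## \<eta>) = vine d (i + a) \<frown> \<eta>"
proof (induction d i rule: gen.induct)
  case (1 d i)
  show ?case
  proof (cases "i < d")
    case True
    then show ?thesis using 1 by (simp add: gen_less branch_build)
  next
    case False
    define \<theta> where "\<theta> = a ## \<eta>"
    have "gen d (i - d) (vine d (i - d) \<frown> \<theta>) = vine d (i - d + a) \<frown> \<eta>"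
      using 1 False unfolding \<theta>_def by simp
    moreover have "\<theta> \<in> cantor_set (Suc d)" unfolding \<theta>_def using 1(3,4) by simp
    moreover have "gen d i = under_last d (gen d (i - d))" "vine d i = d # vine d (i - d)"
      "vine d (i + a) = d # vine d (i - d + a)"
      using False 1(2) gen_rec[of d i] vine_diff[of d i] vine_diff[of d "i + a"] by auto
    ultimately have "gen d i (vine d i \<frown> \<theta>) = vine d (i + a) \<frown> \<eta>"
      using 1(2) by (simp add: under_last_build)
    then show ?thesis unfolding \<theta>_def .
  qed
qed

lemma gen_shifts:
  "0 < d \<Longrightarrow> \<eta> \<in> cantor_set (Suc d) \<Longrightarrow> i < j \<Longrightarrow> gen d i (vine d j \<frown> \<eta>) = vine d (j + d) \<frown> \<eta>"
proof (induction d i arbitrary: j rule: gen.induct)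
  case (1 d i)
  show ?case
  proof (cases "i < d")
    case True
    show ?thesis
      using True 1(2-4)
      by (cases "j < d") (simp_all add: gen_less branch_build vine_diff[of d j])
  next
    case False
    have "gen d (i - d) (vine d (j - d) \<frown> \<eta>) = vine d (j - d + d) \<frown> \<eta>"
      using 1(1)[of "j - d"] False 1(2-4) by simp
    then show ?thesis using False 1(2-4)
      by (simp add: gen_rec vine_diff[of d j] under_last_build)
  qed
qed

text \<open>The last leaf of the vine with \<open>k\<close> carets has address
  \<open>replicate k d\<close>, which is no \<open>vine d j\<close> because those end in a letter
  below \<open>d\<close>. The bound on \<open>i\<close> says that the split leaf is not this last
  one.\<close>

lemma gen_last:
  "0 < d \<Longrightarrow> \<eta> \<in> cantor_set (Suc d) \<Longrightarrow> i < k * d \<Longrightarrow>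
    gen d i (replicate k d \<frown> \<eta>) = replicate (Suc k) d \<frown> \<eta>"
proof (induction d i arbitrary: k rule: gen.induct)
  case (1 d i)
  obtain k' where k: "k = Suc k'" using 1(4) by (cases k) auto
  have rep: "replicate k' d \<frown> \<eta> \<in> cantor_set (Suc d)"
    using 1(3) by (auto simp: set_replicate_conv_if)
  show ?case
  proof (cases "i < d")
    case True
    then show ?thesis using rep by (simp add: k gen_less branch_build)
  next
    case False
    have "gen d (i - d) (replicate k' d \<frown> \<eta>) = replicate (Suc k') d \<frown> \<eta>"
      using 1(1)[of k'] False 1(2-4) k by simp
    then show ?thesis using rep False 1(2) by (simp add: k gen_rec under_last_build)
  qed
qed

text \<open>The invariant treats the last leaf apart: its address depends on the number
  \<open>k\<close> of carets, while the other addresses \<open>vine d i\<close> do not.\<close>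

lemma complete_prefix_code_to_vine:
  assumes "complete_prefix_code (Suc d) us" "0 < d"
  shows "\<exists>g \<in> generate (thompson (Suc d)) (range (gen d)). \<exists>k. length us = Suc (k * d) \<and>
    (\<forall>\<eta> \<in> cantor_set (Suc d). (\<forall>i < k * d. g (us ! i \<frown> \<eta>) = vine d i \<frown> \<eta>) \<and>
       g (us ! (k * d) \<frown> \<eta>) = replicate k d \<frown> \<eta>)"
proof -
  let ?C = "cantor_set (Suc d)" and ?F = "thompson (Suc d)"
  have "2 \<le> Suc d" using assms(2) by simp
  with assms(1) show ?thesis
  proof (induction rule: complete_prefix_code_induct)
    case root
    have "\<one>\<^bsub>?F\<^esub> \<in> generate ?F (range (gen d))" by (rule generate.one)
    then show ?case by (rule bexI[rotated]) (auto intro!: exI[of _ 0])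
  next
    case (expand us i)
    then obtain g k where g: "g \<in> generate ?F (range (gen d))" and len: "length us = Suc (k * d)"
      and vine: "\<And>\<eta> i. \<eta> \<in> ?C \<Longrightarrow> i < k * d \<Longrightarrow> g (us ! i \<frown> \<eta>) = vine d i \<frown> \<eta>"
      and last: "\<And>\<eta>. \<eta> \<in> ?C \<Longrightarrow> g (us ! (k * d) \<frown> \<eta>) = replicate k d \<frown> \<eta>"
      by metis
    have words: "set (us ! j) \<subseteq> {..<Suc d}" if "j < length us" for j
      using expand.hyps(1) nth_mem[OF that] unfolding complete_prefix_code_def by blast
    have len': "length (expand (Suc d) us i) = Suc (Suc k * d)" using expand.hyps(2) len by simp
    have nth: "expand (Suc d) us i ! j = (if j < i then us ! j else
        if j < i + Suc d then us ! i @ [j - i] else us ! (j - d))" if "j \<le> Suc k * d" for j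
      using expand_nth[OF expand.hyps(2), of j "Suc d"] that len by auto
    show ?case
    proof (cases "i < k * d")
      case True
      let ?h = "g \<otimes>\<^bsub>?F\<^esub> gen d i"
      have "?h \<in> generate ?F (range (gen d))"
        by (intro generate.eng g generate.incl) simp
      moreover have "?h (expand (Suc d) us i ! j \<frown> \<eta>) = vine d j \<frown> \<eta>"
        if "\<eta> \<in> ?C" "j < Suc k * d" for \<eta> j
      proof -
        consider "j < i" | "i \<le> j" "j < i + Suc d" | "i + Suc d \<le> j" by linarith
        then show ?thesis
        proof cases
          case 1
          then show ?thesis using that True len words[of j] nth[of j] vine[of \<eta> j]
            gen_fixes[OF assms(2) that(1) 1] by (simp add: compose_def)
        next
          case 2
          then have "vine d i \<frown> (j - i) ## \<eta> \<in> ?C" using that(1) set_vine[OF assms(2), of i] by auto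
          then show ?thesis using 2 that True len words[of i] nth[of j] vine[of "(j - i) ## \<eta>" i]
            gen_splits[OF assms(2) that(1), of "j - i" i] by (simp add: compose_def)
        next
          case 3
          then show ?thesis using that True len words[of "j - d"] nth[of j] vine[of \<eta> "j - d"]
            gen_shifts[OF assms(2) that(1), of i "j - d"] by (simp add: compose_def less_diff_conv2)
        qed
      qed
      moreover have "?h (expand (Suc d) us i ! (Suc k * d) \<frown> \<eta>) = replicate (Suc k) d \<frown> \<eta>"
        if "\<eta> \<in> ?C" for \<eta>
        using that True len words[of "k * d"] nth[of "Suc k * d"] last[of \<eta>]
          gen_last[OF assms(2) that True] by (auto simp: compose_def)
      ultimately show ?thesis using len' by blast
    next
      case False
      \<comment> \<open>Splitting the last leaf of a vine gives the next vine, so \<open>g\<close>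
        is kept unchanged.\<close>
      then have i: "i = k * d" using expand.hyps(2) len by simp
      have "g (expand (Suc d) us i ! j \<frown> \<eta>) = vine d j \<frown> \<eta>" if "\<eta> \<in> ?C" "j < Suc k * d" for \<eta> j
      proof (cases "j < i")
        case True
        then show ?thesis using that nth[of j] vine[of \<eta> j] i by simp
      next
        case False
        then show ?thesis using that nth[of j] last[of "(j - i) ## \<eta>"] i
          vine_last_block[of "j - i" d k] by simp
      qed
      moreover have "g (expand (Suc d) us i ! (Suc k * d) \<frown> \<eta>) = replicate (Suc k) d \<frown> \<eta>"
        if "\<eta> \<in> ?C" for \<eta>
      proof -
        have "replicate k d \<frown> d ## \<eta> = d ## replicate k d \<frown> \<eta>" by (induction k) simp_all
        then show ?thesis using that nth[of "Suc k * d"] last[of "d ## \<eta>"] i by simp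
      qed
      ultimately show ?thesis using len' g by blast
    qed
  qed
qed

text \<open>The two codes of \<open>f\<close> have equally many words and are therefore carried to
  the same vine, by \<open>g\<close> and \<open>h\<close> say; then \<open>f\<close> followed by
  \<open>h\<close> is \<open>g\<close>.\<close>

lemma thompson_generated_infinite:
  assumes "0 < d"
  shows "carrier (thompson (Suc d)) = generate (thompson (Suc d)) (range (gen d))"
proof
  let ?F = "thompson (Suc d)" and ?C = "cantor_set (Suc d)"
  interpret group ?F by (rule group_thompson) simp
  have sub: "range (gen d) \<subseteq> carrier ?F" using gen_carrier[OF assms] by blast
  show "generate ?F (range (gen d)) \<subseteq> carrier ?F" using generate_incl[OF sub] .
  show "carrier ?F \<subseteq> generate ?F (range (gen d))"
  proof
    fix f assume f: "f \<in> carrier ?F"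
    then obtain us vs where us: "complete_prefix_code (Suc d) us" and vs: "complete_prefix_code (Suc d) vs"
      and len: "length us = length vs"
      and rep: "\<And>i \<omega>. i < length us \<Longrightarrow> \<omega> \<in> ?C \<Longrightarrow> f (us ! i \<frown> \<omega>) = vs ! i \<frown> \<omega>"
      unfolding thompson_def replaces_prefixes_def by auto
    obtain g k where g: "g \<in> generate ?F (range (gen d))" "length us = Suc (k * d)"
      "\<And>\<eta> i. \<eta> \<in> ?C \<Longrightarrow> i < k * d \<Longrightarrow> g (us ! i \<frown> \<eta>) = vine d i \<frown> \<eta>"
      "\<And>\<eta>. \<eta> \<in> ?C \<Longrightarrow> g (us ! (k * d) \<frown> \<eta>) = replicate k d \<frown> \<eta>"
      using complete_prefix_code_to_vine[OF us assms] by metis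
    obtain h l where h: "h \<in> generate ?F (range (gen d))" "length vs = Suc (l * d)"
      "\<And>\<eta> i. \<eta> \<in> ?C \<Longrightarrow> i < l * d \<Longrightarrow> h (vs ! i \<frown> \<eta>) = vine d i \<frown> \<eta>"
      "\<And>\<eta>. \<eta> \<in> ?C \<Longrightarrow> h (vs ! (l * d) \<frown> \<eta>) = replicate l d \<frown> \<eta>"
      using complete_prefix_code_to_vine[OF vs assms] by metis
    have lk: "l = k" using len g(2) h(2) assms by simp
    have gF: "g \<in> carrier ?F" and hF: "h \<in> carrier ?F"
      using generate_in_carrier[OF sub] g(1) h(1) by blast+
    have "f \<otimes>\<^bsub>?F\<^esub> h = g"
    proof (rule thompson_eqI)
      show "f \<otimes>\<^bsub>?F\<^esub> h \<in> carrier ?F" by (rule m_closed[OF f hF])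
      fix x assume x: "x \<in> ?C"
      with us obtain i \<eta> where i: "i < length us" "x = us ! i \<frown> \<eta>" "\<eta> \<in> ?C"
        by (rule complete_prefix_code_cover)
      have "h (f x) = g x"
      proof (cases "i < k * d")
        case True
        then show ?thesis using i rep[OF i(1,3)] g(3) h(3) lk by simp
      next
        case False
        then have "i = k * d" using i(1) g(2) by simp
        then show ?thesis using i rep[OF i(1,3)] g(4) h(4) lk by simp
      qed
      then show "(f \<otimes>\<^bsub>?F\<^esub> h) x = g x" using thompson_mult_app[OF x] by metis
    qed (rule gF)
    then have "f = g \<otimes>\<^bsub>?F\<^esub> inv\<^bsub>?F\<^esub> h" using f hF gF by (metis inv_solve_right)
    then show "f \<in> generate ?F (range (gen d))"
      using generate.eng[OF g(1) generate_m_inv_closed[OF sub h(1)]] by metis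
  qed
qed

text \<open>Away from the cylinder of 0, \<open>gen d 0\<close> just prepends \<open>d\<close>, and
  \<open>gen d (i + d)\<close> is a copy of \<open>gen d i\<close> below that letter. On the
  cylinder of 0 both \<open>gen d i\<close> and \<open>gen d (i + d)\<close> act trivially at the
  relevant place, since \<open>0 < i\<close>.\<close>

lemma gen_conjugate:
  assumes "0 < d" "0 < i"
  shows "gen d (i + d) = inv\<^bsub>thompson (Suc d)\<^esub> gen d 0 \<otimes>\<^bsub>thompson (Suc d)\<^esub> (gen d i \<otimes>\<^bsub>thompson (Suc d)\<^esub> gen d 0)"
proof -
  let ?F = "thompson (Suc d)" and ?C = "cantor_set (Suc d)"
  interpret group ?F by (rule group_thompson) simp
  note c = gen_carrier[OF assms(1)]
  have fix0: "gen d i (0 ## \<eta>) = 0 ## \<eta>" if "\<eta> \<in> ?C" for \<eta>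
    using gen_fixes[OF assms(1) that assms(2)] assms(1) by simp
  have "gen d 0 \<otimes>\<^bsub>?F\<^esub> gen d (i + d) = gen d i \<otimes>\<^bsub>?F\<^esub> gen d 0"
  proof (rule thompson_eqI)
    fix x assume x: "x \<in> ?C"
    then obtain a \<xi> where a: "x = a ## \<xi>" "a < Suc d" "\<xi> \<in> ?C" by (rule cantor_set_cases)
    from a(3) obtain b \<zeta> where b: "\<xi> = b ## \<zeta>" "b < Suc d" "\<zeta> \<in> ?C" by (rule cantor_set_cases)
    have "gen d (i + d) (gen d 0 x) = gen d 0 (gen d i x)"
    proof (cases "a = 0")
      case True
      then have "gen d 0 x = vine d b \<frown> \<zeta>"
        using a b assms(1) by (simp add: gen_less branch_build)
      moreover have "gen d (i + d) (vine d b \<frown> \<zeta>) = vine d b \<frown> \<zeta>"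
        using gen_fixes[OF assms(1) b(3), of b "i + d"] b(2) assms(2) by simp
      moreover have "gen d i x = x" using fix0[OF a(3)] a(1) True by simp
      ultimately show ?thesis by simp
    next
      case a0: False
      then have y: "gen d 0 x = d ## x"
        using a assms(1) by (simp add: gen_less branch_build)
      have gx: "gen d i x \<in> ?C" using c x by (rule thompson_app_closed)
      then obtain a' \<xi>' where a': "gen d i x = a' ## \<xi>'" "a' < Suc d" "\<xi>' \<in> ?C"
        by (rule cantor_set_cases)
      \<comment> \<open>As \<open>gen d i\<close> fixes the cylinder of 0 pointwise and is
        injective, it cannot move an outside point into it.\<close>
      have "a' \<noteq> 0"
      proof
        assume "a' = 0"
        then have "gen d i (0 ## \<xi>') = gen d i x" using fix0[OF a'(3)] a'(1) by simp
        then have "0 ## \<xi>' = x"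
          using thompson_inj_on[OF c[of i]] x a'(3) by (simp add: inj_on_eq_iff)
        then show False using a(1) a0 by auto
      qed
      then have "gen d 0 (gen d i x) = d ## gen d i x"
        using a' assms(1) by (simp add: gen_less branch_build)
      then show ?thesis unfolding y gen_add[OF assms(1)] using x by (simp add: under_last_build)
    qed
    then show "(gen d 0 \<otimes>\<^bsub>?F\<^esub> gen d (i + d)) x = (gen d i \<otimes>\<^bsub>?F\<^esub> gen d 0) x"
      using thompson_mult_app[OF x] by metis
  qed (intro m_closed c)+
  then show ?thesis using c by (metis inv_solve_left m_closed)
qed

text \<open>An index above \<open>d\<close> is lowered by \<open>d\<close> through conjugation with
  \<open>gen d 0\<close>; the lowered index is still positive, as the conjugation formula
  requires.\<close>

theorem thompson_generated:
  assumes "0 < d"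
  shows "carrier (thompson (Suc d)) = generate (thompson (Suc d)) (gen d ` {..d})"
proof -
  let ?F = "thompson (Suc d)"
  interpret group ?F by (rule group_thompson) simp
  let ?G = "generate ?F (gen d ` {..d})"
  have sub: "gen d ` {..d} \<subseteq> carrier ?F" using gen_carrier[OF assms] by blast
  have "gen d i \<in> ?G" for i
  proof (induction i rule: less_induct)
    case (less i)
    show ?case
    proof (cases "i \<le> d")
      case True
      then show ?thesis by (intro generate.incl) simp
    next
      case False
      have y0: "gen d 0 \<in> ?G" by (intro generate.incl) simp
      have "gen d (i - d) \<in> ?G" using less False assms by simp
      then have "inv\<^bsub>?F\<^esub> gen d 0 \<otimes>\<^bsub>?F\<^esub> (gen d (i - d) \<otimes>\<^bsub>?F\<^esub> gen d 0) \<in> ?G"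
        using y0 by (intro generate.eng generate_m_inv_closed[OF sub])
      then show ?thesis using gen_conjugate[OF assms, of "i - d"] False by simp
    qed
  qed
  then have "generate ?F (range (gen d)) \<subseteq> ?G"
    using generate_is_subgroup[OF sub] by (intro generate_subgroup_incl) auto
  then show ?thesis
    using thompson_generated_infinite[OF assms] generate_incl[OF sub] by blast
qed

section \<open>Maps represented by transducers\<close>

fun run :: "'s transducer \<Rightarrow> 's \<Rightarrow> nat list \<Rightarrow> 's" where
  "run T s [] = s"
| "run T s (a # w) = run T (snd (T s ! a)) w"

lemma transduce_append: "transduce T s (u @ v) = transduce T s u @ transduce T (run T s u) v"
  by (induction u arbitrary: s) auto

lemma transduce_prefix_mono:
  assumes "k \<le> l"
  obtains w where "transduce T s (prefix l \<omega>) = transduce T s (prefix k \<omega>) @ w"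
  using subsequence_append[of \<omega> k "l - k"] assms by (simp add: transduce_append)

text \<open>Outputs on longer prefixes extend those on shorter ones, so any prefix that yields
  enough output may replace the least one.\<close>

lemma represented_map_nth:
  assumes "i < length (transduce T s (prefix k \<omega>))"
  shows "represented_map T s \<omega> i = transduce T s (prefix k \<omega>) ! i"
proof -
  define m where "m = (LEAST k. i < length (transduce T s (prefix k \<omega>)))"
  have "i < length (transduce T s (prefix m \<omega>))" unfolding m_def using assms by (rule LeastI)
  moreover have "m \<le> k" unfolding m_def using assms by (rule Least_le)
  ultimately show ?thesis
    using transduce_prefix_mono[of m k T s \<omega>] unfolding represented_map_def m_def[symmetric]
    by (metis nth_append)
qed

text \<open>Two consecutive empty outputs are excluded, so \<open>2 * k\<close> input letters yield
  at least \<open>k\<close> output letters. In the four machines empty outputs occur only from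
  \<open>K3_k\<close> on 1 and from \<open>M1_L\<close> on 2.\<close>

locale productive_transducer =
  fixes T :: "'s transducer" and n :: nat
  assumes n_pos: "0 < n"
    and out_letters: "a < n \<Longrightarrow> set (fst (T s ! a)) \<subseteq> {..<2}"
    and productive: "a < n \<Longrightarrow> b < n \<Longrightarrow> fst (T s ! a) \<noteq> [] \<or> fst (T (snd (T s ! a)) ! b) \<noteq> []"
begin

abbreviation rep :: "'s \<Rightarrow> nat word \<Rightarrow> nat word" where
  "rep \<equiv> represented_map T"

lemma length_transduce:
  assumes "\<omega> \<in> cantor_set n"
  shows "k \<le> length (transduce T s (prefix (2 * k) \<omega>))"
  using assms
proof (induction k arbitrary: s \<omega>)
  case (Suc k)
  from Suc.prems obtain a \<xi> where a: "\<omega> = a ## \<xi>" "a < n" "\<xi> \<in> cantor_set n" by (rule cantor_set_cases)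
  from a(3) obtain b \<zeta> where b: "\<xi> = b ## \<zeta>" "b < n" "\<zeta> \<in> cantor_set n" by (rule cantor_set_cases)
  have p: "prefix (2 * Suc k) \<omega> = a # b # prefix (2 * k) \<zeta>" unfolding a(1) b(1) by simp
  have "k \<le> length (transduce T (snd (T (snd (T s ! a)) ! b)) (prefix (2 * k) \<zeta>))"
    using Suc.IH[OF b(3)] .
  moreover have "0 < length (fst (T s ! a)) + length (fst (T (snd (T s ! a)) ! b))"
    using productive[OF a(2) b(2), of s] by auto
  ultimately show ?case unfolding p transduce.simps length_append by linarith
qed simp

lemma rep_eqI:
  assumes "\<omega> \<in> cantor_set n"
    and "\<And>k i. i < length (transduce T s (prefix k \<omega>)) \<Longrightarrow> x i = transduce T s (prefix k \<omega>) ! i"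
  shows "rep s \<omega> = x"
proof
  fix i
  have "i < length (transduce T s (prefix (2 * Suc i) \<omega>))"
    using length_transduce[OF assms(1), of "Suc i" s] by simp
  then show "rep s \<omega> i = x i" using represented_map_nth assms(2) by metis
qed

lemma rep_build:
  assumes "a < n" "\<omega> \<in> cantor_set n"
  shows "rep s (a ## \<omega>) = fst (T s ! a) \<frown> rep (snd (T s ! a)) \<omega>"
proof (rule rep_eqI)
  fix k i assume i: "i < length (transduce T s (prefix k (a ## \<omega>)))"
  then obtain l where k: "k = Suc l" by (cases k) auto
  show "(fst (T s ! a) \<frown> rep (snd (T s ! a)) \<omega>) i = transduce T s (prefix k (a ## \<omega>)) ! i"
    using i represented_map_nth[of "i - length (fst (T s ! a))" T "snd (T s ! a)" \<omega> l]
    unfolding k prefix_build by (auto simp: conc_def nth_append)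
qed (use assms in simp)

lemma rep_closed:
  assumes "\<omega> \<in> cantor_set n"
  shows "rep s \<omega> \<in> cantor_set 2"
proof -
  have letters: "set (transduce T s w) \<subseteq> {..<2}" if "set w \<subseteq> {..<n}" for s w
    using that by (induction w arbitrary: s) (use out_letters in auto)
  have "rep s \<omega> i < 2" for i
  proof -
    have i: "i < length (transduce T s (prefix (2 * Suc i) \<omega>))"
      using length_transduce[OF assms, of "Suc i" s] by simp
    then show ?thesis
      using letters[OF set_prefix_subset[OF assms], of s "2 * Suc i"] nth_mem[OF i]
      unfolding represented_map_nth[OF i] by blast
  qed
  then show ?thesis by (simp add: cantor_set_def)
qed

lemma rep_continuous: "continuous_map (cantor_space n) (cantor_space 2) (rep s)"
proof (rule continuous_map_cantorI)
  show "rep s ` cantor_set n \<subseteq> cantor_set 2" using rep_closed by blast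
  fix x i assume x: "x \<in> cantor_set n"
  let ?k = "2 * Suc i"
  have i: "i < length (transduce T s (prefix ?k x))"
    using length_transduce[OF x, of "Suc i" s] by simp
  have "rep s y i = rep s x i" if "\<forall>j<?k. y j = x j" for y
  proof -
    have "prefix ?k y = prefix ?k x" using that unfolding eq_prefix_iff .
    then show ?thesis using represented_map_nth[OF i] represented_map_nth[of i T s y ?k] i by simp
  qed
  then show "\<exists>k. \<forall>y\<in>cantor_set n. (\<forall>j<k. y j = x j) \<longrightarrow> rep s y i = rep s x i" by blast
qed

end

text \<open>\<open>I s\<close> is the image of the map represented by the transducer with initial state \<open>s\<close>.\<close>

locale ordered_transducer = productive_transducer T n for T :: "'s transducer" and n +
  fixes I :: "'s \<Rightarrow> nat word set"
  assumes rep_in: "\<omega> \<in> cantor_set n \<Longrightarrow> represented_map T s \<omega> \<in> I s"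
    and covered: "x \<in> I s \<Longrightarrow> \<exists>a<n. \<exists>y\<in>I (snd (T s ! a)). x = fst (T s ! a) \<frown> y"
    and ordered: "a < b \<Longrightarrow> b < n \<Longrightarrow> x \<in> I (snd (T s ! a)) \<Longrightarrow> y \<in> I (snd (T s ! b)) \<Longrightarrow>
      less_fun (fst (T s ! a) \<frown> x) (fst (T s ! b) \<frown> y)"
begin

text \<open>Equal leading letters produce the same output and lead to the same state, and at the
  first difference \<open>ordered\<close> decides. The induction on the position of this difference
  must therefore run over all states.\<close>

lemma rep_mono: "lex_mono n (rep s)"
proof -
  have "less_fun (rep s x) (rep s y)"
    if "x \<in> cantor_set n" "y \<in> cantor_set n" "x k < y k" "\<And>j. j < k \<Longrightarrow> x j = y j" for x y k
    using that
  proof (induction k arbitrary: s x y)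
    case 0
    obtain a \<xi> where x: "x = a ## \<xi>" "a < n" "\<xi> \<in> cantor_set n"
      using 0(1) by (rule cantor_set_cases)
    obtain b \<zeta> where y: "y = b ## \<zeta>" "b < n" "\<zeta> \<in> cantor_set n"
      using 0(2) by (rule cantor_set_cases)
    show ?case
      using 0(3) ordered[of a b "rep (snd (T s ! a)) \<xi>" s "rep (snd (T s ! b)) \<zeta>"] x y
      by (simp add: rep_build rep_in)
  next
    case (Suc k)
    obtain a \<xi> where x: "x = a ## \<xi>" "a < n" "\<xi> \<in> cantor_set n"
      using Suc.prems(1) by (rule cantor_set_cases)
    obtain b \<zeta> where y: "y = b ## \<zeta>" "b < n" "\<zeta> \<in> cantor_set n"
      using Suc.prems(2) by (rule cantor_set_cases)
    have "a = b" using Suc.prems(4)[of 0] x y by simp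
    moreover have "\<xi> j = \<zeta> j" if "j < k" for j using Suc.prems(4)[of "Suc j"] x y that by simp
    ultimately show ?case
      using Suc.IH[OF x(3) y(3), of "snd (T s ! a)"] Suc.prems(3) x y by (simp add: rep_build)
  qed
  then show ?thesis unfolding lex_mono_def less_fun_def by metis
qed

text \<open>Decoding: for a pair of a state and an output word, \<open>covered\<close> chooses an
  input letter and the remaining output. Iterating this choice gives the input word
  \<open>W\<close>, whose output agrees with \<open>x\<close> on every finite stretch and hence, by
  productivity, entirely.\<close>

lemma rep_surj:
  assumes "x \<in> I s"
  shows "x \<in> rep s ` cantor_set n"
proof -
  have "\<forall>p. \<exists>a y. snd p \<in> I (fst p) \<longrightarrow> a < n \<and> y \<in> I (snd (T (fst p) ! a)) \<and> snd p = fst (T (fst p) ! a) \<frown> y"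
    using covered by (metis prod.collapse)
  then obtain al nx where step: "\<And>p. snd p \<in> I (fst p) \<Longrightarrow> al p < n \<and> nx p \<in> I (snd (T (fst p) ! al p)) \<and>
      snd p = fst (T (fst p) ! al p) \<frown> nx p"
    by metis
  define succ where "succ p = (snd (T (fst p) ! al p), nx p)" for p
  define W where "W p = (\<lambda>i. al ((succ ^^ i) p))" for p
  have W: "W p = al p ## W (succ p)" for p
  proof
    fix i show "W p i = (al p ## W (succ p)) i"
      by (cases i) (simp_all add: W_def funpow_swap1)
  qed
  have inv: "snd (succ p) \<in> I (fst (succ p))" if "snd p \<in> I (fst p)" for p
    using step[OF that] unfolding succ_def by simp
  have W_in: "W p \<in> cantor_set n" if "snd p \<in> I (fst p)" for p
  proof -
    have "snd ((succ ^^ i) p) \<in> I (fst ((succ ^^ i) p))" for i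
      by (induction i) (use that inv in simp_all)
    then show ?thesis unfolding W_def cantor_set_def using step by simp
  qed
  have "i < length (transduce T (fst p) (prefix k (W p))) \<Longrightarrow>
      snd p i = transduce T (fst p) (prefix k (W p)) ! i" if "snd p \<in> I (fst p)" for p k i
    using that
  proof (induction k arbitrary: p i)
    case (Suc k)
    let ?w = "fst (T (fst p) ! al p)"
    have sp: "snd p = ?w \<frown> snd (succ p)" "snd (T (fst p) ! al p) = fst (succ p)"
      using step[OF Suc.prems(2)] unfolding succ_def by simp_all
    have "prefix (Suc k) (W p) = al p # prefix k (W (succ p))"
      by (subst W) (rule prefix_build)
    then have "transduce T (fst p) (prefix (Suc k) (W p)) =
        ?w @ transduce T (fst (succ p)) (prefix k (W (succ p)))"
      using sp(2) by simp
    then show ?case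
      using Suc.IH[OF _ inv[OF Suc.prems(2)], of "i - length ?w"] Suc.prems(1)
      by (subst sp(1)) (auto simp: conc_def nth_append)
  qed simp
  from this[of "(s, x)"] have "rep s (W (s, x)) = x"
    using assms W_in[of "(s, x)"] by (intro rep_eqI) simp_all
  then show ?thesis using W_in[of "(s, x)"] assms by (metis fst_conv snd_conv image_eqI)
qed

lemma rep_image: "rep s ` cantor_set n = I s"
  using rep_in rep_surj by blast

lemma rep_homeomorphic:
  assumes "I s = cantor_set 2"
  shows "homeomorphic_map (cantor_space n) (cantor_space 2) (rep s)"
  using rep_continuous rep_image lex_mono_inj_on[OF rep_mono] assms
  by (intro continuous_imp_homeomorphic_map compact_space_cantor Hausdorff_space_cantor)
    (auto simp: topspace_cantor_space)

end

section \<open>Conjugation of \<open>F\<^sub>n\<close> into \<open>F\<close>\<close>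

locale conjugation =
  fixes n :: nat and \<psi> :: "nat word \<Rightarrow> nat word"
  assumes n_pos: "0 < n"
    and \<psi>_mono: "lex_mono n \<psi>"
    and \<psi>_image: "\<psi> ` cantor_set n = cantor_set 2"
begin

text \<open>The result need not lie in \<open>F\<close> a priori. The homomorphism laws below
  therefore carry membership of the images as a hypothesis, which later is discharged on generators
  only.\<close>

definition transport :: "(nat word \<Rightarrow> nat word) \<Rightarrow> nat word \<Rightarrow> nat word" where
  "transport f = (\<lambda>\<omega> \<in> cantor_set 2. \<psi> (f (inv_into (cantor_set n) \<psi> \<omega>)))"

lemma conjugated_thompson_eq: "conjugated_thompson n \<psi> = transport ` carrier (thompson n)"
  unfolding conjugated_thompson_def transport_def ..

lemma \<psi>_inj: "inj_on \<psi> (cantor_set n)"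
  using \<psi>_mono by (rule lex_mono_inj_on)

lemma \<psi>_closed: "\<xi> \<in> cantor_set n \<Longrightarrow> \<psi> \<xi> \<in> cantor_set 2"
  using \<psi>_image by blast

lemma \<psi>_cases:
  assumes "x \<in> cantor_set 2"
  obtains \<xi> where "\<xi> \<in> cantor_set n" "x = \<psi> \<xi>"
  using assms \<psi>_image by blast

lemma transport_app: "\<xi> \<in> cantor_set n \<Longrightarrow> transport f (\<psi> \<xi>) = \<psi> (f \<xi>)"
  unfolding transport_def using \<psi>_closed by (simp add: inv_into_f_f[OF \<psi>_inj])

text \<open>Since \<psi> is onto, a candidate for the conjugate can be tested at points \<psi>
  \<xi>, so the inverse of \<psi> never has to be evaluated.\<close>

lemma transport_eqI:
  assumes "g \<in> carrier thompson_F" "\<And>\<xi>. \<xi> \<in> cantor_set n \<Longrightarrow> g (\<psi> \<xi>) = \<psi> (f \<xi>)"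
  shows "transport f = g"
proof (rule extensionalityI)
  show "transport f \<in> extensional (cantor_set 2)" unfolding transport_def by simp
  show "g \<in> extensional (cantor_set 2)" using assms(1) by (simp add: thompson_def)
  fix x assume "x \<in> cantor_set 2"
  then show "transport f x = g x" using assms(2) transport_app by (elim \<psi>_cases) simp
qed

lemma transport_mult:
  assumes "f \<in> carrier (thompson n)" "g \<in> carrier (thompson n)"
    and "transport f \<in> carrier thompson_F" "transport g \<in> carrier thompson_F"
  shows "transport (f \<otimes>\<^bsub>thompson n\<^esub> g) = transport f \<otimes>\<^bsub>thompson_F\<^esub> transport g"
proof (rule transport_eqI)
  interpret F: group thompson_F by (rule group_thompson) simp
  show "transport f \<otimes>\<^bsub>thompson_F\<^esub> transport g \<in> carrier thompson_F" using assms by (intro F.m_closed)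
  fix \<xi> assume \<xi>: "\<xi> \<in> cantor_set n"
  show "(transport f \<otimes>\<^bsub>thompson_F\<^esub> transport g) (\<psi> \<xi>) = \<psi> ((f \<otimes>\<^bsub>thompson n\<^esub> g) \<xi>)"
    using thompson_app_closed[OF assms(1) \<xi>]
    by (simp only: thompson_mult_app[OF \<xi>] thompson_mult_app[OF \<psi>_closed[OF \<xi>]] transport_app \<xi>)
qed

lemma transport_inv:
  assumes "f \<in> carrier (thompson n)" "transport f \<in> carrier thompson_F"
  shows "transport (inv\<^bsub>thompson n\<^esub> f) = inv\<^bsub>thompson_F\<^esub> transport f"
proof (rule transport_eqI)
  interpret F: group thompson_F by (rule group_thompson) simp
  interpret Fn: group "thompson n" by (rule group_thompson[OF n_pos])
  show "inv\<^bsub>thompson_F\<^esub> transport f \<in> carrier thompson_F" using assms by (intro F.inv_closed)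
  fix \<xi> assume \<xi>: "\<xi> \<in> cantor_set n"
  define \<zeta> where "\<zeta> = (inv\<^bsub>thompson n\<^esub> f) \<xi>"
  have \<zeta>: "\<zeta> \<in> cantor_set n"
    unfolding \<zeta>_def using thompson_app_closed[OF Fn.inv_closed[OF assms(1)] \<xi>] .
  have "(inv\<^bsub>thompson n\<^esub> f \<otimes>\<^bsub>thompson n\<^esub> f) \<xi> = \<one>\<^bsub>thompson n\<^esub> \<xi>"
    using assms(1) by (simp only: Fn.l_inv)
  then have "f \<zeta> = \<xi>" unfolding \<zeta>_def using \<xi> by (simp add: compose_def)
  then have "transport f (\<psi> \<zeta>) = \<psi> \<xi>" using transport_app[OF \<zeta>] by simp
  then show "(inv\<^bsub>thompson_F\<^esub> transport f) (\<psi> \<xi>) = \<psi> ((inv\<^bsub>thompson n\<^esub> f) \<xi>)"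
    using thompson_inv_app[OF _ assms(2) \<psi>_closed[OF \<zeta>]] unfolding \<zeta>_def by simp
qed

lemma transport_generate:
  assumes "G \<subseteq> carrier (thompson n)" "transport ` G \<subseteq> carrier thompson_F"
  shows "transport ` generate (thompson n) G = generate thompson_F (transport ` G)"
proof -
  interpret F: group thompson_F by (rule group_thompson) simp
  interpret Fn: group "thompson n" by (rule group_thompson[OF n_pos])
  note carr = F.generate_in_carrier[OF assms(2)] Fn.generate_in_carrier[OF assms(1)]
  have transport_one: "transport \<one>\<^bsub>thompson n\<^esub> = \<one>\<^bsub>thompson_F\<^esub>"
    using \<psi>_closed by (intro transport_eqI F.one_closed) simp
  have 1: "transport f \<in> generate thompson_F (transport ` G)" if "f \<in> generate (thompson n) G" for f
    using that
  proof induction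
    case one
    then show ?case unfolding transport_one by (rule generate.one)
  next
    case (incl h)
    then show ?case by (intro generate.incl) blast
  next
    case (inv h)
    then have "transport (inv\<^bsub>thompson n\<^esub> h) = inv\<^bsub>thompson_F\<^esub> transport h"
      using assms by (intro transport_inv) blast+
    then show ?case using inv by (simp only:) (intro generate.inv imageI)
  next
    case (eng h1 h2)
    have "transport (h1 \<otimes>\<^bsub>thompson n\<^esub> h2) = transport h1 \<otimes>\<^bsub>thompson_F\<^esub> transport h2"
      using eng carr by (intro transport_mult)
    then show ?case using eng by (simp only:) (intro generate.eng)
  qed
  have 2: "g \<in> transport ` generate (thompson n) G" if "g \<in> generate thompson_F (transport ` G)" for g
    using that
  proof induction
    case one
    then show ?case using generate.one[of "thompson n" G] transport_one by (metis image_eqI)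
  next
    case (incl h)
    then show ?case using generate.incl[of _ G "thompson n"] by blast
  next
    case (inv h)
    then obtain f where f: "f \<in> G" "h = transport f" by blast
    then have "inv\<^bsub>thompson_F\<^esub> h = transport (inv\<^bsub>thompson n\<^esub> f)"
      unfolding f(2) using assms f(1) by (intro transport_inv[symmetric]) blast+
    then show ?case using generate.inv[OF f(1), of "thompson n"] by blast
  next
    case (eng h1 h2)
    then obtain f1 f2 where f: "f1 \<in> generate (thompson n) G" "f2 \<in> generate (thompson n) G"
      "h1 = transport f1" "h2 = transport f2" by blast
    have "h1 \<otimes>\<^bsub>thompson_F\<^esub> h2 = transport (f1 \<otimes>\<^bsub>thompson n\<^esub> f2)"
      unfolding f(3,4) by (intro transport_mult[symmetric] carr(2) carr(1)[OF 1] f(1,2))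
    then show ?case using generate.eng[OF f(1,2)] by blast
  qed
  show ?thesis using 1 2 by blast
qed

lemma transport_inj_on: "inj_on transport (carrier (thompson n))"
proof (rule inj_onI)
  fix f g assume f: "f \<in> carrier (thompson n)" and g: "g \<in> carrier (thompson n)" and eq: "transport f = transport g"
  show "f = g"
  proof (rule thompson_eqI[OF f g])
    fix \<xi> assume \<xi>: "\<xi> \<in> cantor_set n"
    have "\<psi> (f \<xi>) = \<psi> (g \<xi>)" using transport_app[OF \<xi>] eq by metis
    then show "f \<xi> = g \<xi>"
      using \<psi>_inj thompson_app_closed[OF f \<xi>] thompson_app_closed[OF g \<xi>] by (simp add: inj_on_eq_iff)
  qed
qed

lemma conjugated_is_iso:
  assumes "conjugated_thompson n \<psi> \<subseteq> carrier thompson_F"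
  shows "thompson_F\<lparr>carrier := conjugated_thompson n \<psi>\<rparr> \<cong> thompson n"
proof -
  interpret Fn: group "thompson n" by (rule group_thompson[OF n_pos])
  let ?H = "thompson_F\<lparr>carrier := conjugated_thompson n \<psi>\<rparr>"
  have in_F: "transport f \<in> carrier thompson_F" if "f \<in> carrier (thompson n)" for f
    using that assms unfolding conjugated_thompson_eq by blast
  have "transport \<in> hom (thompson n) ?H"
  proof (rule homI)
    fix f g assume "f \<in> carrier (thompson n)" "g \<in> carrier (thompson n)"
    then show "transport (f \<otimes>\<^bsub>thompson n\<^esub> g) = transport f \<otimes>\<^bsub>?H\<^esub> transport g"
      using transport_mult[OF _ _ in_F in_F] by simp
  qed (simp add: conjugated_thompson_eq)
  then have "transport \<in> iso (thompson n) ?H"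
    using transport_inj_on by (simp add: iso_def bij_betw_def conjugated_thompson_eq)
  then show ?thesis using Fn.iso_sym unfolding is_iso_def by blast
qed

text \<open>The candidate preimage is obtained by conjugating \<open>f\<close> back to the
  \<open>n\<close>-ary space. It is monotone and onto because \<open>f\<close> and \<psi> are, and
  \<open>loc\<close> is prefix replacement for it, seen through \<psi>.\<close>

lemma conjugated_thompsonI:
  assumes f: "f \<in> carrier thompson_F"
    and loc: "\<And>\<xi>. \<xi> \<in> cantor_set n \<Longrightarrow> \<exists>p p' \<eta>. \<eta> \<in> cantor_set n \<and> \<xi> = p \<frown> \<eta> \<and> set p' \<subseteq> {..<n} \<and>
      (\<forall>\<omega> \<in> cantor_set n. f (\<psi> (p \<frown> \<omega>)) = \<psi> (p' \<frown> \<omega>))"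
  shows "f \<in> conjugated_thompson n \<psi>"
proof -
  let ?i = "inv_into (cantor_set n) \<psi>"
  define g where "g = (\<lambda>\<xi> \<in> cantor_set n. ?i (f (\<psi> \<xi>)))"
  note f' = f[unfolded thompson_carrier_iff[OF zero_less_numeral]]
  have i_closed: "?i x \<in> cantor_set n" "\<psi> (?i x) = x" if "x \<in> cantor_set 2" for x
    using that \<psi>_image by (auto simp: inv_into_into f_inv_into_f)
  have i_mono: "lex_mono 2 ?i" using \<psi>_mono \<psi>_image by (rule lex_mono_inv_into)
  have f_closed: "f x \<in> cantor_set 2" if "x \<in> cantor_set 2" for x
    using f that by (rule thompson_app_closed)
  have \<psi>g: "\<psi> (g \<xi>) = f (\<psi> \<xi>)" if "\<xi> \<in> cantor_set n" for \<xi>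
    unfolding g_def using that \<psi>_closed f_closed i_closed by simp
  have "g \<in> carrier (thompson n)"
  proof (rule thompsonI[OF n_pos])
    show "g \<in> extensional (cantor_set n)" unfolding g_def by simp
    have "g ` cantor_set n = ?i ` f ` \<psi> ` cantor_set n"
      unfolding g_def image_image by (intro image_cong) simp_all
    also have "\<dots> = ?i ` \<psi> ` cantor_set n" using f' \<psi>_image by simp
    also have "\<dots> = cantor_set n" using inv_into_image_cancel[OF \<psi>_inj order_refl] .
    finally show "g ` cantor_set n = cantor_set n" .
    show "lex_mono n g"
      unfolding lex_mono_def
    proof (intro ballI impI)
      fix x y assume x: "x \<in> cantor_set n" and y: "y \<in> cantor_set n" and less: "less_fun x y"
      have "less_fun (\<psi> x) (\<psi> y)" using \<psi>_mono x y less unfolding lex_mono_def by blast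
      then have "less_fun (f (\<psi> x)) (f (\<psi> y))"
        using f' \<psi>_closed[OF x] \<psi>_closed[OF y] unfolding lex_mono_def by blast
      then show "less_fun (g x) (g y)"
        using i_mono f_closed[OF \<psi>_closed[OF x]] f_closed[OF \<psi>_closed[OF y]] x y
        unfolding lex_mono_def g_def by simp
    qed
    show "locally_replacing n g"
      unfolding locally_replacing_def
    proof
      fix \<xi> assume \<xi>: "\<xi> \<in> cantor_set n"
      obtain p p' \<eta> where p: "\<eta> \<in> cantor_set n" "\<xi> = p \<frown> \<eta>" "set p' \<subseteq> {..<n}"
        "\<And>\<omega>. \<omega> \<in> cantor_set n \<Longrightarrow> f (\<psi> (p \<frown> \<omega>)) = \<psi> (p' \<frown> \<omega>)"
        using loc[OF \<xi>] by blast
      have "g (p \<frown> \<omega>) = p' \<frown> \<omega>" if "\<omega> \<in> cantor_set n" for \<omega>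
        using p \<xi> that inv_into_f_f[OF \<psi>_inj, of "p' \<frown> \<omega>"] unfolding g_def by simp
      then show "\<exists>u v \<eta>. \<eta> \<in> cantor_set n \<and> \<xi> = u \<frown> \<eta> \<and> (\<forall>\<omega>\<in>cantor_set n. g (u \<frown> \<omega>) = v \<frown> \<omega>)"
        using p(1,2) by blast
    qed
  qed
  moreover have "transport g = f" using f \<psi>g by (intro transport_eqI) simp_all
  ultimately show ?thesis unfolding conjugated_thompson_eq by blast
qed

end

section \<open>The four transducers\<close>

lemma cantor_set_2_cases:
  assumes "\<omega> \<in> cantor_set 2"
  obtains \<eta> where "\<omega> = 0 ## \<eta>" "\<eta> \<in> cantor_set 2" | \<eta> where "\<omega> = Suc 0 ## \<eta>" "\<eta> \<in> cantor_set 2"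
proof -
  from assms obtain a \<eta> where "\<omega> = a ## \<eta>" "a < 2" "\<eta> \<in> cantor_set 2" by (rule cantor_set_cases)
  then show thesis using that by (cases "a = 0") (auto simp: less_2_cases_iff)
qed

lemma cantor_set_3_cases:
  assumes "\<omega> \<in> cantor_set 3"
  obtains \<eta> where "\<omega> = 0 ## \<eta>" "\<eta> \<in> cantor_set 3"
    | \<eta> where "\<omega> = Suc 0 ## \<eta>" "\<eta> \<in> cantor_set 3"
    | \<eta> where "\<omega> = 2 ## \<eta>" "\<eta> \<in> cantor_set 3"
proof -
  from assms obtain a \<eta> where "\<omega> = a ## \<eta>" "a < 3" "\<eta> \<in> cantor_set 3" by (rule cantor_set_cases)
  moreover from this(2) have "a = 0 \<or> a = Suc 0 \<or> a = 2" by linarith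
  ultimately show thesis using that by blast
qed

text \<open>Three letters are enough to find the transition that produced an output, since no output
  word of the four machines is longer.\<close>

lemma cantor_set_2_cases3:
  assumes "x \<in> cantor_set 2"
  obtains b c d \<eta> where "x = b ## c ## d ## \<eta>" "b = 0 \<or> b = Suc 0" "c = 0 \<or> c = Suc 0"
    "d = 0 \<or> d = Suc 0" "\<eta> \<in> cantor_set 2"
proof -
  have step: "\<exists>b \<eta>. y = b ## \<eta> \<and> (b = 0 \<or> b = Suc 0) \<and> \<eta> \<in> cantor_set 2" if "y \<in> cantor_set 2" for y
    using that by (rule cantor_set_2_cases) auto
  from step[OF assms] obtain b y where 1: "x = b ## y" "b = 0 \<or> b = Suc 0" "y \<in> cantor_set 2" by blast
  from step[OF 1(3)] obtain c z where 2: "y = c ## z" "c = 0 \<or> c = Suc 0" "z \<in> cantor_set 2" by blast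
  from step[OF 2(3)] obtain d \<eta> where 3: "z = d ## \<eta>" "d = 0 \<or> d = Suc 0" "\<eta> \<in> cantor_set 2" by blast
  show thesis using that[of b c d \<eta>] 1 2 3 by simp
qed

lemma ex_less_3: "(\<exists>a<3::nat. P a) \<longleftrightarrow> P 0 \<or> P (Suc 0) \<or> P 2"
  by (auto simp: numeral_3_eq_3 numeral_2_eq_2 less_Suc_eq)

lemma ex_less_2: "(\<exists>a<2::nat. P a) \<longleftrightarrow> P 0 \<or> P (Suc 0)"
  by (auto simp: numeral_2_eq_2 less_Suc_eq)

lemma less_3_cases: "a < 3 \<Longrightarrow> a = 0 \<or> a = Suc 0 \<or> a = (2 :: nat)"
  by linarith

lemma less_less_3_cases:
  "a < b \<Longrightarrow> b < 3 \<Longrightarrow> a = 0 \<and> b = Suc 0 \<or> a = 0 \<and> b = 2 \<or> a = Suc 0 \<and> b = (2 :: nat)"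
  by linarith

lemma less_less_2_cases: "a < b \<Longrightarrow> b < 2 \<Longrightarrow> a = 0 \<and> b = Suc (0 :: nat)"
  by linarith

text \<open>These are the images of the states whose siblings have taken part of the cylinder:
  \<open>K1_G\<close> and \<open>K3_m\<close> must avoid 00, which belongs to the other transition,
  and \<open>M1_O\<close>, entered from \<open>M1_L\<close> with empty output, must avoid both 00
  and 010.\<close>

definition avoid_00 :: "nat word set" where
  "avoid_00 = {x \<in> cantor_set 2. \<not> (x 0 = 0 \<and> x 1 = 0)}"

definition avoid_00_010 :: "nat word set" where
  "avoid_00_010 = {x \<in> cantor_set 2. \<not> (x 0 = 0 \<and> (x 1 = 0 \<or> x 2 = 0))}"

lemmas avoid_defs = avoid_00_def avoid_00_010_def

lemma in_avoid_build [simp]: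
  "a ## b ## \<omega> \<in> avoid_00 \<longleftrightarrow> a ## b ## \<omega> \<in> cantor_set 2 \<and> \<not> (a = 0 \<and> b = 0)"
  "a ## b ## c ## \<omega> \<in> avoid_00_010 \<longleftrightarrow>
     a ## b ## c ## \<omega> \<in> cantor_set 2 \<and> \<not> (a = 0 \<and> (b = 0 \<or> c = 0))"
  by (auto simp: avoid_defs)

lemma in_avoid_one [simp]:
  "Suc 0 ## \<omega> \<in> avoid_00 \<longleftrightarrow> \<omega> \<in> cantor_set 2"
  "Suc 0 ## \<omega> \<in> avoid_00_010 \<longleftrightarrow> \<omega> \<in> cantor_set 2"
  by (auto simp: avoid_defs)

lemma less_fun_avoid [simp]:
  "y \<in> avoid_00 \<Longrightarrow> less_fun (0 ## 0 ## x) y"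
  "y \<in> avoid_00_010 \<Longrightarrow> less_fun (0 ## 0 ## x) y"
  "y \<in> avoid_00_010 \<Longrightarrow> less_fun (0 ## Suc 0 ## 0 ## x) y"
proof -
  assume y: "y \<in> avoid_00"
  then have "y \<in> cantor_set 2" by (simp add: avoid_defs)
  then obtain b c d \<eta> where "y = b ## c ## d ## \<eta>" "b = 0 \<or> b = Suc 0" "c = 0 \<or> c = Suc 0"
    "d = 0 \<or> d = Suc 0" "\<eta> \<in> cantor_set 2" by (rule cantor_set_2_cases3)
  then show "less_fun (0 ## 0 ## x) y" using y by auto
next
  assume y: "y \<in> avoid_00_010"
  then have "y \<in> cantor_set 2" by (simp add: avoid_defs)
  then obtain b c d \<eta> where "y = b ## c ## d ## \<eta>" "b = 0 \<or> b = Suc 0" "c = 0 \<or> c = Suc 0"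
    "d = 0 \<or> d = Suc 0" "\<eta> \<in> cantor_set 2" by (rule cantor_set_2_cases3)
  then show "less_fun (0 ## 0 ## x) y" "less_fun (0 ## Suc 0 ## 0 ## x) y" using y by auto
qed

lemma avoid_imp_cantor_set: "x \<in> avoid_00 \<Longrightarrow> x \<in> cantor_set 2" "x \<in> avoid_00_010 \<Longrightarrow> x \<in> cantor_set 2"
  by (auto simp: avoid_defs)

definition I_K1 :: "K1_state \<Rightarrow> nat word set" where
  "I_K1 s = (if s = K1_G then avoid_00 else cantor_set 2)"

definition I_K3 :: "K3_state \<Rightarrow> nat word set" where
  "I_K3 s = (if s = K3_m then avoid_00 else cantor_set 2)"

definition I_M1 :: "M1_state \<Rightarrow> nat word set" where
  "I_M1 s = (if s = M1_O then avoid_00_010 else cantor_set 2)"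

interpretation tK1: productive_transducer T_K1 3
proof
  fix a b :: nat and s assume "a < (3::nat)"
  then show "set (fst (T_K1 s ! a)) \<subseteq> {..<2}"
    by (cases s) (auto dest!: less_3_cases)
  assume "b < 3"
  then show "fst (T_K1 s ! a) \<noteq> [] \<or> fst (T_K1 (snd (T_K1 s ! a)) ! b) \<noteq> []"
    using \<open>a < 3\<close> by (cases s) (auto dest!: less_3_cases)
qed simp

interpretation tK3: productive_transducer T_K3 2
proof
  fix a b :: nat and s assume "a < (2::nat)"
  then show "set (fst (T_K3 s ! a)) \<subseteq> {..<2}"
    by (cases s) (auto simp: less_2_cases_iff)
  assume "b < 2"
  then show "fst (T_K3 s ! a) \<noteq> [] \<or> fst (T_K3 (snd (T_K3 s ! a)) ! b) \<noteq> []"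
    using \<open>a < 2\<close> by (cases s) (auto simp: less_2_cases_iff)
qed simp

interpretation tM0: productive_transducer T_M0 3
proof
  fix a b :: nat and s assume "a < (3::nat)"
  then show "set (fst (T_M0 s ! a)) \<subseteq> {..<2}"
    by (cases s) (auto dest!: less_3_cases)
  assume "b < 3"
  then show "fst (T_M0 s ! a) \<noteq> [] \<or> fst (T_M0 (snd (T_M0 s ! a)) ! b) \<noteq> []"
    using \<open>a < 3\<close> by (cases s) (auto dest!: less_3_cases)
qed simp

interpretation tM1: productive_transducer T_M1 3
proof
  fix a b :: nat and s assume "a < (3::nat)"
  then show "set (fst (T_M1 s ! a)) \<subseteq> {..<2}"
    by (cases s) (auto dest!: less_3_cases)
  assume "b < 3"
  then show "fst (T_M1 s ! a) \<noteq> [] \<or> fst (T_M1 (snd (T_M1 s ! a)) ! b) \<noteq> []"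
    using \<open>a < 3\<close> by (cases s) (auto dest!: less_3_cases)
qed simp

lemmas rep_simps [simp] =
  tK1.rep_build tK3.rep_build tM0.rep_build tM1.rep_build
  tK1.rep_closed tK3.rep_closed tM0.rep_closed tM1.rep_closed

text \<open>Although the images consist of infinite words, the output on one input letter already
  decides whether the forbidden prefix occurs; so \<open>rep_in\<close> needs no coinduction, here
  and for the other machines.\<close>

interpretation oK1: ordered_transducer T_K1 3 I_K1
proof
  fix \<omega> s assume "\<omega> \<in> cantor_set 3"
  then show "represented_map T_K1 s \<omega> \<in> I_K1 s"
    by (rule cantor_set_3_cases; cases s) (simp_all add: I_K1_def)
next
  fix x s assume x: "x \<in> I_K1 s"
  then have "x \<in> cantor_set 2" by (auto simp: I_K1_def avoid_imp_cantor_set split: if_splits)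
  then obtain b c d \<eta> where "x = b ## c ## d ## \<eta>" "b = 0 \<or> b = Suc 0" "c = 0 \<or> c = Suc 0"
    "d = 0 \<or> d = Suc 0" "\<eta> \<in> cantor_set 2" by (rule cantor_set_2_cases3)
  then show "\<exists>a<3. \<exists>y\<in>I_K1 (snd (T_K1 s ! a)). x = fst (T_K1 s ! a) \<frown> y"
    using x unfolding ex_less_3 by (cases s; elim disjE) (simp_all add: I_K1_def)
next
  fix a b :: nat and x y s
  assume ab: "a < b" "b < (3::nat)" and x: "x \<in> I_K1 (snd (T_K1 s ! a))" and y: "y \<in> I_K1 (snd (T_K1 s ! b))"
  show "less_fun (fst (T_K1 s ! a) \<frown> x) (fst (T_K1 s ! b) \<frown> y)"
    using less_less_3_cases[OF ab] x y by (elim disjE conjE; hypsubst; cases s) (simp_all add: I_K1_def)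
qed

interpretation oK3: ordered_transducer T_K3 2 I_K3
proof
  fix \<omega> s assume "\<omega> \<in> cantor_set 2"
  then show "represented_map T_K3 s \<omega> \<in> I_K3 s"
    by (rule cantor_set_2_cases; cases s) (simp_all add: I_K3_def)
next
  fix x s assume x: "x \<in> I_K3 s"
  then have "x \<in> cantor_set 2" by (auto simp: I_K3_def avoid_imp_cantor_set split: if_splits)
  then obtain b c d \<eta> where "x = b ## c ## d ## \<eta>" "b = 0 \<or> b = Suc 0" "c = 0 \<or> c = Suc 0"
    "d = 0 \<or> d = Suc 0" "\<eta> \<in> cantor_set 2" by (rule cantor_set_2_cases3)
  then show "\<exists>a<2. \<exists>y\<in>I_K3 (snd (T_K3 s ! a)). x = fst (T_K3 s ! a) \<frown> y"
    using x unfolding ex_less_2 by (cases s; elim disjE) (simp_all add: I_K3_def)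
next
  fix a b :: nat and x y s
  assume ab: "a < b" "b < (2::nat)" and x: "x \<in> I_K3 (snd (T_K3 s ! a))" and y: "y \<in> I_K3 (snd (T_K3 s ! b))"
  show "less_fun (fst (T_K3 s ! a) \<frown> x) (fst (T_K3 s ! b) \<frown> y)"
    using less_less_2_cases[OF ab] x y by (elim disjE conjE; hypsubst; cases s) (simp_all add: I_K3_def)
qed

interpretation oM0: ordered_transducer T_M0 3 "\<lambda>_. cantor_set 2"
proof
  fix \<omega> s assume "\<omega> \<in> cantor_set 3"
  then show "represented_map T_M0 s \<omega> \<in> cantor_set 2"
    by (rule cantor_set_3_cases; cases s) simp_all
next
  fix x s assume x: "x \<in> cantor_set 2"
  then have "x \<in> cantor_set 2" by simp
  then obtain b c d \<eta> where "x = b ## c ## d ## \<eta>" "b = 0 \<or> b = Suc 0" "c = 0 \<or> c = Suc 0"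
    "d = 0 \<or> d = Suc 0" "\<eta> \<in> cantor_set 2" by (rule cantor_set_2_cases3)
  then show "\<exists>a<3. \<exists>y\<in>cantor_set 2. x = fst (T_M0 s ! a) \<frown> y"
    using x unfolding ex_less_3 by (cases s; elim disjE) simp_all
next
  fix a b :: nat and x y s
  assume ab: "a < b" "b < (3::nat)" and x: "x \<in> cantor_set 2" and y: "y \<in> cantor_set 2"
  show "less_fun (fst (T_M0 s ! a) \<frown> x) (fst (T_M0 s ! b) \<frown> y)"
    using less_less_3_cases[OF ab] x y by (elim disjE conjE; hypsubst; cases s) (simp_all)
qed

interpretation oM1: ordered_transducer T_M1 3 I_M1
proof
  fix \<omega> s assume "\<omega> \<in> cantor_set 3"
  then show "represented_map T_M1 s \<omega> \<in> I_M1 s"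
    by (rule cantor_set_3_cases; cases s) (simp_all add: I_M1_def)
next
  fix x s assume x: "x \<in> I_M1 s"
  then have "x \<in> cantor_set 2" by (auto simp: I_M1_def avoid_imp_cantor_set split: if_splits)
  then obtain b c d \<eta> where "x = b ## c ## d ## \<eta>" "b = 0 \<or> b = Suc 0" "c = 0 \<or> c = Suc 0"
    "d = 0 \<or> d = Suc 0" "\<eta> \<in> cantor_set 2" by (rule cantor_set_2_cases3)
  then show "\<exists>a<3. \<exists>y\<in>I_M1 (snd (T_M1 s ! a)). x = fst (T_M1 s ! a) \<frown> y"
    using x unfolding ex_less_3 by (cases s; elim disjE) (simp_all add: I_M1_def)
next
  fix a b :: nat and x y s
  assume ab: "a < b" "b < (3::nat)" and x: "x \<in> I_M1 (snd (T_M1 s ! a))" and y: "y \<in> I_M1 (snd (T_M1 s ! b))"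
  show "less_fun (fst (T_M1 s ! a) \<frown> x) (fst (T_M1 s ! b) \<frown> y)"
    using less_less_3_cases[OF ab] x y by (elim disjE conjE; hypsubst; cases s) (simp_all add: I_M1_def)
qed

section \<open>Evaluation of group elements on cylinders\<close>

declare thompson_mult [simp del] thompson_one [simp del] x_gen.simps(3) [simp del]
declare thompson_mult_app [simp]

interpretation F: group thompson_F
  by (rule group_thompson) simp

lemma x_0_eq_gen: "x_0 = gen 1 0"
proof
  fix \<omega>
  show "x_0 \<omega> = gen 1 0 \<omega>"
  proof (cases "\<omega> \<in> cantor_set 2")
    case True
    then obtain a b c \<eta> where "\<omega> = a ## b ## c ## \<eta>" "a = 0 \<or> a = Suc 0" "b = 0 \<or> b = Suc 0"
      "c = 0 \<or> c = Suc 0" "\<eta> \<in> cantor_set 2" by (rule cantor_set_2_cases3)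
    then show ?thesis
      by (elim disjE) (simp_all add: x_0_def gen_less branch_def vine.simps flip: numeral_2_eq_2)
  qed (simp add: x_0_def gen_less branch_def flip: numeral_2_eq_2)
qed

lemma x_1_eq_gen: "x_1 = gen 1 1"
proof
  fix \<omega>
  have g: "gen 1 1 = under_last 1 x_0" using gen_add[of 1 0] by (simp add: x_0_eq_gen)
  show "x_1 \<omega> = gen 1 1 \<omega>"
  proof (cases "\<omega> \<in> cantor_set 2")
    case True
    then obtain a b c \<eta> where "\<omega> = a ## b ## c ## \<eta>" "a = 0 \<or> a = Suc 0" "b = 0 \<or> b = Suc 0"
      "c = 0 \<or> c = Suc 0" "\<eta> \<in> cantor_set 2" by (rule cantor_set_2_cases3)
    then show ?thesis
      unfolding g
      by (elim disjE) (simp_all add: x_1_def x_0_def under_last_def flip: numeral_2_eq_2)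
  qed (unfold g, simp add: x_1_def under_last_def flip: numeral_2_eq_2)
qed

text \<open>The recursion for \<open>x_gen\<close> is the conjugation formula with
  \<open>d = 1\<close>. Evaluation can then descend below the letter 1 instead of going through
  conjugates.\<close>

lemma x_gen_eq_gen: "x_gen k = gen 1 k"
proof (induction k rule: x_gen.induct)
  case (3 k)
  have "gen 1 (Suc k + 1) = inv\<^bsub>thompson_F\<^esub> gen 1 0 \<otimes>\<^bsub>thompson_F\<^esub> (gen 1 (Suc k) \<otimes>\<^bsub>thompson_F\<^esub> gen 1 0)"
    using gen_conjugate[of 1 "Suc k", unfolded Suc_1] by simp
  moreover have "gen 1 j \<in> carrier thompson_F" for j
    using gen_carrier[of 1 j, unfolded Suc_1] by simp
  ultimately show ?case
    unfolding x_gen.simps(3) 3 by (simp only: F.m_assoc F.inv_closed add_Suc_right Nat.add_0_right One_nat_def)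
qed (simp_all add: x_0_eq_gen x_1_eq_gen)

lemma x_gen_carrier [simp]: "x_gen k \<in> carrier thompson_F"
  unfolding x_gen_eq_gen using gen_carrier[of 1 k, unfolded Suc_1] by simp

lemma x_0_carrier [simp]: "x_0 \<in> carrier thompson_F"
  and x_1_carrier [simp]: "x_1 \<in> carrier thompson_F"
  using x_gen_carrier[of 0] x_gen_carrier[of 1] by simp_all

lemma x_0_build [simp]:
  assumes "\<eta> \<in> cantor_set 2"
  shows "x_0 (0 ## 0 ## \<eta>) = 0 ## \<eta>" "x_0 (0 ## Suc 0 ## \<eta>) = Suc 0 ## 0 ## \<eta>"
    "x_0 (Suc 0 ## \<eta>) = Suc 0 ## Suc 0 ## \<eta>"
  using assms by (simp_all add: x_0_def)

lemma x_gen_Suc_build: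
  assumes "\<eta> \<in> cantor_set 2"
  shows "x_gen (Suc k) (0 ## \<eta>) = 0 ## \<eta>" "x_gen (Suc k) (Suc 0 ## \<eta>) = Suc 0 ## x_gen k \<eta>"
proof -
  have g: "x_gen (Suc k) = under_last (Suc 0) (x_gen k)"
    using gen_add[of 1 k] by (simp add: x_gen_eq_gen)
  have \<eta>: "\<eta> \<in> cantor_set (Suc (Suc 0))" using assms by (simp add: numeral_2_eq_2)
  show "x_gen (Suc k) (0 ## \<eta>) = 0 ## \<eta>"
    unfolding g by (rule under_last_build(2)[OF \<eta>]) simp
  show "x_gen (Suc k) (Suc 0 ## \<eta>) = Suc 0 ## x_gen k \<eta>"
    unfolding g by (rule under_last_build(1)[OF \<eta>])
qed

lemma inv_x_gen_Suc_build:
  assumes "\<eta> \<in> cantor_set 2"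
  shows "(inv\<^bsub>thompson_F\<^esub> x_gen (Suc k)) (0 ## \<eta>) = 0 ## \<eta>"
    "(inv\<^bsub>thompson_F\<^esub> x_gen (Suc k)) (Suc 0 ## \<eta>) = Suc 0 ## (inv\<^bsub>thompson_F\<^esub> x_gen k) \<eta>"
proof -
  show "(inv\<^bsub>thompson_F\<^esub> x_gen (Suc k)) (0 ## \<eta>) = 0 ## \<eta>"
    using assms x_gen_Suc_build[OF assms] by (intro thompson_inv_app) simp_all
  define \<zeta> where "\<zeta> = (inv\<^bsub>thompson_F\<^esub> x_gen k) \<eta>"
  have \<zeta>: "\<zeta> \<in> cantor_set 2" unfolding \<zeta>_def
    using thompson_app_closed[OF F.inv_closed[OF x_gen_carrier] assms] .
  have "(inv\<^bsub>thompson_F\<^esub> x_gen k \<otimes>\<^bsub>thompson_F\<^esub> x_gen k) \<eta> = \<one>\<^bsub>thompson_F\<^esub> \<eta>"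
    by (simp only: F.l_inv x_gen_carrier)
  then have "x_gen k \<zeta> = \<eta>" unfolding \<zeta>_def thompson_mult_app[OF assms] using assms by (simp add: thompson_one)
  then show "(inv\<^bsub>thompson_F\<^esub> x_gen (Suc k)) (Suc 0 ## \<eta>) = Suc 0 ## (inv\<^bsub>thompson_F\<^esub> x_gen k) \<eta>"
    using \<zeta> x_gen_Suc_build[OF \<zeta>, of k] unfolding \<zeta>_def[symmetric] by (intro thompson_inv_app) simp_all
qed

lemma inv_x_0_build [simp]:
  assumes "\<eta> \<in> cantor_set 2"
  shows "(inv\<^bsub>thompson_F\<^esub> x_0) (0 ## \<eta>) = 0 ## 0 ## \<eta>"
    "(inv\<^bsub>thompson_F\<^esub> x_0) (Suc 0 ## 0 ## \<eta>) = 0 ## Suc 0 ## \<eta>"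
    "(inv\<^bsub>thompson_F\<^esub> x_0) (Suc 0 ## Suc 0 ## \<eta>) = Suc 0 ## \<eta>"
  using assms by (auto intro!: thompson_inv_app)

lemmas x_build [simp] =
  x_gen_Suc_build[of _ 0, unfolded x_gen.simps(1,2)]
  x_gen_Suc_build[of _ 1, folded numeral_2_eq_2, unfolded One_nat_def x_gen.simps(2), folded numeral_2_eq_2]
  x_gen_Suc_build[of _ 2, folded numeral_3_eq_3, simplified Suc_numeral, simplified]
  inv_x_gen_Suc_build[of _ 0, unfolded x_gen.simps(1,2)]
  inv_x_gen_Suc_build[of _ 1, folded numeral_2_eq_2, unfolded One_nat_def x_gen.simps(2), folded numeral_2_eq_2]
  inv_x_gen_Suc_build[of _ 2, simplified Suc_numeral, simplified]

lemma x_closed [simp]: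
  assumes "\<eta> \<in> cantor_set 2"
  shows "x_gen k \<eta> \<in> cantor_set 2" "(inv\<^bsub>thompson_F\<^esub> x_gen k) \<eta> \<in> cantor_set 2"
    "x_0 \<eta> \<in> cantor_set 2" "(inv\<^bsub>thompson_F\<^esub> x_0) \<eta> \<in> cantor_set 2"
    "x_1 \<eta> \<in> cantor_set 2" "(inv\<^bsub>thompson_F\<^esub> x_1) \<eta> \<in> cantor_set 2"
  using thompson_app_closed[OF x_gen_carrier assms]
    thompson_app_closed[OF F.inv_closed[OF x_gen_carrier] assms]
  by (simp_all flip: x_gen.simps(1,2))

lemma gen_2_build [simp]:
  assumes "\<eta> \<in> cantor_set 3"
  shows "gen 2 0 (0 ## 0 ## \<eta>) = 0 ## \<eta>" "gen 2 0 (0 ## Suc 0 ## \<eta>) = Suc 0 ## \<eta>"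
    "gen 2 0 (0 ## 2 ## \<eta>) = 2 ## 0 ## \<eta>" "gen 2 0 (Suc 0 ## \<eta>) = 2 ## Suc 0 ## \<eta>"
    "gen 2 0 (2 ## \<eta>) = 2 ## 2 ## \<eta>"
    "gen 2 (Suc 0) (0 ## \<eta>) = 0 ## \<eta>" "gen 2 (Suc 0) (Suc 0 ## 0 ## \<eta>) = Suc 0 ## \<eta>"
    "gen 2 (Suc 0) (Suc 0 ## Suc 0 ## \<eta>) = 2 ## 0 ## \<eta>"
    "gen 2 (Suc 0) (Suc 0 ## 2 ## \<eta>) = 2 ## Suc 0 ## \<eta>"
    "gen 2 (Suc 0) (2 ## \<eta>) = 2 ## 2 ## \<eta>"
    "gen 2 2 (0 ## \<eta>) = 0 ## \<eta>" "gen 2 2 (Suc 0 ## \<eta>) = Suc 0 ## \<eta>"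
    "gen 2 2 (2 ## \<eta>) = 2 ## gen 2 0 \<eta>"
proof -
  have "vine 2 2 = [2, 0]" "vine 2 3 = [2, Suc 0]" by (simp_all add: vine_diff)
  moreover from this have "vine 2 (Suc (Suc 0)) = [2, 0]" "vine 2 (Suc (Suc (Suc 0))) = [2, Suc 0]"
    by (simp_all add: numeral_2_eq_2 numeral_3_eq_3)
  moreover have "gen 2 0 = branch 2 0" "gen 2 (Suc 0) = branch 2 (Suc 0)" "gen 2 2 = under_last 2 (gen 2 0)"
    by (simp_all add: gen_less gen_rec)
  ultimately show "gen 2 0 (0 ## 0 ## \<eta>) = 0 ## \<eta>" "gen 2 0 (0 ## Suc 0 ## \<eta>) = Suc 0 ## \<eta>"
    "gen 2 0 (0 ## 2 ## \<eta>) = 2 ## 0 ## \<eta>" "gen 2 0 (Suc 0 ## \<eta>) = 2 ## Suc 0 ## \<eta>"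
    "gen 2 0 (2 ## \<eta>) = 2 ## 2 ## \<eta>"
    "gen 2 (Suc 0) (0 ## \<eta>) = 0 ## \<eta>" "gen 2 (Suc 0) (Suc 0 ## 0 ## \<eta>) = Suc 0 ## \<eta>"
    "gen 2 (Suc 0) (Suc 0 ## Suc 0 ## \<eta>) = 2 ## 0 ## \<eta>"
    "gen 2 (Suc 0) (Suc 0 ## 2 ## \<eta>) = 2 ## Suc 0 ## \<eta>"
    "gen 2 (Suc 0) (2 ## \<eta>) = 2 ## 2 ## \<eta>"
    "gen 2 2 (0 ## \<eta>) = 0 ## \<eta>" "gen 2 2 (Suc 0 ## \<eta>) = Suc 0 ## \<eta>"
    "gen 2 2 (2 ## \<eta>) = 2 ## gen 2 0 \<eta>"
    using assms by (simp_all add: branch_def under_last_def)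
qed

lemma gen_2_carrier: "gen 2 k \<in> carrier (thompson 3)"
  using gen_carrier[of 2 k] by simp

lemma gen_2_closed [simp]: "\<eta> \<in> cantor_set 3 \<Longrightarrow> gen 2 k \<eta> \<in> cantor_set 3"
  using thompson_app_closed gen_2_carrier by blast

lemma thompson_3_generated:
  "carrier (thompson 3) = generate (thompson 3) {gen 2 0, gen 2 1, gen 2 2}"
proof -
  have "gen 2 ` {..2} = {gen 2 0, gen 2 1, gen 2 2}" by (auto simp: numeral_2_eq_2 atMost_Suc)
  then show ?thesis using thompson_generated[of 2] by simp
qed

lemma thompson_2_generated: "carrier thompson_F = generate thompson_F {x_0, x_1}"
proof -
  have "gen 1 ` {..1} = {x_0, x_1}" by (auto simp: x_0_eq_gen x_1_eq_gen atMost_Suc)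
  then show ?thesis using thompson_generated[of 1, unfolded Suc_1] by simp
qed

lemma (in conjugation) conjugated_thompson_generate:
  assumes "carrier (thompson n) = generate (thompson n) G" "transport ` G \<subseteq> carrier thompson_F"
  shows "conjugated_thompson n \<psi> = generate thompson_F (transport ` G)"
proof -
  have "G \<subseteq> carrier (thompson n)"
    unfolding assms(1) by (rule subsetI) (rule generate.incl)
  from transport_generate[OF this assms(2)] show ?thesis
    unfolding conjugated_thompson_eq assms(1) .
qed

lemma (in group) int_pow_2: "x \<in> carrier G \<Longrightarrow> x [^] (2::int) = x \<otimes> x"
  by (simp add: int_pow_def2 numeral_2_eq_2)

lemma (in group) int_pow_minus_3: "x \<in> carrier G \<Longrightarrow> x [^] (- 3::int) = inv x \<otimes> inv x \<otimes> inv x"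
  by (simp add: int_pow_def2 numeral_3_eq_3 inv_mult_group m_assoc)

section \<open>The subgroups as conjugates\<close>

interpretation cK1: conjugation 3 psi_K1
  unfolding psi_K1_def
  by unfold_locales (use oK1.rep_mono oK1.rep_image in \<open>simp_all add: I_K1_def\<close>)

interpretation cK3: conjugation 2 psi_K3
  unfolding psi_K3_def
  by unfold_locales (use oK3.rep_mono oK3.rep_image in \<open>simp_all add: I_K3_def\<close>)

interpretation c0: conjugation 3 psi_0
  unfolding psi_0_def
  by unfold_locales (use oM0.rep_mono oM0.rep_image in simp_all)

interpretation c1: conjugation 3 psi_1
  unfolding psi_1_def
  by unfold_locales (use oM1.rep_mono oM1.rep_image in \<open>simp_all add: I_M1_def\<close>)

text \<open>Input letters are split off until both sides have written the same word and continue
  with the same state on the same tail; branches already decided are closed at once. The values are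
  the three given generators of \<open>K_1\<close>.\<close>

lemma transport_K1:
  "cK1.transport (gen 2 0) = x_0"
  "cK1.transport (gen 2 1) = x_1 \<otimes>\<^bsub>thompson_F\<^esub> x_1 \<otimes>\<^bsub>thompson_F\<^esub> inv\<^bsub>thompson_F\<^esub> x_gen 2"
  "cK1.transport (gen 2 2) = x_1 \<otimes>\<^bsub>thompson_F\<^esub> x_gen 2 \<otimes>\<^bsub>thompson_F\<^esub> inv\<^bsub>thompson_F\<^esub> x_1"
  unfolding psi_K1_def One_nat_def
  by (rule cK1.transport_eqI[unfolded psi_K1_def], simp,
    (erule cantor_set_3_cases; hypsubst; (simp; fail)?)+)+

text \<open>The first value is the extra generator of \<open>M_0\<close>; the second is 3-colorable,
  and the third is a 3-colorable element times the first. For \<open>M_1\<close> the roles of the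
  first two are exchanged.\<close>

lemma transport_M0:
  "c0.transport (gen 2 0) = x_0 \<otimes>\<^bsub>thompson_F\<^esub> x_0"
  "c0.transport (gen 2 1) = x_0 \<otimes>\<^bsub>thompson_F\<^esub> x_1 \<otimes>\<^bsub>thompson_F\<^esub> x_1 \<otimes>\<^bsub>thompson_F\<^esub> inv\<^bsub>thompson_F\<^esub> x_0"
  "c0.transport (gen 2 2) = x_1 \<otimes>\<^bsub>thompson_F\<^esub> x_gen 2"
  unfolding psi_0_def One_nat_def
  by (rule c0.transport_eqI[unfolded psi_0_def], simp,
    (erule cantor_set_3_cases; hypsubst; (simp; fail)?)+)+

lemma transport_M1:
  "c1.transport (gen 2 0) = x_0 \<otimes>\<^bsub>thompson_F\<^esub> x_0 \<otimes>\<^bsub>thompson_F\<^esub> x_1 \<otimes>\<^bsub>thompson_F\<^esub> inv\<^bsub>thompson_F\<^esub> x_gen 2"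
  "c1.transport (gen 2 1) = x_1 \<otimes>\<^bsub>thompson_F\<^esub> x_1"
  "c1.transport (gen 2 2) = x_gen 2 \<otimes>\<^bsub>thompson_F\<^esub> x_gen 3"
  unfolding psi_1_def One_nat_def
  by (rule c1.transport_eqI[unfolded psi_1_def], simp,
    (erule cantor_set_3_cases; hypsubst; (simp; fail)?)+)+

abbreviation K3_gen_2 :: "nat word \<Rightarrow> nat word" where
  "K3_gen_2 \<equiv> x_1 \<otimes>\<^bsub>thompson_F\<^esub> x_gen 2 \<otimes>\<^bsub>thompson_F\<^esub>
     (inv\<^bsub>thompson_F\<^esub> x_1 \<otimes>\<^bsub>thompson_F\<^esub> inv\<^bsub>thompson_F\<^esub> x_1 \<otimes>\<^bsub>thompson_F\<^esub> inv\<^bsub>thompson_F\<^esub> x_1)"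

abbreviation K3_gen_3 :: "nat word \<Rightarrow> nat word" where
  "K3_gen_3 \<equiv> x_1 \<otimes>\<^bsub>thompson_F\<^esub> x_gen 2 \<otimes>\<^bsub>thompson_F\<^esub> x_gen 3 \<otimes>\<^bsub>thompson_F\<^esub>
     (inv\<^bsub>thompson_F\<^esub> x_gen 2 \<otimes>\<^bsub>thompson_F\<^esub> inv\<^bsub>thompson_F\<^esub> x_gen 2 \<otimes>\<^bsub>thompson_F\<^esub> inv\<^bsub>thompson_F\<^esub> x_gen 2)
     \<otimes>\<^bsub>thompson_F\<^esub> inv\<^bsub>thompson_F\<^esub> x_1"

lemma transport_K3_0: "cK3.transport x_0 = x_0"
  unfolding psi_K3_def
  by (rule cK3.transport_eqI[unfolded psi_K3_def], simp,
    (erule cantor_set_2_cases; hypsubst; (simp; fail)?)+)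

text \<open>The conjugate of \<open>x_1\<close> is the inverse of \<open>K3_gen_2\<close>. Starting
  from \<open>x_1 \<xi>\<close> avoids evaluating the inverse of this product.\<close>

lemma K3_gen_2_psi_K3: "\<xi> \<in> cantor_set 2 \<Longrightarrow> K3_gen_2 (psi_K3 (x_1 \<xi>)) = psi_K3 \<xi>"
  unfolding psi_K3_def
  by (erule cantor_set_2_cases; hypsubst; (simp; fail)?)+

text \<open>Let y_1 be the inverse of \<open>K3_gen_2\<close> and y_2 = x_0^-1 y_1 x_0, the images
  of x_1 and x_2. The relation says \<open>K3_gen_3\<close> = y_1 y_2^-1 y_1^-1, written without
  inverses of products so that it can be evaluated.\<close>

lemma K3_gen_3_relation:
  "x_0 \<otimes>\<^bsub>thompson_F\<^esub> (K3_gen_2 \<otimes>\<^bsub>thompson_F\<^esub> K3_gen_3) = K3_gen_2 \<otimes>\<^bsub>thompson_F\<^esub> (x_0 \<otimes>\<^bsub>thompson_F\<^esub> K3_gen_2)"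
  by (rule thompson_eqI[of _ 2], simp, simp,
    (erule cantor_set_2_cases; hypsubst; (simp; fail)?)+)

lemma K1_eq_conjugated: "K1 = conjugated_thompson 3 psi_K1"
proof -
  have "conjugated_thompson 3 psi_K1 = generate thompson_F (cK1.transport ` {gen 2 0, gen 2 1, gen 2 2})"
    by (rule cK1.conjugated_thompson_generate[OF thompson_3_generated])
      (simp add: transport_K1[unfolded One_nat_def])
  then show ?thesis
    by (simp add: transport_K1[unfolded One_nat_def] K1_def F.int_pow_2 insert_commute)
qed

lemma transport_K3_1: "cK3.transport x_1 = inv\<^bsub>thompson_F\<^esub> K3_gen_2"
proof (rule cK3.transport_eqI)
  fix \<xi> assume \<xi>: "\<xi> \<in> cantor_set 2"
  show "(inv\<^bsub>thompson_F\<^esub> K3_gen_2) (psi_K3 \<xi>) = psi_K3 (x_1 \<xi>)"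
    using \<xi> by (intro thompson_inv_app K3_gen_2_psi_K3 cK3.\<psi>_closed) simp_all
qed simp

lemma K3_eq_conjugated: "K3 = conjugated_thompson 2 psi_K3"
proof -
  let ?G = "{x_0, inv\<^bsub>thompson_F\<^esub> K3_gen_2}" and ?H = "{x_0, K3_gen_2, K3_gen_3}"
  have carr: "K3_gen_2 \<in> carrier thompson_F" "K3_gen_3 \<in> carrier thompson_F" by simp_all
  have "conjugated_thompson 2 psi_K3 = generate thompson_F (cK3.transport ` {x_0, x_1})"
    by (rule cK3.conjugated_thompson_generate[OF thompson_2_generated])
      (simp add: transport_K3_0 transport_K3_1)
  then have 1: "conjugated_thompson 2 psi_K3 = generate thompson_F ?G"
    by (simp only: image_insert image_empty transport_K3_0 transport_K3_1)
  have 2: "K3 = generate thompson_F ?H"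
    by (simp add: K3_def F.int_pow_minus_3)
  have G: "?G \<subseteq> carrier thompson_F" and H: "?H \<subseteq> carrier thompson_F"
    using carr x_0_carrier by blast+
  have x0: "x_0 \<in> generate thompson_F ?G" and k2i: "inv\<^bsub>thompson_F\<^esub> K3_gen_2 \<in> generate thompson_F ?G"
    by (intro generate.incl; simp)+
  have K3_gen_2: "K3_gen_2 \<in> generate thompson_F ?G"
    using F.generate_m_inv_closed[OF G k2i] F.inv_inv[OF carr(1)] by metis
  have "K3_gen_3 = inv\<^bsub>thompson_F\<^esub> K3_gen_2 \<otimes>\<^bsub>thompson_F\<^esub>
      (inv\<^bsub>thompson_F\<^esub> x_0 \<otimes>\<^bsub>thompson_F\<^esub> (K3_gen_2 \<otimes>\<^bsub>thompson_F\<^esub> (x_0 \<otimes>\<^bsub>thompson_F\<^esub> K3_gen_2)))"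
  proof -
    have "K3_gen_2 \<otimes>\<^bsub>thompson_F\<^esub> K3_gen_3 = inv\<^bsub>thompson_F\<^esub> x_0 \<otimes>\<^bsub>thompson_F\<^esub> (K3_gen_2 \<otimes>\<^bsub>thompson_F\<^esub> (x_0 \<otimes>\<^bsub>thompson_F\<^esub> K3_gen_2))"
      using K3_gen_3_relation carr x_0_carrier F.m_closed by (metis F.inv_solve_left)
    then show ?thesis using carr x_0_carrier F.m_closed F.inv_closed by (metis F.inv_solve_left)
  qed
  then have "K3_gen_3 \<in> generate thompson_F ?G"
    using generate.eng[OF k2i generate.eng[OF F.generate_m_inv_closed[OF G x0]
      generate.eng[OF K3_gen_2 generate.eng[OF x0 K3_gen_2]]]] by metis
  then have "generate thompson_F ?H \<subseteq> generate thompson_F ?G"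
    using x0 K3_gen_2 by (intro F.generate_subgroup_incl F.generate_is_subgroup[OF G]) blast
  moreover have "generate thompson_F ?G \<subseteq> generate thompson_F ?H"
  proof (intro F.generate_subgroup_incl F.generate_is_subgroup[OF H])
    have "x_0 \<in> generate thompson_F ?H" "K3_gen_2 \<in> generate thompson_F ?H"
      by (intro generate.incl; simp)+
    then show "?G \<subseteq> generate thompson_F ?H"
      using F.generate_m_inv_closed[OF H] by blast
  qed
  ultimately show ?thesis unfolding 1 2 by blast
qed

section \<open>The 3-colorable subgroup\<close>

lemma jones_subgroupI:
  fixes cs :: "nat list"
  assumes "f \<in> carrier thompson_F"
    and "list_all2 (\<lambda>u v. \<forall>\<omega> \<in> cantor_set 2. f (u \<frown> \<omega>) = v \<frown> \<omega>) (leaves S) (leaves T)"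
    and "length cs = Suc (length (leaves S))" "set cs \<subseteq> {0, 1, 2}"
    and "\<forall>(p, q) \<in> edge_sides 0 S \<union> edge_sides 0 T. cs ! p \<noteq> cs ! q"
  shows "f \<in> jones_subgroup"
proof -
  have tree: "tree_diagram f S T"
    using assms(2) unfolding tree_diagram_def replaces_prefixes_def list_all2_conv_all_nth by blast
  have "(!) cs ` {0..length (leaves S)} \<subseteq> {0, 1, 2}"
  proof
    fix x assume "x \<in> (!) cs ` {0..length (leaves S)}"
    then obtain i where "i \<le> length (leaves S)" "x = cs ! i" by auto
    then have "i < length cs" "x = cs ! i" using assms(3) by simp_all
    then have "x \<in> set cs" by simp
    then show "x \<in> {0, 1, 2}" using assms(4) by (rule subsetD[rotated])
  qed
  then have "three_colorable S T"
    unfolding three_colorable_def using assms(5) by (intro exI[of _ "(!) cs"] conjI)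
  then show ?thesis
    using assms(1) tree unfolding jones_subgroup_def by blast
qed

text \<open>Each colour list is forced by colouring the region left of the roots 0 and the one right
  of them 1: going down the trees, the region between two sibling edges gets the colour missing
  above them.\<close>

lemma jones_elements:
  "x_0 \<otimes>\<^bsub>thompson_F\<^esub> x_1 \<otimes>\<^bsub>thompson_F\<^esub> x_1 \<otimes>\<^bsub>thompson_F\<^esub> inv\<^bsub>thompson_F\<^esub> x_0 \<in> jones_subgroup"
  "x_1 \<otimes>\<^bsub>thompson_F\<^esub> x_gen 2 \<otimes>\<^bsub>thompson_F\<^esub> inv\<^bsub>thompson_F\<^esub> (x_0 \<otimes>\<^bsub>thompson_F\<^esub> x_0) \<in> jones_subgroup"
  "x_0 \<otimes>\<^bsub>thompson_F\<^esub> x_0 \<otimes>\<^bsub>thompson_F\<^esub> x_1 \<otimes>\<^bsub>thompson_F\<^esub> inv\<^bsub>thompson_F\<^esub> x_gen 2 \<in> jones_subgroup"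
  "x_gen 2 \<otimes>\<^bsub>thompson_F\<^esub> x_gen 3 \<otimes>\<^bsub>thompson_F\<^esub> inv\<^bsub>thompson_F\<^esub> (x_1 \<otimes>\<^bsub>thompson_F\<^esub> x_1) \<in> jones_subgroup"
proof -
  show "x_0 \<otimes>\<^bsub>thompson_F\<^esub> x_1 \<otimes>\<^bsub>thompson_F\<^esub> x_1 \<otimes>\<^bsub>thompson_F\<^esub> inv\<^bsub>thompson_F\<^esub> x_0 \<in> jones_subgroup"
    by (rule jones_subgroupI[of _ "Caret (Caret Leaf (Caret (Caret Leaf Leaf) Leaf)) Leaf"
          "Caret (Caret Leaf Leaf) (Caret Leaf (Caret Leaf Leaf))" "[0, 1, 2, 0, 2, 1]"]) simp_all
  show "x_1 \<otimes>\<^bsub>thompson_F\<^esub> x_gen 2 \<otimes>\<^bsub>thompson_F\<^esub> inv\<^bsub>thompson_F\<^esub> (x_0 \<otimes>\<^bsub>thompson_F\<^esub> x_0) \<in> jones_subgroup"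
    by (rule jones_subgroupI[of _ "Caret Leaf (Caret (Caret Leaf (Caret Leaf Leaf)) Leaf)"
          "Caret (Caret (Caret Leaf Leaf) Leaf) (Caret Leaf Leaf)" "[0, 2, 1, 2, 0, 1]"])
      (simp_all add: F.inv_mult_group)
  show "x_0 \<otimes>\<^bsub>thompson_F\<^esub> x_0 \<otimes>\<^bsub>thompson_F\<^esub> x_1 \<otimes>\<^bsub>thompson_F\<^esub> inv\<^bsub>thompson_F\<^esub> x_gen 2 \<in> jones_subgroup"
    by (rule jones_subgroupI[of _ "Caret (Caret (Caret Leaf (Caret Leaf Leaf)) Leaf) Leaf"
          "Caret Leaf (Caret Leaf (Caret (Caret Leaf Leaf) Leaf))" "[0, 2, 0, 1, 2, 1]"]) simp_all
  show "x_gen 2 \<otimes>\<^bsub>thompson_F\<^esub> x_gen 3 \<otimes>\<^bsub>thompson_F\<^esub> inv\<^bsub>thompson_F\<^esub> (x_1 \<otimes>\<^bsub>thompson_F\<^esub> x_1) \<in> jones_subgroup"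
    by (rule jones_subgroupI[of _ "Caret Leaf (Caret Leaf (Caret (Caret Leaf (Caret Leaf Leaf)) Leaf))"
          "Caret Leaf (Caret (Caret (Caret Leaf Leaf) Leaf) (Caret Leaf Leaf))" "[0, 2, 0, 1, 0, 2, 1]"])
      (simp_all add: F.inv_mult_group)
qed

text \<open>If an edge has colours \<open>a\<close> and \<open>b\<close> on its two sides, then the region between the two
  edges below it has the third colour \<open>3 - a - b\<close>. So the colours beside the leaf \<open>w\<close> only
  depend on \<open>w\<close> and on the colours beside the root.\<close>

fun sides :: "nat \<Rightarrow> nat \<Rightarrow> nat list \<Rightarrow> nat \<times> nat" where
  "sides a b [] = (a, b)"
| "sides a b (x # w) = (if x = 0 then sides a (3 - a - b) w else sides (3 - a - b) b w)"

section \<open>Region colours along a tree address\<close>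

lemma sides_snoc:
  "sides a b (w @ [x]) = (let (p, q) = sides a b w in if x = 0 then (p, 3 - p - q) else (3 - p - q, q))"
  by (induction w arbitrary: a b) auto

lemma sides_distinct:
  "sides 0 1 w \<in> {(0, 1), (0, 2), (1, 0), (1, 2), (2, 0), (2, 1)}"
proof (induction w rule: rev_induct)
  case (snoc x w)
  then show ?case unfolding sides_snoc by (elim insertE emptyE; cases "x = 0"; simp)
qed simp

lemma sides_zeros: "sides 0 1 (replicate k 0) = (if even k then (0, 1) else (0, 2))"
proof (induction k)
  case (Suc k)
  have "replicate (Suc k) (0::nat) = replicate k 0 @ [0]" by (simp add: replicate_append_same)
  then show ?case unfolding \<open>replicate (Suc k) _ = _\<close> sides_snoc Suc by simp
qed simp

text \<open>Taking the third colour commutes with every permutation of the colours;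
  \<open>\<pi>\<close> is the permutation carrying the root colours 0, 1 to \<open>a\<close>,
  \<open>b\<close>.\<close>

lemma sides_recolour:
  assumes "a \<in> {0, 1, 2}" "b \<in> {0, 1, 2}" "a \<noteq> b"
  defines "\<pi> \<equiv> \<lambda>x. if x = 0 then a else if x = 1 then b else 3 - a - b"
  shows "sides a b w = map_prod \<pi> \<pi> (sides 0 1 w)"
proof (induction w rule: rev_induct)
  case Nil
  show ?case by (simp add: \<pi>_def)
next
  case (snoc x w)
  have "3 - \<pi> p - \<pi> q = \<pi> (3 - p - q)" if "sides 0 1 w = (p, q)" for p q
    using sides_distinct[of w] assms(1-3) unfolding that \<pi>_def by auto
  then show ?case unfolding sides_snoc snoc by (auto simp: Let_def split: prod.splits)
qed

lemma sides_eq_iff: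
  assumes "a \<in> {0, 1, 2}" "b \<in> {0, 1, 2}" "a \<noteq> b"
  shows "sides a b u = sides a b v \<longleftrightarrow> sides 0 1 u = sides 0 1 v"
proof -
  let ?\<pi> = "\<lambda>x. if x = 0 then a else if x = 1 then b else 3 - a - b"
  have inj: "?\<pi> x = ?\<pi> y \<longleftrightarrow> x = y" if "x \<in> {0, 1, 2}" "y \<in> {0, 1, 2}" for x y
    using assms that by (elim insertE emptyE) simp_all
  obtain p q p' q' where pq: "sides 0 1 u = (p, q)" "sides 0 1 v = (p', q')" by (metis surj_pair)
  then have "p \<in> {0, 1, 2}" "q \<in> {0, 1, 2}" "p' \<in> {0, 1, 2}" "q' \<in> {0, 1, 2}"
    using sides_distinct[of u] sides_distinct[of v] by auto
  then show ?thesis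
    unfolding sides_recolour[OF assms] pq map_prod_simp prod.inject by (simp only: inj)
qed

lemma root_edge: "(i, i + length (leaves T)) \<in> edge_sides i T"
  by (cases T) auto

text \<open>In a proper colouring the three regions around a caret have three different colours, so
  the middle one is forced by the outer two.\<close>

lemma sides_of_coloring:
  assumes "c ` {i..i + length (leaves T)} \<subseteq> {0, 1, 2}" "\<forall>(p, q) \<in> edge_sides i T. c p \<noteq> c q"
    and "j < length (leaves T)"
  shows "sides (c i) (c (i + length (leaves T))) (leaves T ! j) = (c (i + j), c (i + j + 1))"
  using assms
proof (induction T arbitrary: i j)
  case (Caret l r)
  let ?m = "i + length (leaves l)" and ?k = "i + length (leaves (Caret l r))"
  have k: "?m + length (leaves r) = ?k" by simp
  have neq: "c i \<noteq> c ?k" "c i \<noteq> c ?m" "c ?m \<noteq> c ?k"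
    using Caret.prems(2) root_edge[of i l] root_edge[of ?m r] unfolding k by fastforce+
  have "c i \<in> {0, 1, 2}" "c ?m \<in> {0, 1, 2}" "c ?k \<in> {0, 1, 2}"
    using Caret.prems(1) by (auto simp: image_subset_iff)
  then have third: "3 - c i - c ?k = c ?m" using neq by auto
  have sub: "c ` {i..?m} \<subseteq> {0, 1, 2}" "c ` {?m..?m + length (leaves r)} \<subseteq> {0, 1, 2}"
    using Caret.prems(1) by (auto simp: image_subset_iff)
  have edges: "\<forall>(p, q) \<in> edge_sides i l. c p \<noteq> c q" "\<forall>(p, q) \<in> edge_sides ?m r. c p \<noteq> c q"
    using Caret.prems(2) by auto
  show ?case
  proof (cases "j < length (leaves l)")
    case True
    then have "leaves (Caret l r) ! j = 0 # leaves l ! j" by (simp add: nth_append)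
    then show ?thesis using Caret.IH(1)[OF sub(1) edges(1) True] third by simp
  next
    case False
    define j' where "j' = j - length (leaves l)"
    have j': "j' < length (leaves r)" "j = length (leaves l) + j'"
      using False Caret.prems(3) unfolding j'_def by auto
    then have "leaves (Caret l r) ! j = 1 # leaves r ! j'" by (simp add: nth_append)
    then show ?thesis using Caret.IH(2)[OF sub(2) edges(2) j'(1)] third j' k by (simp add: add.assoc)
  qed
qed simp

lemma leaves_cover:
  assumes "\<omega> \<in> cantor_set 2"
  shows "\<exists>j < length (leaves T). \<exists>\<eta> \<in> cantor_set 2. \<omega> = leaves T ! j \<frown> \<eta>"
  using assms
proof (induction T arbitrary: \<omega>)
  case (Caret l r)
  from Caret.prems show ?case
  proof (rule cantor_set_2_cases)
    fix \<eta> assume \<eta>: "\<omega> = 0 ## \<eta>" "\<eta> \<in> cantor_set 2"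
    obtain j \<zeta> where j: "j < length (leaves l)" "\<zeta> \<in> cantor_set 2" "\<eta> = leaves l ! j \<frown> \<zeta>"
      using Caret.IH(1)[OF \<eta>(2)] by blast
    then have "leaves (Caret l r) ! j = 0 # leaves l ! j" by (simp add: nth_append)
    then show ?thesis
      using \<eta> j by (intro exI[of _ j] conjI bexI[of _ \<zeta>]) simp_all
  next
    fix \<eta> assume \<eta>: "\<omega> = Suc 0 ## \<eta>" "\<eta> \<in> cantor_set 2"
    obtain j \<zeta> where j: "j < length (leaves r)" "\<zeta> \<in> cantor_set 2" "\<eta> = leaves r ! j \<frown> \<zeta>"
      using Caret.IH(2)[OF \<eta>(2)] by blast
    then have "leaves (Caret l r) ! (length (leaves l) + j) = 1 # leaves r ! j" by (simp add: nth_append)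
    then show ?thesis
      using \<eta> j by (intro exI[of _ "length (leaves l) + j"] conjI bexI[of _ \<zeta>]) simp_all
  qed
qed auto

lemma leaves_letters: "w \<in> set (leaves T) \<Longrightarrow> set w \<subseteq> {..<2}"
  by (induction T arbitrary: w) force+

text \<open>The leaves numbered \<open>j\<close> of both trees lie between the regions
  \<open>j\<close> and \<open>j + 1\<close>, so one colouring of both trees gives them the same
  sides; recolouring normalises the root colours to 0 and 1.\<close>

lemma jones_subgroup_local:
  assumes "f \<in> jones_subgroup" "\<omega> \<in> cantor_set 2"
  obtains u v \<eta> where "\<omega> = u \<frown> \<eta>" "\<eta> \<in> cantor_set 2" "set u \<subseteq> {..<2}" "set v \<subseteq> {..<2}"
    "\<And>\<zeta>. \<zeta> \<in> cantor_set 2 \<Longrightarrow> f (u \<frown> \<zeta>) = v \<frown> \<zeta>" "sides 0 1 u = sides 0 1 v"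
proof -
  obtain S T where ST: "tree_diagram f S T" "three_colorable S T"
    using assms(1) unfolding jones_subgroup_def by blast
  then obtain c :: "nat \<Rightarrow> nat" where c: "c ` {0..length (leaves S)} \<subseteq> {0, 1, 2}"
    "\<forall>(p, q) \<in> edge_sides 0 S \<union> edge_sides 0 T. c p \<noteq> c q"
    unfolding three_colorable_def by blast
  have len: "length (leaves T) = length (leaves S)"
    and rep: "\<And>i \<omega>. i < length (leaves S) \<Longrightarrow> \<omega> \<in> cantor_set 2 \<Longrightarrow>
      f (leaves S ! i \<frown> \<omega>) = leaves T ! i \<frown> \<omega>"
    using ST(1) unfolding tree_diagram_def replaces_prefixes_def by auto
  obtain j \<eta> where j: "j < length (leaves S)" "\<eta> \<in> cantor_set 2" "\<omega> = leaves S ! j \<frown> \<eta>"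
    using leaves_cover[OF assms(2)] by blast
  let ?k = "length (leaves S)"
  have "sides (c 0) (c ?k) (leaves S ! j) = (c j, c (j + 1))"
    using sides_of_coloring[of c 0 S j] c j(1) by auto
  moreover have "sides (c 0) (c ?k) (leaves T ! j) = (c j, c (j + 1))"
    using sides_of_coloring[of c 0 T j] c j(1) len by auto
  moreover have "c 0 \<in> {0, 1, 2}" "c ?k \<in> {0, 1, 2}" "c 0 \<noteq> c ?k"
    using c root_edge[of 0 S] by fastforce+
  ultimately have "sides 0 1 (leaves S ! j) = sides 0 1 (leaves T ! j)"
    using sides_eq_iff by metis
  then show thesis
    using that[of "leaves S ! j" \<eta> "leaves T ! j"] j rep[OF j(1)] leaves_letters len
    by (metis nth_mem)
qed

lemma thompson_fixes_zero:
  assumes "f \<in> carrier (thompson n)" "0 < n"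
  shows "f (\<lambda>_. 0) = (\<lambda>_. 0)"
proof (rule ccontr)
  assume ne: "f (\<lambda>_. 0) \<noteq> (\<lambda>_. 0)"
  note f = assms(1)[unfolded thompson_carrier_iff[OF assms(2)]]
  have least: "\<not> less_fun x (\<lambda>_. 0)" for x :: "nat word" by (simp add: less_fun_def)
  have "(\<lambda>_. 0) \<in> f ` cantor_set n" using f assms(2) by simp
  then obtain x where x: "x \<in> cantor_set n" "f x = (\<lambda>_. 0)" by (metis imageE)
  then have "less_fun (\<lambda>_. 0) x" using ne less_fun_linear[of x "\<lambda>_. 0"] least by metis
  then have "less_fun (f (\<lambda>_. 0)) (f x)"
    using f x(1) assms(2) unfolding lex_mono_def by (metis cantor_set_0)
  then show False using least x(2) by simp
qed

lemma conc_eq_zero_iff: "u \<frown> (\<lambda>_. 0) = (\<lambda>_. 0) \<longleftrightarrow> u = replicate (length u) (0::nat)"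
proof -
  have "(\<lambda>_. 0) = 0 ## (\<lambda>_. 0::nat)"
  proof
    fix i show "0 = (0 ## (\<lambda>_. 0::nat)) i" by (cases i) simp_all
  qed
  then have "a ## \<omega> = (\<lambda>_. 0) \<longleftrightarrow> a = 0 \<and> \<omega> = (\<lambda>_. 0)" for a :: nat and \<omega>
    using build_eq[of a \<omega> 0 "\<lambda>_. 0"] by simp
  then show ?thesis by (induction u) auto
qed

section \<open>Binary words at which the state of a transducer is known\<close>

context productive_transducer
begin

text \<open>Phrased through the represented map instead of a run on \<open>p\<close>, because this
  identity between infinite words is what gets composed with group elements.\<close>

definition reach :: "'s \<Rightarrow> 's \<Rightarrow> nat list \<Rightarrow> bool" where
  "reach s q u \<longleftrightarrow> (\<exists>p. set p \<subseteq> {..<n} \<and> (\<forall>\<omega> \<in> cantor_set n. rep s (p \<frown> \<omega>) = u \<frown> rep q \<omega>))"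

lemma reach_refl: "reach s s []"
  unfolding reach_def by (auto intro!: exI[of _ "[]"])

lemma reach_step:
  assumes "reach s q u" "a < n"
  shows "reach s (snd (T q ! a)) (u @ fst (T q ! a))"
proof -
  obtain p where p: "set p \<subseteq> {..<n}" "\<And>\<omega>. \<omega> \<in> cantor_set n \<Longrightarrow> rep s (p \<frown> \<omega>) = u \<frown> rep q \<omega>"
    using assms(1) unfolding reach_def by blast
  have "rep s ((p @ [a]) \<frown> \<omega>) = (u @ fst (T q ! a)) \<frown> rep (snd (T q ! a)) \<omega>"
    if "\<omega> \<in> cantor_set n" for \<omega>
    using p(2)[of "a ## \<omega>"] that assms(2) by (simp add: rep_build)
  then show ?thesis using p(1) assms(2) unfolding reach_def by (intro exI[of _ "p @ [a]"]) auto
qed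

text \<open>If the colour \<open>z\<close> is on neither side of an edge, it is the colour between
  the two edges below. These have \<open>z\<close> on the right and on the left respectively, so the
  state is known one letter later.\<close>

definition classified :: "'s \<Rightarrow> 's \<Rightarrow> 's \<Rightarrow> nat \<Rightarrow> nat list \<Rightarrow> bool" where
  "classified s qr ql z u \<longleftrightarrow>
     (if snd (sides 0 1 u) = z then reach s qr u
      else if fst (sides 0 1 u) = z then reach s ql u
      else reach s qr (u @ [0]) \<and> reach s ql (u @ [1]))"

end

text \<open>The words whose edge has the colour \<open>z\<close> on the right (left) are those read off by the
  transducer when it reaches the state \<open>qr\<close> (\<open>ql\<close>); the words consisting of zeros, which end in
  \<open>q0\<close> for one of the two parities of their length, are an exception.\<close>

locale jones_transducer = ordered_transducer T 3 I for T :: "'s transducer" and I +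
  fixes s0 q0 qr ql :: 's and z :: nat and par :: bool
  assumes full: "I s0 = cantor_set 2" "I q0 = cantor_set 2" "I qr = cantor_set 2" "I ql = cantor_set 2"
    and z: "z \<in> {0, 1, 2}"
    and qr_steps: "reach s0 qr u \<Longrightarrow> reach s0 qr (u @ [0, 0]) \<and> reach s0 ql (u @ [0, 1]) \<and> reach s0 qr (u @ [1])"
    and ql_steps: "reach s0 ql u \<Longrightarrow> reach s0 ql (u @ [0]) \<and> reach s0 qr (u @ [1, 0]) \<and> reach s0 ql (u @ [1, 1])"
    and zeros: "even k = par \<Longrightarrow> reach s0 q0 (replicate k 0)"
    and first_one: "classified s0 qr ql z (replicate k 0 @ [1])"
begin

text \<open>An edge with \<open>z\<close> on one side has one child that keeps \<open>z\<close> on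
  that side and one that has \<open>z\<close> on neither side. The one- and two-letter steps of
  \<open>qr\<close> and \<open>ql\<close> provide exactly the states required for these
  children.\<close>

lemma classified_snoc:
  assumes "classified s0 qr ql z u" "x = 0 \<or> x = 1"
  shows "classified s0 qr ql z (u @ [x])"
proof -
  obtain p q where pq: "sides 0 1 u = (p, q)" by (metis surj_pair)
  show ?thesis
    using assms z qr_steps[of u] ql_steps[of u] sides_distinct[of u]
    unfolding classified_def sides_snoc pq by (auto simp: Let_def)
qed

lemma classified_nonzero:
  assumes "set u \<subseteq> {..<2}" "u \<noteq> replicate (length u) 0"
  shows "classified s0 qr ql z u"
  using assms
proof (induction u rule: rev_induct)
  case (snoc x u)
  have x: "x = 0 \<or> x = 1" using snoc.prems(1) by auto
  show ?case
  proof (cases "u = replicate (length u) 0")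
    case True
    have "x \<noteq> 0"
    proof
      assume "x = 0"
      then have "u @ [x] = replicate (length (u @ [x])) 0"
        by (subst True) (simp add: replicate_append_same)
      then show False using snoc.prems(2) by blast
    qed
    then show ?thesis using first_one[of "length u"] x True by metis
  next
    case False
    then show ?thesis using snoc x by (intro classified_snoc) auto
  qed
qed simp

lemma psi_conjugation: "conjugation 3 (rep s0)"
  using rep_mono rep_image full(1) by unfold_locales simp_all

abbreviation transfers :: "(nat word \<Rightarrow> nat word) \<Rightarrow> nat word \<Rightarrow> bool" where
  "transfers f \<xi> \<equiv> \<exists>p p' \<eta>. \<eta> \<in> cantor_set 3 \<and> \<xi> = p \<frown> \<eta> \<and> set p' \<subseteq> {..<3} \<and>
      (\<forall>\<omega> \<in> cantor_set 3. f (rep s0 (p \<frown> \<omega>)) = rep s0 (p' \<frown> \<omega>))"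

text \<open>If \<open>p\<close> and \<open>p'\<close> make the transducer write \<open>u\<close> and
  \<open>v\<close> and end in the same state, then replacing \<open>u\<close> by \<open>v\<close>
  amounts to replacing \<open>p\<close> by \<open>p'\<close>. The full image of that state ensures
  that the given point lies below \<open>p\<close>.\<close>

lemma transfer:
  assumes "reach s0 q u" "reach s0 q v" "I q = cantor_set 2" "\<xi> \<in> cantor_set 3"
    and "rep s0 \<xi> = u \<frown> \<eta>" "\<eta> \<in> cantor_set 2"
    and f: "\<And>\<zeta>. \<zeta> \<in> cantor_set 2 \<Longrightarrow> f (u \<frown> \<zeta>) = v \<frown> \<zeta>"
  shows "transfers f \<xi>"
proof -
  obtain p where p: "set p \<subseteq> {..<3}" "\<And>\<omega>. \<omega> \<in> cantor_set 3 \<Longrightarrow> rep s0 (p \<frown> \<omega>) = u \<frown> rep q \<omega>"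
    using assms(1) unfolding reach_def by blast
  obtain p' where p': "set p' \<subseteq> {..<3}" "\<And>\<omega>. \<omega> \<in> cantor_set 3 \<Longrightarrow> rep s0 (p' \<frown> \<omega>) = v \<frown> rep q \<omega>"
    using assms(2) unfolding reach_def by blast
  obtain \<omega> where \<omega>: "\<omega> \<in> cantor_set 3" "\<eta> = rep q \<omega>"
    using rep_surj[of \<eta> q] assms(3,6) by blast
  have "rep s0 \<xi> = rep s0 (p \<frown> \<omega>)" using assms(5) p(2)[OF \<omega>(1)] \<omega>(2) by simp
  then have "\<xi> = p \<frown> \<omega>"
    using lex_mono_inj_on[OF rep_mono[of s0]] assms(4) \<omega>(1) p(1) by (simp add: inj_on_eq_iff)
  moreover have "f (rep s0 (p \<frown> \<omega>)) = rep s0 (p' \<frown> \<omega>)" if "\<omega> \<in> cantor_set 3" for \<omega>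
    using p(2)[OF that] p'(2)[OF that] f[OF rep_closed[OF that]] by simp
  ultimately show ?thesis using \<omega>(1) p'(1) by blast
qed

lemma transfer_nonzero:
  assumes "set u \<subseteq> {..<2}" "u \<noteq> replicate (length u) 0"
    and "set v \<subseteq> {..<2}" "v \<noteq> replicate (length v) 0"
    and sides: "sides 0 1 u = sides 0 1 v"
    and \<xi>: "\<xi> \<in> cantor_set 3" "rep s0 \<xi> = u \<frown> \<eta>" "\<eta> \<in> cantor_set 2"
    and f: "\<And>\<zeta>. \<zeta> \<in> cantor_set 2 \<Longrightarrow> f (u \<frown> \<zeta>) = v \<frown> \<zeta>"
  shows "transfers f \<xi>"
proof -
  have u: "classified s0 qr ql z u" and v: "classified s0 qr ql z v"
    using assms by (intro classified_nonzero; simp)+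
  consider "snd (sides 0 1 u) = z" | "snd (sides 0 1 u) \<noteq> z" "fst (sides 0 1 u) = z"
    | "snd (sides 0 1 u) \<noteq> z" "fst (sides 0 1 u) \<noteq> z" by blast
  then show ?thesis
  proof cases
    case 1
    then have "reach s0 qr u" "reach s0 qr v" using u v sides unfolding classified_def by simp_all
    from transfer[OF this full(3) \<xi> f] show ?thesis .
  next
    case 2
    then have "reach s0 ql u" "reach s0 ql v" using u v sides unfolding classified_def by simp_all
    from transfer[OF this full(4) \<xi> f] show ?thesis .
  next
    case 3
    \<comment> \<open>Here both words are classified only one letter later, so the next letter of
      \<open>\<eta>\<close> selects the pair of children to be matched.\<close>
    then have r: "reach s0 qr (u @ [0])" "reach s0 qr (v @ [0])" "reach s0 ql (u @ [1])" "reach s0 ql (v @ [1])"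
      using u v sides unfolding classified_def by simp_all
    have f': "f ((u @ [x]) \<frown> \<zeta>) = (v @ [x]) \<frown> \<zeta>" if "\<zeta> \<in> cantor_set 2" "x < 2" for x \<zeta>
      using f[of "x ## \<zeta>"] that by simp
    from \<xi>(3) show ?thesis
    proof (rule cantor_set_2_cases)
      fix \<zeta> assume "\<eta> = 0 ## \<zeta>" "\<zeta> \<in> cantor_set 2"
      then show ?thesis using \<xi> f' by (intro transfer[OF r(1,2) full(3), of _ \<zeta>]) simp_all
    next
      fix \<zeta> assume "\<eta> = Suc 0 ## \<zeta>" "\<zeta> \<in> cantor_set 2"
      then show ?thesis using \<xi> f' by (intro transfer[OF r(3,4) full(4), of _ \<zeta>]) simp_all
    qed
  qed
qed

lemma jones_subgroup_conjugated: "jones_subgroup \<subseteq> conjugated_thompson 3 (rep s0)"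
proof
  interpret conjugation 3 "rep s0" by (rule psi_conjugation)
  fix f assume f: "f \<in> jones_subgroup"
  then have fF: "f \<in> carrier thompson_F" unfolding jones_subgroup_def by blast
  show "f \<in> conjugated_thompson 3 (rep s0)"
  proof (rule conjugated_thompsonI[OF fF])
    fix \<xi> assume \<xi>: "\<xi> \<in> cantor_set 3"
    obtain u v \<eta> where uv: "rep s0 \<xi> = u \<frown> \<eta>" "\<eta> \<in> cantor_set 2" "set u \<subseteq> {..<2}" "set v \<subseteq> {..<2}"
      "\<And>\<zeta>. \<zeta> \<in> cantor_set 2 \<Longrightarrow> f (u \<frown> \<zeta>) = v \<frown> \<zeta>" "sides 0 1 u = sides 0 1 v"
      by (rule jones_subgroup_local[OF f rep_closed[OF \<xi>, of s0]]) (rule that)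
    \<comment> \<open>Fixing the least point, \<open>f\<close> matches a word of zeros only with a
      word of zeros, so the exceptional words are never matched with classified ones.\<close>
    have "f (\<lambda>_. 0) = (\<lambda>_. 0)" by (rule thompson_fixes_zero[OF fF]) simp
    moreover have "f (u \<frown> (\<lambda>_. 0)) = v \<frown> (\<lambda>_. 0)" "u \<frown> (\<lambda>_. 0) \<in> cantor_set 2"
      using uv(3) by (simp_all add: uv(5))
    ultimately have "u \<frown> (\<lambda>_. 0) = (\<lambda>_. 0) \<longleftrightarrow> v \<frown> (\<lambda>_. 0) = (\<lambda>_. 0)"
      using thompson_inj_on[OF fF] by (metis cantor_set_0 inj_onD zero_less_numeral)
    then have zero_iff: "u = replicate (length u) 0 \<longleftrightarrow> v = replicate (length v) 0"
      unfolding conc_eq_zero_iff .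
    show "transfers f \<xi>"
    proof (cases "u = replicate (length u) 0")
      case False
      then show ?thesis using zero_iff by (intro transfer_nonzero[OF uv(3) _ uv(4) _ uv(6) \<xi> uv(1,2,5)]) simp_all
    next
      case True
      define k l where "k = length u" and "l = length v"
      have u: "u = replicate k 0" and v: "v = replicate l 0"
        using True zero_iff unfolding k_def l_def by simp_all
      \<comment> \<open>Along zeros the left colour is constant and the right colour alternates, so
        the sides reveal the parity of the length.\<close>
      have par: "even k = even l" using uv(6) unfolding u v sides_zeros by (simp split: if_splits)
      show ?thesis
      proof (cases "even k = par")
        case True
        then have "reach s0 q0 u" "reach s0 q0 v"
          using zeros[of k] zeros[of l] par unfolding u v by simp_all
        from transfer[OF this full(2) \<xi> uv(1,2,5)] show ?thesis .
      next
        case False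
        \<comment> \<open>At the wrong parity one more letter is read: a 0 corrects the parity of
          both words, and a 1 leads to words that are classified.\<close>
        from uv(2) show ?thesis
        proof (rule cantor_set_2_cases)
          fix \<zeta> assume z: "\<eta> = 0 ## \<zeta>" "\<zeta> \<in> cantor_set 2"
          have r: "replicate (Suc m) (0::nat) = replicate m 0 @ [0]" for m by (simp add: replicate_append_same)
          show ?thesis
          proof (rule transfer[OF zeros[of "Suc k"] zeros[of "Suc l"] full(2) \<xi> _ z(2)])
            show "rep s0 \<xi> = replicate (Suc k) 0 \<frown> \<zeta>" unfolding uv(1) r u z(1) by simp
            show "f (replicate (Suc k) 0 \<frown> \<zeta>) = replicate (Suc l) 0 \<frown> \<zeta>" if "\<zeta> \<in> cantor_set 2" for \<zeta>
              using uv(5)[of "0 ## \<zeta>"] that unfolding r u v by simp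
          qed (use False par in auto)
        next
          fix \<zeta> assume z: "\<eta> = Suc 0 ## \<zeta>" "\<zeta> \<in> cantor_set 2"
          have one: "w @ [1::nat] \<noteq> replicate (length (w @ [1])) 0" for w
            by (metis in_set_conv_decomp in_set_replicate one_neq_zero)
          show ?thesis
          proof (rule transfer_nonzero[OF _ one _ one _ \<xi> _ z(2)])
            show "set (u @ [1]) \<subseteq> {..<2}" "set (v @ [1]) \<subseteq> {..<2}" using uv(3,4) by auto
            show "sides 0 1 (u @ [1]) = sides 0 1 (v @ [1])" using uv(6) by (simp add: sides_snoc)
            show "rep s0 \<xi> = (u @ [1]) \<frown> \<zeta>" using uv(1) z(1) by simp
            show "f ((u @ [1]) \<frown> \<zeta>) = (v @ [1]) \<frown> \<zeta>" if "\<zeta> \<in> cantor_set 2" for \<zeta>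
              using uv(5)[of "1 ## \<zeta>"] that by simp
          qed
        qed
      qed
    qed
  qed
qed

end

lemma reach_M0_zeros: "even k \<Longrightarrow> tM0.reach M0_X M0_X (replicate k 0)"
proof (induction k rule: nat_less_induct)
  case (1 k)
  show ?case
  proof (cases "k = 0")
    case True
    then show ?thesis by (simp add: tM0.reach_refl)
  next
    case False
    then obtain m where m: "k = Suc (Suc m)" using 1(2) by (metis even_Suc not0_implies_Suc odd_one One_nat_def)
    then have "tM0.reach M0_X M0_X (replicate m 0)" using 1 by simp
    from tM0.reach_step[OF this, of 0] have "tM0.reach M0_X M0_X (replicate m 0 @ [0, 0])" by simp
    moreover have "replicate m (0::nat) @ [0, 0] = replicate k 0"
      unfolding m using replicate_append_same[of m "0::nat"] by (simp add: replicate_app_Cons_same)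
    ultimately show ?thesis by simp
  qed
qed

lemma reach_M1_zeros: "odd k \<Longrightarrow> tM1.reach M1_E M1_L (replicate k 0)"
proof (induction k rule: nat_less_induct)
  case (1 k)
  show ?case
  proof (cases "k = 1")
    case True
    then show ?thesis using tM1.reach_step[OF tM1.reach_refl[of M1_E], of 0] by simp
  next
    case False
    then obtain m where m: "k = Suc (Suc m)" using 1(2) by (metis even_zero not0_implies_Suc One_nat_def)
    then have "tM1.reach M1_E M1_L (replicate m 0)" using 1 by simp
    from tM1.reach_step[OF this, of 0] have "tM1.reach M1_E M1_L (replicate m 0 @ [0, 0])" by simp
    moreover have "replicate m (0::nat) @ [0, 0] = replicate k 0"
      unfolding m using replicate_append_same[of m "0::nat"] by (simp add: replicate_app_Cons_same)
    ultimately show ?thesis by simp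
  qed
qed

text \<open>The colour 2 is the one missing at the root. After an even number of zeros the sides are
  (0,1), and a further 1 gives (2,1), read off in \<open>M0_Z\<close>; after an odd number they are
  (0,2), and a further 1 gives (1,2), read off in \<open>M0_Y\<close>.\<close>

interpretation jM0: jones_transducer T_M0 "\<lambda>_. cantor_set 2" M0_X M0_X M0_Y M0_Z 2 True
proof
  fix u
  show "tM0.reach M0_X M0_Y (u @ [0, 0]) \<and> tM0.reach M0_X M0_Z (u @ [0, 1]) \<and> tM0.reach M0_X M0_Y (u @ [1])"
    if "tM0.reach M0_X M0_Y u"
    using tM0.reach_step[OF that, of 0] tM0.reach_step[OF that, of 1] tM0.reach_step[OF that, of 2] by simp
  show "tM0.reach M0_X M0_Z (u @ [0]) \<and> tM0.reach M0_X M0_Y (u @ [1, 0]) \<and> tM0.reach M0_X M0_Z (u @ [1, 1])"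
    if "tM0.reach M0_X M0_Z u"
    using tM0.reach_step[OF that, of 0] tM0.reach_step[OF that, of 1] tM0.reach_step[OF that, of 2] by simp
next
  fix k
  show "tM0.reach M0_X M0_X (replicate k 0)" if "even k = True" using that reach_M0_zeros by simp
  show "tM0.classified M0_X M0_Y M0_Z 2 (replicate k 0 @ [1])"
  proof (cases "even k")
    case True
    then have "tM0.reach M0_X M0_Z (replicate k 0 @ [1])"
      using tM0.reach_step[OF reach_M0_zeros[OF True], of 2] by simp
    then show ?thesis using True by (simp add: tM0.classified_def sides_snoc sides_zeros[unfolded One_nat_def])
  next
    case False
    then obtain m where m: "k = Suc m" "even m" by (cases k) auto
    have "replicate k (0::nat) @ [1] = replicate m 0 @ [0, 1]" unfolding m(1) by (simp add: replicate_app_Cons_same)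
    then have "tM0.reach M0_X M0_Y (replicate k 0 @ [1])"
      using tM0.reach_step[OF reach_M0_zeros[OF m(2)], of 1] by simp
    then show ?thesis using False by (simp add: tM0.classified_def sides_snoc sides_zeros[unfolded One_nat_def])
  qed
qed simp_all

text \<open>The colour 0 is the one to the left of the root. Every word of zeros followed by a 1
  lacks it on both sides, so only the last clause of \<open>classified\<close> is at stake.
  \<open>M1_L\<close> is reached after odd numbers of zeros, hence \<open>False\<close>.\<close>

interpretation jM1: jones_transducer T_M1 I_M1 M1_E M1_L M1_A M1_B 0 False
proof
  fix u
  show "tM1.reach M1_E M1_A (u @ [0, 0]) \<and> tM1.reach M1_E M1_B (u @ [0, 1]) \<and> tM1.reach M1_E M1_A (u @ [1])"
    if "tM1.reach M1_E M1_A u"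
    using tM1.reach_step[OF that, of 0] tM1.reach_step[OF that, of 1] tM1.reach_step[OF that, of 2] by simp
  show "tM1.reach M1_E M1_B (u @ [0]) \<and> tM1.reach M1_E M1_A (u @ [1, 0]) \<and> tM1.reach M1_E M1_B (u @ [1, 1])"
    if "tM1.reach M1_E M1_B u"
    using tM1.reach_step[OF that, of 0] tM1.reach_step[OF that, of 1] tM1.reach_step[OF that, of 2] by simp
next
  fix k
  show "tM1.reach M1_E M1_L (replicate k 0)" if "even k = False" using that reach_M1_zeros by simp
  have "tM1.reach M1_E M1_A (replicate k 0 @ [1, 0]) \<and> tM1.reach M1_E M1_B (replicate k 0 @ [1, 1])"
  proof (cases "odd k")
    case True
    have "tM1.reach M1_E M1_O (replicate k 0)"
      using tM1.reach_step[OF reach_M1_zeros[OF True], of 2] by simp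
    from tM1.reach_step[OF this, of 1] tM1.reach_step[OF this, of 2] show ?thesis by simp
  next
    case False
    show ?thesis
    proof (cases k)
      case 0
      then show ?thesis
        using tM1.reach_step[OF tM1.reach_refl[of M1_E], of 1] tM1.reach_step[OF tM1.reach_refl[of M1_E], of 2]
        by simp
    next
      case (Suc m)
      then have m: "odd m" using False by simp
      have L: "tM1.reach M1_E M1_L (replicate m 0)" using reach_M1_zeros[OF m] .
      have O: "tM1.reach M1_E M1_O (replicate m 0)"
        using tM1.reach_step[OF L, of 2] by simp
      have "replicate k (0::nat) @ w = replicate m 0 @ 0 # w" for w
        unfolding Suc by (simp add: replicate_app_Cons_same)
      \<comment> \<open>For even \<open>k > 0\<close> the two words come from the state after
        \<open>k - 1\<close> zeros: \<open>M1_L\<close> writes 010 on input 1, and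
        \<open>M1_O\<close>, reached without output, writes 011 on input 0.\<close>
      then show ?thesis using tM1.reach_step[OF L, of 1] tM1.reach_step[OF O, of 0] by simp
    qed
  qed
  then show "tM1.classified M1_E M1_A M1_B 0 (replicate k 0 @ [1])"
    by (simp add: tM1.classified_def sides_snoc sides_zeros[unfolded One_nat_def])
qed (simp_all add: I_M1_def)

text \<open>Compares adjoining \<open>s\<close> to the possibly infinite set \<open>J\<close> with a
  three-element generating set. Only \<open>b\<close> has to be rebuilt, as a member of
  \<open>J\<close> times \<open>s\<close>; \<open>J\<close> is the 3-colorable subgroup
  below.\<close>

lemma (in group) generate_union_singleton_eq:
  assumes J: "J \<subseteq> carrier G" and s: "s \<in> carrier G" and b: "b \<in> carrier G"
    and "a \<in> J" "b \<otimes> inv s \<in> J" "J \<subseteq> generate G {s, a, b}"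
  shows "generate G (J \<union> {s}) = generate G {s, a, b}"
proof
  have carr: "{s, a, b} \<subseteq> carrier G" "J \<union> {s} \<subseteq> carrier G" using assms by auto
  have "s \<in> generate G {s, a, b}" by (intro generate.incl) simp
  then show "generate G (J \<union> {s}) \<subseteq> generate G {s, a, b}"
    using assms(6) by (intro generate_subgroup_incl[OF _ generate_is_subgroup[OF carr(1)]]) simp
  have gens: "s \<in> generate G (J \<union> {s})" "a \<in> generate G (J \<union> {s})" "b \<otimes> inv s \<in> generate G (J \<union> {s})"
    using assms(4,5) by (intro generate.incl; simp)+
  moreover have "b = b \<otimes> inv s \<otimes> s" using s b by (simp add: m_assoc)
  ultimately have "b \<in> generate G (J \<union> {s})" using generate.eng by metis
  then show "generate G {s, a, b} \<subseteq> generate G (J \<union> {s})"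
    using gens(1,2) by (intro generate_subgroup_incl[OF _ generate_is_subgroup[OF carr(2)]]) simp
qed

lemma jones_subgroup_subset: "jones_subgroup \<subseteq> carrier thompson_F"
  by (auto simp: jones_subgroup_def)

lemma M0_eq_conjugated: "M0 = conjugated_thompson 3 psi_0"
proof -
  have "conjugated_thompson 3 psi_0 = generate thompson_F (c0.transport ` {gen 2 0, gen 2 1, gen 2 2})"
    by (rule c0.conjugated_thompson_generate[OF thompson_3_generated])
      (simp add: transport_M0[unfolded One_nat_def])
  also have "\<dots> = generate thompson_F (jones_subgroup \<union> {x_0 \<otimes>\<^bsub>thompson_F\<^esub> x_0})"
    unfolding image_insert image_empty transport_M0
  proof (rule F.generate_union_singleton_eq[symmetric, OF jones_subgroup_subset _ _ jones_elements(1,2)])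
    show "jones_subgroup \<subseteq> generate thompson_F {x_0 \<otimes>\<^bsub>thompson_F\<^esub> x_0,
        x_0 \<otimes>\<^bsub>thompson_F\<^esub> x_1 \<otimes>\<^bsub>thompson_F\<^esub> x_1 \<otimes>\<^bsub>thompson_F\<^esub> inv\<^bsub>thompson_F\<^esub> x_0,
        x_1 \<otimes>\<^bsub>thompson_F\<^esub> x_gen 2}"
      using jM0.jones_subgroup_conjugated calculation
      unfolding psi_0_def[symmetric] image_insert image_empty transport_M0 by blast
  qed simp_all
  also have "\<dots> = M0" by (simp add: M0_def F.int_pow_2)
  finally show ?thesis ..
qed

lemma M1_eq_conjugated: "M1 = conjugated_thompson 3 psi_1"
proof -
  \<comment> \<open>The generators are listed with \<open>gen 2 1\<close> in front, since its
    conjugate is the extra generator x_1^2.\<close>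
  have "conjugated_thompson 3 psi_1 = generate thompson_F (c1.transport ` {gen 2 1, gen 2 0, gen 2 2})"
    by (rule c1.conjugated_thompson_generate)
      (simp_all add: transport_M1[unfolded One_nat_def] thompson_3_generated insert_commute)
  also have "\<dots> = generate thompson_F (jones_subgroup \<union> {x_1 \<otimes>\<^bsub>thompson_F\<^esub> x_1})"
    unfolding image_insert image_empty transport_M1
  proof (rule F.generate_union_singleton_eq[symmetric, OF jones_subgroup_subset _ _ jones_elements(3,4)])
    show "jones_subgroup \<subseteq> generate thompson_F {x_1 \<otimes>\<^bsub>thompson_F\<^esub> x_1,
        x_0 \<otimes>\<^bsub>thompson_F\<^esub> x_0 \<otimes>\<^bsub>thompson_F\<^esub> x_1 \<otimes>\<^bsub>thompson_F\<^esub> inv\<^bsub>thompson_F\<^esub> x_gen 2,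
        x_gen 2 \<otimes>\<^bsub>thompson_F\<^esub> x_gen 3}"
      using jM1.jones_subgroup_conjugated calculation
      unfolding psi_1_def[symmetric] image_insert image_empty transport_M1 by blast
  qed simp_all
  also have "\<dots> = M1" by (simp add: M1_def F.int_pow_2)
  finally show ?thesis ..
qed

section \<open>The flip automorphism\<close>

lemma flip_conc: "flip (u \<frown> \<omega>) = map (\<lambda>a. 1 - a) u \<frown> flip \<omega>"
  by (auto simp: flip_def conc_def fun_eq_iff)

lemma flip_closed [simp]: "flip \<omega> \<in> cantor_set 2"
proof -
  have "1 - \<omega> i < 2" for i by linarith
  then show ?thesis by (simp add: flip_def cantor_set_def)
qed

lemma flip_flip [simp]: "\<omega> \<in> cantor_set 2 \<Longrightarrow> flip (flip \<omega>) = \<omega>"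
  unfolding flip_def cantor_set_def by (intro ext) (simp add: less_2_cases_iff, metis diff_self_eq_0 diff_zero)

lemma flip_image: "flip ` cantor_set 2 = cantor_set 2"
proof
  show "cantor_set 2 \<subseteq> flip ` cantor_set 2" by (metis flip_closed flip_flip image_eqI subsetI)
qed auto

lemma less_fun_flip:
  assumes "x \<in> cantor_set 2" "y \<in> cantor_set 2" "less_fun x y"
  shows "less_fun (flip y) (flip x)"
proof -
  obtain k where k: "x k < y k" "\<And>j. j < k \<Longrightarrow> x j = y j"
    using assms(3) by (auto elim: less_funE)
  have "y k < 2" using assms(2) by (simp add: cantor_set_def)
  then have "flip y k < flip x k" using k(1) by (simp add: flip_def)
  moreover have "flip y j = flip x j" if "j < k" for j using k(2)[OF that] by (simp add: flip_def)
  ultimately show ?thesis unfolding less_fun_def by blast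
qed

lemma sigma_F_app: "\<omega> \<in> cantor_set 2 \<Longrightarrow> sigma_F f \<omega> = flip (f (flip \<omega>))"
  by (simp add: sigma_F_def)

lemma sigma_F_replaces:
  assumes "set u \<subseteq> {..<2}" "\<omega> \<in> cantor_set 2"
    and "\<And>\<omega>. \<omega> \<in> cantor_set 2 \<Longrightarrow> f (u \<frown> \<omega>) = v \<frown> \<omega>"
  shows "sigma_F f (map (\<lambda>a. 1 - a) u \<frown> \<omega>) = map (\<lambda>a. 1 - a) v \<frown> \<omega>"
proof -
  have "map (\<lambda>a. 1 - a) (map (\<lambda>a. 1 - a) u) = u"
    using assms(1) by (induction u) (auto simp: less_2_cases_iff)
  then have "flip (map (\<lambda>a. 1 - a) u \<frown> \<omega>) = u \<frown> flip \<omega>" by (simp only: flip_conc)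
  moreover have "map (\<lambda>a. 1 - a) u \<frown> \<omega> \<in> cantor_set 2" using assms(2) by auto
  ultimately show ?thesis
    using assms(2) by (simp add: sigma_F_app assms(3) flip_conc)
qed

lemma sigma_F_carrier:
  assumes "f \<in> carrier thompson_F"
  shows "sigma_F f \<in> carrier thompson_F"
proof (rule thompsonI)
  note f = assms[unfolded thompson_carrier_iff[OF zero_less_numeral]]
  show "sigma_F f \<in> extensional (cantor_set 2)" by (simp add: sigma_F_def)
  have "sigma_F f ` cantor_set 2 = flip ` f ` flip ` cantor_set 2"
    unfolding image_image by (intro image_cong refl) (simp add: sigma_F_app)
  also have "\<dots> = cantor_set 2" using f flip_image by simp
  finally show "sigma_F f ` cantor_set 2 = cantor_set 2" .
  show "lex_mono 2 (sigma_F f)"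
    unfolding lex_mono_def
  proof (intro ballI impI)
    fix x y assume xy: "x \<in> cantor_set 2" "y \<in> cantor_set 2" "less_fun x y"
    then have "less_fun (f (flip y)) (f (flip x))"
      using f less_fun_flip[OF xy] unfolding lex_mono_def by simp
    then show "less_fun (sigma_F f x) (sigma_F f y)"
      unfolding sigma_F_app[OF xy(1)] sigma_F_app[OF xy(2)]
      by (intro less_fun_flip thompson_app_closed[OF assms] flip_closed)
  qed
  show "locally_replacing 2 (sigma_F f)"
    unfolding locally_replacing_def
  proof
    fix x assume x: "x \<in> cantor_set 2"
    obtain u v \<eta> where u: "\<eta> \<in> cantor_set 2" "flip x = u \<frown> \<eta>"
      "\<And>\<omega>. \<omega> \<in> cantor_set 2 \<Longrightarrow> f (u \<frown> \<omega>) = v \<frown> \<omega>"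
      using f flip_closed[of x] unfolding locally_replacing_def by metis
    have "u \<frown> \<eta> \<in> cantor_set 2" using u(2) flip_closed[of x] by metis
    then have "set u \<subseteq> {..<2}" by simp
    moreover have "x = map (\<lambda>a. 1 - a) u \<frown> flip \<eta>"
      using u(2) x flip_conc by (metis flip_flip)
    ultimately show "\<exists>u v \<eta>. \<eta> \<in> cantor_set 2 \<and> x = u \<frown> \<eta> \<and>
        (\<forall>\<omega>\<in>cantor_set 2. sigma_F f (u \<frown> \<omega>) = v \<frown> \<omega>)"
      using sigma_F_replaces[of u _ f v] u(3) flip_closed by blast
  qed
qed simp

lemma sigma_F_sigma_F:
  assumes "f \<in> carrier thompson_F"
  shows "sigma_F (sigma_F f) = f"
proof (rule thompson_eqI)
  fix x assume x: "x \<in> cantor_set 2"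
  then show "sigma_F (sigma_F f) x = f x"
    using thompson_app_closed[OF assms x] by (simp add: sigma_F_app)
qed (use assms sigma_F_carrier in blast)+

lemma sigma_F_mult:
  assumes "f \<in> carrier thompson_F" "g \<in> carrier thompson_F"
  shows "sigma_F (f \<otimes>\<^bsub>thompson_F\<^esub> g) = sigma_F f \<otimes>\<^bsub>thompson_F\<^esub> sigma_F g"
proof (rule thompson_eqI)
  fix x assume x: "x \<in> cantor_set 2"
  have "f (flip x) \<in> cantor_set 2" using assms(1) by (rule thompson_app_closed) simp
  then show "sigma_F (f \<otimes>\<^bsub>thompson_F\<^esub> g) x = (sigma_F f \<otimes>\<^bsub>thompson_F\<^esub> sigma_F g) x"
    using x by (simp add: sigma_F_app)
qed (use assms sigma_F_carrier F.m_closed in blast)+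

lemma sigma_F_iso: "sigma_F \<in> iso thompson_F thompson_F"
proof -
  have "bij_betw sigma_F (carrier thompson_F) (carrier thompson_F)"
    by (rule bij_betw_byWitness[of _ sigma_F]) (auto simp: sigma_F_sigma_F sigma_F_carrier)
  then show ?thesis
    by (auto simp: iso_def hom_def sigma_F_mult sigma_F_carrier)
qed

section \<open>Mirror images of tree diagrams and their colourings\<close>

fun mirror :: "bintree \<Rightarrow> bintree" where
  "mirror Leaf = Leaf"
| "mirror (Caret l r) = Caret (mirror r) (mirror l)"

lemma leaves_mirror: "leaves (mirror T) = rev (map (map (\<lambda>a. 1 - a)) (leaves T))"
  by (induction T) (simp_all add: rev_map)

lemma length_leaves_mirror [simp]: "length (leaves (mirror T)) = length (leaves T)"
  by (simp add: leaves_mirror)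

text \<open>In a picture with \<open>N\<close> leaves the reflection sends region \<open>p\<close>
  to \<open>N - p\<close> and exchanges left and right. A subtree occupying the leaves from
  \<open>i\<close> onwards then starts at \<open>N - (i + length (leaves T))\<close>.\<close>

lemma edge_sides_mirror:
  assumes "(p, q) \<in> edge_sides (N - (i + length (leaves T))) (mirror T)" "i + length (leaves T) \<le> N"
  shows "\<exists>(p', q') \<in> edge_sides i T. p = N - q' \<and> q = N - p'"
  using assms
proof (induction T arbitrary: i)
  case (Caret l r)
  let ?l = "length (leaves l)" and ?r = "length (leaves r)"
  have "N - (i + (?l + ?r)) + ?r = N - (i + ?l)" using Caret.prems(2) by simp
  with Caret.prems(1) consider "p = N - (i + (?l + ?r))" "q = N - i"
    | "(p, q) \<in> edge_sides (N - (i + ?l + ?r)) (mirror r)"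
    | "(p, q) \<in> edge_sides (N - (i + ?l)) (mirror l)"
    using Caret.prems(2) by (auto simp: add.assoc add.commute[of ?r])
  then show ?case
  proof cases
    case 1
    then show ?thesis by auto
  next
    case 2
    then show ?thesis using Caret.IH(2)[of "i + ?l"] Caret.prems(2) by auto
  next
    case 3
    then show ?thesis using Caret.IH(1)[of i] Caret.prems(2) by auto
  qed
qed auto

lemma sigma_F_jones_subgroup:
  assumes "f \<in> jones_subgroup"
  shows "sigma_F f \<in> jones_subgroup"
proof -
  obtain S T where ST: "tree_diagram f S T" "three_colorable S T" and f: "f \<in> carrier thompson_F"
    using assms unfolding jones_subgroup_def by blast
  obtain c :: "nat \<Rightarrow> nat" where c: "c ` {0..length (leaves S)} \<subseteq> {0, 1, 2}"
    "\<forall>(p, q) \<in> edge_sides 0 S \<union> edge_sides 0 T. c p \<noteq> c q"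
    using ST(2) unfolding three_colorable_def by blast
  let ?k = "length (leaves S)"
  have len: "length (leaves T) = ?k"
    and rep: "\<And>i \<omega>. i < ?k \<Longrightarrow> \<omega> \<in> cantor_set 2 \<Longrightarrow> f (leaves S ! i \<frown> \<omega>) = leaves T ! i \<frown> \<omega>"
    using ST(1) unfolding tree_diagram_def replaces_prefixes_def by auto
  have "tree_diagram (sigma_F f) (mirror S) (mirror T)"
    unfolding tree_diagram_def replaces_prefixes_def
  proof (intro conjI allI impI ballI)
    fix i \<omega> assume i: "i < length (leaves (mirror S))" and \<omega>: "\<omega> \<in> cantor_set 2"
    let ?j = "?k - Suc i"
    have j: "?j < ?k" using i by simp
    have "leaves (mirror S) ! i = map (\<lambda>a. 1 - a) (leaves S ! ?j)"
      "leaves (mirror T) ! i = map (\<lambda>a. 1 - a) (leaves T ! ?j)"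
      using i len by (simp_all add: leaves_mirror rev_nth)
    then show "sigma_F f (leaves (mirror S) ! i \<frown> \<omega>) = leaves (mirror T) ! i \<frown> \<omega>"
      using sigma_F_replaces[OF leaves_letters[OF nth_mem[OF j]] \<omega> rep[OF j]] by simp
  qed (simp add: len)
  moreover have "three_colorable (mirror S) (mirror T)"
    unfolding three_colorable_def
  proof (intro exI[of _ "\<lambda>i. c (?k - i)"] conjI)
    show "(\<lambda>i. c (?k - i)) ` {0..length (leaves (mirror S))} \<subseteq> {0, 1, 2}"
      using c(1) by (auto simp: image_subset_iff)
    \<comment> \<open>Regions beside an edge are numbered at most by the number of leaves, so the
      truncated subtraction from \<open>?k\<close> is undone by subtracting again.\<close>
    have le: "p \<le> i + length (leaves U) \<and> q \<le> i + length (leaves U)" if "(p, q) \<in> edge_sides i U" for p q i U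
      using that by (induction U arbitrary: i) fastforce+
    have "c (?k - p) \<noteq> c (?k - q)" if mem: "(p, q) \<in> edge_sides 0 (mirror U)" and U: "U = S \<or> U = T" for p q U
    proof -
      have k: "length (leaves U) = ?k" using U len by auto
      then obtain p' q' where pq: "(p', q') \<in> edge_sides 0 U" "p = ?k - q'" "q = ?k - p'"
        using edge_sides_mirror[of p q ?k 0 U] mem by auto
      have "?k - p = q'" "?k - q = p'" using le[OF pq(1)] k pq(2,3) by simp_all
      moreover have "c p' \<noteq> c q'" using c(2) pq(1) U by blast
      ultimately show ?thesis by simp
    qed
    then show "\<forall>(p, q) \<in> edge_sides 0 (mirror S) \<union> edge_sides 0 (mirror T). c (?k - p) \<noteq> c (?k - q)"
      by blast
  qed
  ultimately show ?thesis
    using sigma_F_carrier[OF f] unfolding jones_subgroup_def by blast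
qed

lemma sigma_F_image_jones_subgroup: "sigma_F ` jones_subgroup = jones_subgroup"
proof
  show "jones_subgroup \<subseteq> sigma_F ` jones_subgroup"
  proof
    fix f assume f: "f \<in> jones_subgroup"
    then have "f = sigma_F (sigma_F f)" using sigma_F_sigma_F jones_subgroup_subset by (metis subsetD)
    then show "f \<in> sigma_F ` jones_subgroup" using sigma_F_jones_subgroup[OF f] by (rule image_eqI)
  qed
qed (auto intro: sigma_F_jones_subgroup)

text \<open>The flip maps the 3-colorable subgroup onto itself and the extra generator of
  \<open>M_1\<close> to that of \<open>M_2\<close>; a homomorphism carries generated subgroups to
  generated subgroups.\<close>

lemma M2_eq_sigma_F_M1: "M2 = sigma_F ` M1"
proof -
  interpret \<sigma>: group_hom thompson_F thompson_F sigma_F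
    by unfold_locales (use sigma_F_iso in \<open>simp add: iso_def\<close>)
  have "sigma_F ` (jones_subgroup \<union> {x_1 \<otimes>\<^bsub>thompson_F\<^esub> x_1}) =
      jones_subgroup \<union> {sigma_F x_1 \<otimes>\<^bsub>thompson_F\<^esub> sigma_F x_1}"
    unfolding image_Un sigma_F_image_jones_subgroup by (simp add: sigma_F_mult)
  moreover have "jones_subgroup \<union> {x_1 \<otimes>\<^bsub>thompson_F\<^esub> x_1} \<subseteq> carrier thompson_F"
    using jones_subgroup_subset by simp
  ultimately show ?thesis
    using \<sigma>.generate_img[of "jones_subgroup \<union> {x_1 \<otimes>\<^bsub>thompson_F\<^esub> x_1}"]
    by (simp add: M1_def M2_def F.int_pow_2 sigma_F_carrier)
qed

lemma M1_subset: "M1 \<subseteq> carrier thompson_F"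
  unfolding M1_def by (rule F.generate_incl) (use jones_subgroup_subset in simp)

lemma M2_is_iso_M1: "thompson_F\<lparr>carrier := M2\<rparr> \<cong> thompson_F\<lparr>carrier := M1\<rparr>"
proof -
  have M2: "M2 \<subseteq> carrier thompson_F"
    unfolding M2_eq_sigma_F_M1 using M1_subset sigma_F_carrier by blast
  have "sigma_F ` M2 = M1"
    unfolding M2_eq_sigma_F_M1 image_image using M1_subset sigma_F_sigma_F by force
  moreover have "inj_on sigma_F M2" using M2 sigma_F_sigma_F by (metis inj_on_inverseI subsetD)
  moreover have "sigma_F (f \<otimes>\<^bsub>thompson_F\<^esub> g) = sigma_F f \<otimes>\<^bsub>thompson_F\<^esub> sigma_F g"
    if "f \<in> M2" "g \<in> M2" for f g
    using that M2 sigma_F_mult by blast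
  ultimately have "sigma_F \<in> iso (thompson_F\<lparr>carrier := M2\<rparr>) (thompson_F\<lparr>carrier := M1\<rparr>)"
    by (auto simp: iso_def hom_def bij_betw_def)
  then show ?thesis unfolding is_iso_def by blast
qed

theorem mainTheorem12:
  shows "(homeomorphic_map (cantor_space 3) (cantor_space 2) psi_K1)
    \<and> (homeomorphic_map (cantor_space 2) (cantor_space 2) psi_K3)
    \<and> (homeomorphic_map (cantor_space 3) (cantor_space 2) psi_0)
    \<and> (homeomorphic_map (cantor_space 3) (cantor_space 2) psi_1)
    \<and> (sigma_F \<in> iso thompson_F thompson_F)
    \<and> (K1 = conjugated_thompson 3 psi_K1)
    \<and> (thompson_F\<lparr>carrier := K1\<rparr> \<cong> thompson 3)
    \<and> (K3 = conjugated_thompson 2 psi_K3)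
    \<and> (thompson_F\<lparr>carrier := K3\<rparr> \<cong> thompson_F)
    \<and> (M0 = conjugated_thompson 3 psi_0)
    \<and> (thompson_F\<lparr>carrier := M0\<rparr> \<cong> thompson 3)
    \<and> (M1 = conjugated_thompson 3 psi_1)
    \<and> (thompson_F\<lparr>carrier := M1\<rparr> \<cong> thompson 3)
    \<and> (M2 = sigma_F ` M1)
    \<and> (thompson_F\<lparr>carrier := M2\<rparr> \<cong> thompson 3)"
proof -
  have homeo: "homeomorphic_map (cantor_space 3) (cantor_space 2) psi_K1"
    "homeomorphic_map (cantor_space 2) (cantor_space 2) psi_K3"
    "homeomorphic_map (cantor_space 3) (cantor_space 2) psi_0"
    "homeomorphic_map (cantor_space 3) (cantor_space 2) psi_1"
    unfolding psi_K1_def psi_K3_def psi_0_def psi_1_def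
    by (intro oK1.rep_homeomorphic oK3.rep_homeomorphic oM0.rep_homeomorphic oM1.rep_homeomorphic;
        simp add: I_K1_def I_K3_def I_M1_def)+
  have carr: "K1 \<subseteq> carrier thompson_F" "K3 \<subseteq> carrier thompson_F" "M0 \<subseteq> carrier thompson_F"
    unfolding K1_def K3_def M0_def
    by (rule F.generate_incl; use jones_subgroup_subset in simp)+
  have iso: "thompson_F\<lparr>carrier := K1\<rparr> \<cong> thompson 3" "thompson_F\<lparr>carrier := K3\<rparr> \<cong> thompson_F"
    "thompson_F\<lparr>carrier := M0\<rparr> \<cong> thompson 3" "thompson_F\<lparr>carrier := M1\<rparr> \<cong> thompson 3"
    using cK1.conjugated_is_iso cK3.conjugated_is_iso c0.conjugated_is_iso c1.conjugated_is_iso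
      carr M1_subset
    unfolding K1_eq_conjugated[symmetric] K3_eq_conjugated[symmetric]
      M0_eq_conjugated[symmetric] M1_eq_conjugated[symmetric]
    by blast+
  then have "thompson_F\<lparr>carrier := M2\<rparr> \<cong> thompson 3"
    using iso_trans[OF M2_is_iso_M1] by blast
  then show ?thesis
    using homeo sigma_F_iso K1_eq_conjugated K3_eq_conjugated M0_eq_conjugated M1_eq_conjugated
      M2_eq_sigma_F_M1 iso by (intro conjI)
qed

end
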